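(* Consider the algorithm $$X_{n+1}=X_n+a_n b_n(X_n,\xi_n)+a_n h(X_n,\zeta_n)+a_n h_0(\tilde\zeta_n)+a_n\beta_n,\qquad n\ge 0,$$ with values in $\mathbb R^d$, and let $X^n(\cdot)$ be the shifted piecewise linear interpolations of $\{X_n\}$ (see context). Assume that $\{X_n\}$ is bounded w.p.1 and that the following hold. (A-i) $h(\cdot,\zeta)$ is continuous in $x$, uniformly in $\zeta$, on bounded sets of $x$. (A-ii) Either $h$ is a bounded measurable function, or there are non-negative measurable functions $g_1$ (of $x$) and $g_2,g_3$ (of $\zeta$) such that $g_1$ is bounded on bounded sets, $|h(x,\zeta)|\le g_1(x)g_2(\zeta)+g_3(\zeta)$, and for each $\varepsilon>0$ $$\lim_{\Delta\to0}\lim_{n\to\infty}\mathbb P\Big\{\sup_{j\ge n}\max_{t\le\Delta}\sum_{i=m(j\Delta)}^{m(j\Delta+t)-1}a_i[g_2(\zeta_i)+g_3(\zeta_i)]\ge\varepsilon\Big\}=0.$$ (A-iii) There is a continuous function $\bar h:\mathbb R^d\to\mathbb R^d$ such that for some $T>0$, each $\varepsilon>0$ and each $x$, $$\lim_{n\to\infty}\mathbb P\Big\{\sup_{j\ge n}\max_{t\le T}\Big|\sum_{i=m(jT)}^{m(jT+t)-1}a_i\big(h(x,\zeta_i)-\bar h(x)\big)\Big|\ge\varepsilon\Big\}=0.$$ (A-iv) $\{\xi_n\},\{\zeta_n\},\{\tilde\zeta_n\}$ are independent of each other and are exogenous noises, and $h_0$ is measurable such that for some $T>0$ and each $\varepsilon>0$,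 $$\lim_{n\to\infty}\mathbb P\Big\{\sup_{j\ge n}\max_{t\le T}\Big|\sum_{i=m(jT)}^{m(jT+t)-1}a_ih_0(\tilde\zeta_i)\Big|\ge\varepsilon\Big\}=0.$$ (A-v) $\{\beta_n\}$ is a sequence of bounded random variables with $|\beta_n|\to0$ w.p.1. (G) There is a set-valued mapping $G:\mathbb R^d\to2^{\mathbb R^d}$ such that: (i) $G$ has non-empty, compact, convex values, all contained in one finite common ball; (ii) the graph $\{(x,y):y\in G(x)\}$ is closed in $\mathbb R^d\times\mathbb R^d$; (iii) there is a sequence of positive real-valued functions $m_n(x,\xi)$, continuous in $x$ uniformly in $\xi$, such that for all $n,x,\xi$, $b_n(x,\xi)\in G(x)+m_n(x,\xi)\bar B$, and for some $T>0$, each $\varepsilon>0$ and each $x$, $$\lim_{n\to\infty}\mathbb P\Big\{\sup_{j\ge n}\max_{t\le T}\Big|\sum_{i=m(jT)}^{m(jT+t)-1}a_im_i(x,\xi_i)\Big|\ge\varepsilon\Big\}=0.$$ Then: (1) There is a null set $\Omega_0$ such that for all $\omega\notin\Omega_0$, $\{X^n(\cdot)\}$ is bounded and equicontinuous on bounded intervals. (2) (For $\omega\notin\Omega_0$.) If $X(\cdot)$ is the limit of a convergent subsequence of $\{X^n(\cdot)\}$, then $X(\cdot)$ is a solution of the differential inclusion $$\dot X(t)\in\bar h(X(t))+G(X(t)).\qquad( * )$$ (3) The limit set of $X(\cdot)$ is internally chain transitive with respect to $( * )$, and the limit points of $\{X_n\}$ are contained in $\mathcal R$, the set of chain-recurrent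 points of $( * )$. (4) Let $\Lambda$ be a locally asymptotically stable set (in the sense of Lyapunov) for all solutions of $( * )$, with domain of attraction $DA(\Lambda)$. If $\{X_n\}$ visits a compact subset of $DA(\Lambda)$ infinitely often with probability $1$ (resp. with probability $\ge\rho$), then $X_n\to\Lambda$ as $n\to\infty$ with probability $1$ (resp. with probability $\ge\rho$).
   Context: All random variables live on a complete probability space $(\Omega,\mathcal F,\mathbb P)$; $|\cdot|$ is the Euclidean norm on $\mathbb R^d$; $\bar B$ is the closed unit ball of $\mathbb R^d$. For sets, $S+S_1=\{x+y:x\in S,y\in S_1\}$, $kS=\{kx:x\in S\}$. Step sizes: $a_n>0$, $a_n\to0$, $\sum_n a_n=\infty$. The noises $\xi_n,\zeta_n,\tilde\zeta_n$ take values in measurable spaces; $b_n(x,\xi)$, $h(x,\zeta)$, $h_0(\tilde\zeta)$ and $\beta_n$ are $\mathbb R^d$-valued. Exogenous means: the distribution of $\{\xi_i,i>n\}$ conditioned on $\{\xi_i,X_n:i\le n\}$ equals that conditioned on $\{\xi_i:i\le n\}$, and similarly for $\zeta_n$ and $\tilde\zeta_n$. $t_0=0$, $t_n=\sum_{i=0}^{n-1}a_i$; $m(t)=\max\{n:t_n\le t\}$ for $t\ge0$ and $m(t)=0$ for $t<0$. $X^0(\cdot)$ is the piecewise linear interpolation: $X^0(t_n)=X_n$, $X^0(t)=\frac{t_{n+1}-t}{a_n}X_n+\frac{t-t_n}{a_n}X_{n+1}$ for $t\in(t_n,t_{n+1})$. The shifted processes on $(-\infty,\infty)$ are $X^n(t)=X^0(t+t_n)$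 if $t\ge-t_n$, $X^n(t)=X_0$ if $t\le-t_n$. Convergence of functions means uniform convergence on bounded intervals. A solution of $\dot X(t)\in F(X(t))$ is an absolutely continuous (on compact intervals) function satisfying the inclusion for almost every $t$. For a differential inclusion $\dot X\in F(X)$: the limit set of a solution is $L(X)=\bigcap_{t\ge0}\overline{\{X(s):s\ge t\}}$. Points $x,y\in A$ are chain connected in $A$ if for every $\varepsilon>0,T>0$ there are $n\in\mathbb N$, solutions $X_1,\dots,X_n$ and $t_1,\dots,t_n>T$ with $X_i(s)\in A$ for $0\le s\le t_i$, $|X_i(t_i)-X_{i+1}(0)|\le\varepsilon$ for $i\le n-1$, $|X_1(0)-x|\le\varepsilon$, $|X_n(t_n)-y|\le\varepsilon$. $A$ is internally chain transitive if it is compact and all $x,y\in A$ are chain connected in $A$. A point $\theta$ is chain-recurrent if for any $\varepsilon>0,T>0$ there are $n\in\mathbb N$, solutions $X_1,\dots,X_n$ and $t_1,\dots,t_n>T$ with $|X_1(0)-\theta|\le\varepsilon$, $|X_i(t_i)-X_{i+1}(0)|\le\varepsilon$ ($i\le n-1$), $|X_n(t_n)-\theta|\le\varepsilon$. $\Lambda$ is locally asymptotically stable (Lyapunov) for all solutions if every solution starting sufficiently close to $\Lambda$ stays in any prescribed neighborhood of $\Lambda$ for all $t\ge0$, and all solutions starting in some neighborhood of $\Lambda$ converge to $\Lambda$ as $t\to\infty$; $DA(\Lambda)$ is the set of initial points from which all solutions converge to $\Lambda$.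
   Formalization: In (G)(iii) the functions m_n(x,ξ) are assumed continuous in x uniformly in both ξ and n (equicontinuous at each x); with continuity uniform only in ξ for each n, claim (2) fails, e.g. for iterates rotating on the unit circle with G={0}. *)

theory Defs
  imports "HOL-Probability.Probability"
begin

subsection \<open>Time scale and interpolation\<close>

definition step_time :: "(nat \<Rightarrow> real) \<Rightarrow> nat \<Rightarrow> real" where
  "step_time a n = (\<Sum>i<n. a i)"

text \<open>
  The set under \<open>Max\<close> is nonempty, and it is finite when the step sizes are positive with a
  divergent sum.
\<close>
definition step_index :: "(nat \<Rightarrow> real) \<Rightarrow> real \<Rightarrow> nat" where
  "step_index a t = (if t < 0 then 0 else Max {n. step_time a n \<le> t})"

text \<open>Only used for nonnegative times; at \<open>t = step_time a n\<close> the value is \<open>x n\<close>.\<close>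
definition interpolation :: "(nat \<Rightarrow> real) \<Rightarrow> (nat \<Rightarrow> 'v::real_vector) \<Rightarrow> real \<Rightarrow> 'v" where
  "interpolation a x t =
     (let n = step_index a t in
        ((step_time a (Suc n) - t) / a n) *\<^sub>R x n + ((t - step_time a n) / a n) *\<^sub>R x (Suc n))"

definition shifted_interpolation ::
  "(nat \<Rightarrow> real) \<Rightarrow> (nat \<Rightarrow> 'v::real_vector) \<Rightarrow> nat \<Rightarrow> real \<Rightarrow> 'v" where
  "shifted_interpolation a x n t =
     (if - step_time a n \<le> t then interpolation a x (t + step_time a n) else x 0)"

definition equicontinuous_on_bounded_intervals :: "(nat \<Rightarrow> real \<Rightarrow> 'v::metric_space) \<Rightarrow> bool" where
  "equicontinuous_on_bounded_intervals f \<longleftrightarrow>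
     (\<forall>c d. \<forall>\<epsilon>>0. \<exists>\<delta>>0. \<forall>n. \<forall>s\<in>{c..d}. \<forall>t\<in>{c..d}. \<bar>s - t\<bar> < \<delta> \<longrightarrow> dist (f n s) (f n t) < \<epsilon>)"

definition limit_of_subsequence ::
  "(nat \<Rightarrow> real \<Rightarrow> 'v::metric_space) \<Rightarrow> (real \<Rightarrow> 'v) \<Rightarrow> bool" where
  "limit_of_subsequence f g \<longleftrightarrow>
     (\<exists>r::nat \<Rightarrow> nat. strict_mono r \<and>
        (\<forall>c d. uniform_limit {c..d} (\<lambda>k. f (r k)) g sequentially))"

definition limit_points :: "(nat \<Rightarrow> 'v::topological_space) \<Rightarrow> 'v set" where
  "limit_points x = {\<theta>. \<exists>r::nat \<Rightarrow> nat. strict_mono r \<and> (x \<circ> r) \<longlonglongrightarrow> \<theta>}"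

subsection \<open>Differential inclusions\<close>

definition absolutely_continuous_interval :: "(real \<Rightarrow> 'v::real_normed_vector) \<Rightarrow> real \<Rightarrow> real \<Rightarrow> bool" where
  "absolutely_continuous_interval f c d \<longleftrightarrow>
     (\<forall>\<epsilon>>0. \<exists>\<delta>>0. \<forall>P::(real \<times> real) set.
        finite P \<longrightarrow>
        (\<forall>(s, t)\<in>P. c \<le> s \<and> s \<le> t \<and> t \<le> d) \<longrightarrow>
        pairwise (\<lambda>p q. {fst p<..<snd p} \<inter> {fst q<..<snd q} = {}) P \<longrightarrow>
        (\<Sum>(s, t)\<in>P. t - s) < \<delta> \<longrightarrow>
        (\<Sum>(s, t)\<in>P. norm (f t - f s)) < \<epsilon>)"

text \<open>
  Solutions on an interval \<open>I\<close> of times; below \<open>I\<close> is the whole line or the half-line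
  \<open>{0..}\<close>.
\<close>
definition di_solution ::
  "('v::real_normed_vector \<Rightarrow> 'v set) \<Rightarrow> real set \<Rightarrow> (real \<Rightarrow> 'v) \<Rightarrow> bool" where
  "di_solution F I X \<longleftrightarrow>
     (\<forall>c d. {c..d} \<subseteq> I \<longrightarrow> absolutely_continuous_interval X c d) \<and>
     (AE t in lborel. t \<in> I \<longrightarrow> (\<exists>v\<in>F (X t). (X has_vector_derivative v) (at t within I)))"

definition limit_set :: "(real \<Rightarrow> 'v::topological_space) \<Rightarrow> 'v set" where
  "limit_set X = (\<Inter>t\<in>{0..}. closure (X ` {t..}))"

definition chain_connected_in ::
  "('v::real_normed_vector \<Rightarrow> 'v set) \<Rightarrow> 'v set \<Rightarrow> 'v \<Rightarrow> 'v \<Rightarrow> bool" where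
  "chain_connected_in F A x y \<longleftrightarrow>
     (\<forall>\<epsilon>>0. \<forall>T>0. \<exists>n\<ge>1. \<exists>(Y::nat \<Rightarrow> real \<Rightarrow> 'v) (\<tau>::nat \<Rightarrow> real).
        (\<forall>i\<in>{1..n}. di_solution F {0..} (Y i) \<and> \<tau> i > T \<and> (\<forall>s\<in>{0..\<tau> i}. Y i s \<in> A)) \<and>
        (\<forall>i\<in>{1..<n}. norm (Y i (\<tau> i) - Y (Suc i) 0) \<le> \<epsilon>) \<and>
        norm (Y 1 0 - x) \<le> \<epsilon> \<and> norm (Y n (\<tau> n) - y) \<le> \<epsilon>)"

definition internally_chain_transitive ::
  "('v::real_normed_vector \<Rightarrow> 'v set) \<Rightarrow> 'v set \<Rightarrow> bool" where
  "internally_chain_transitive F A \<longleftrightarrow>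
     compact A \<and> (\<forall>x\<in>A. \<forall>y\<in>A. chain_connected_in F A x y)"

definition chain_recurrent_points ::
  "('v::real_normed_vector \<Rightarrow> 'v set) \<Rightarrow> 'v set" where
  "chain_recurrent_points F =
     {\<theta>. \<forall>\<epsilon>>0. \<forall>T>0. \<exists>n\<ge>1. \<exists>(Y::nat \<Rightarrow> real \<Rightarrow> 'v) (\<tau>::nat \<Rightarrow> real).
        (\<forall>i\<in>{1..n}. di_solution F {0..} (Y i) \<and> \<tau> i > T) \<and>
        norm (Y 1 0 - \<theta>) \<le> \<epsilon> \<and>
        (\<forall>i\<in>{1..<n}. norm (Y i (\<tau> i) - Y (Suc i) 0) \<le> \<epsilon>) \<and>
        norm (Y n (\<tau> n) - \<theta>) \<le> \<epsilon>}"

text \<open>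
  Neighbourhoods of \<open>\<Lambda>\<close> are metric ones, \<open>{x. infdist x \<Lambda> < \<epsilon>}\<close>, and convergence to \<open>\<Lambda>\<close> means
  that the distance to \<open>\<Lambda>\<close> tends to \<open>0\<close>. The empty set is excluded because \<open>infdist x {} = 0\<close>.
\<close>
definition locally_asymptotically_stable ::
  "('v::real_normed_vector \<Rightarrow> 'v set) \<Rightarrow> 'v set \<Rightarrow> bool" where
  "locally_asymptotically_stable F \<Lambda> \<longleftrightarrow>
     \<Lambda> \<noteq> {} \<and>
     (\<forall>\<epsilon>>0. \<exists>\<delta>>0. \<forall>X. di_solution F {0..} X \<longrightarrow> infdist (X 0) \<Lambda> < \<delta> \<longrightarrow>
        (\<forall>t\<ge>0. infdist (X t) \<Lambda> < \<epsilon>)) \<and>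
     (\<exists>\<delta>>0. \<forall>X. di_solution F {0..} X \<longrightarrow> infdist (X 0) \<Lambda> < \<delta> \<longrightarrow>
        ((\<lambda>t. infdist (X t) \<Lambda>) \<longlongrightarrow> 0) at_top)"

definition domain_of_attraction ::
  "('v::real_normed_vector \<Rightarrow> 'v set) \<Rightarrow> 'v set \<Rightarrow> 'v set" where
  "domain_of_attraction F \<Lambda> =
     {x. \<forall>X. di_solution F {0..} X \<longrightarrow> X 0 = x \<longrightarrow> ((\<lambda>t. infdist (X t) \<Lambda>) \<longlongrightarrow> 0) at_top}"

subsection \<open>Conditions on the noise\<close>

text \<open>The sigma-algebra on \<open>space M\<close> generated by \<open>\<xi> i\<close>, \<open>i \<in> I\<close>.\<close>
definition noise_sigma ::
  "'a measure \<Rightarrow> 's measure \<Rightarrow> (nat \<Rightarrow> 'a \<Rightarrow> 's) \<Rightarrow> nat set \<Rightarrow> 'a measure" where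
  "noise_sigma M S \<xi> I =
     vimage_algebra (space M) (\<lambda>\<omega>. \<lambda>i\<in>I. \<xi> i \<omega>) (\<Pi>\<^sub>M i\<in>I. S)"

text \<open>The sigma-algebra on \<open>space M\<close> generated by \<open>\<xi> i\<close>, \<open>i \<le> n\<close>, together with \<open>X n\<close>.\<close>
definition noise_state_sigma ::
  "'a measure \<Rightarrow> 's measure \<Rightarrow> (nat \<Rightarrow> 'a \<Rightarrow> 's) \<Rightarrow> (nat \<Rightarrow> 'a \<Rightarrow> 'v::topological_space) \<Rightarrow> nat \<Rightarrow> 'a measure"
where
  "noise_state_sigma M S \<xi> X n =
     vimage_algebra (space M) (\<lambda>\<omega>. (\<lambda>i\<in>{..n}. \<xi> i \<omega>, X n \<omega>)) ((\<Pi>\<^sub>M i\<in>{..n}. S) \<Otimes>\<^sub>M borel)"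

definition exogenous ::
  "'a measure \<Rightarrow> 's measure \<Rightarrow> (nat \<Rightarrow> 'a \<Rightarrow> 's) \<Rightarrow> (nat \<Rightarrow> 'a \<Rightarrow> 'v::topological_space) \<Rightarrow> bool" where
  "exogenous M S \<xi> X \<longleftrightarrow>
     (\<forall>n. \<forall>A\<in>sets (noise_sigma M S \<xi> {n<..}). AE \<omega> in M.
        real_cond_exp M (noise_state_sigma M S \<xi> X n) (indicator A) \<omega> =
        real_cond_exp M (noise_sigma M S \<xi> {..n}) (indicator A) \<omega>)"

text \<open>The sum over \<open>i\<close> from \<open>m (j T)\<close> to \<open>m (j T + t) - 1\<close>, where \<open>m = step_index a\<close>.\<close>
definition window_sum ::
  "(nat \<Rightarrow> real) \<Rightarrow> real \<Rightarrow> (nat \<Rightarrow> 'v::real_vector) \<Rightarrow> nat \<Rightarrow> real \<Rightarrow> 'v" where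
  "window_sum a T z j t =
     (\<Sum>i\<in>{step_index a (real j * T)..<step_index a (real j * T + t)}. a i *\<^sub>R z i)"

text \<open>The supremum is taken in \<^typ>\<open>ereal\<close> since it may be infinite.\<close>
definition window_sup :: "real \<Rightarrow> nat \<Rightarrow> (nat \<Rightarrow> real \<Rightarrow> real) \<Rightarrow> ereal" where
  "window_sup T n s = (SUP j\<in>{n..}. SUP t\<in>{0..T}. ereal (s j t))"

definition averages_out ::
  "'a measure \<Rightarrow> (nat \<Rightarrow> real) \<Rightarrow> real \<Rightarrow> (nat \<Rightarrow> 'a \<Rightarrow> 'v::real_normed_vector) \<Rightarrow> bool" where
  "averages_out M a T Z \<longleftrightarrow>
     (\<forall>\<epsilon>>0. (\<lambda>n. measure M {\<omega>\<in>space M.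
        window_sup T n (\<lambda>j t. norm (window_sum a T (\<lambda>i. Z i \<omega>) j t)) \<ge> ereal \<epsilon>}) \<longlonglongrightarrow> 0)"

text \<open>
  The inner limit always exists, the probabilities being decreasing in \<open>n\<close>.
\<close>
definition asymptotically_small_increments ::
  "'a measure \<Rightarrow> (nat \<Rightarrow> real) \<Rightarrow> (nat \<Rightarrow> 'a \<Rightarrow> real) \<Rightarrow> bool" where
  "asymptotically_small_increments M a Z \<longleftrightarrow>
     (\<forall>\<epsilon>>0. ((\<lambda>\<Delta>. lim (\<lambda>n. measure M {\<omega>\<in>space M.
        window_sup \<Delta> n (window_sum a \<Delta> (\<lambda>i. Z i \<omega>)) \<ge> ereal \<epsilon>})) \<longlongrightarrow> 0) (at_right 0))"

text \<open>
  The condition on \<open>G\<close>. The modulus of continuity of the functions \<open>m n\<close> is uniform in the noise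
  and along the sequence. Uniformity in \<open>n\<close> cannot be dropped: let \<open>X n\<close> run along the unit circle of
  the plane with angular steps \<open>a n = 1 / (n + 1)\<close>, let \<open>b n\<close> be \<open>(X (n + 1) - X n) / a n\<close> at \<open>X n\<close> and \<open>0\<close>
  elsewhere, \<open>G x = {0}\<close> and \<open>m n x = max 0 (1 - (n + 1) * norm (x - X n)) + 1 / (n + 1)\<close>. All the
  other requirements hold, with zero \<open>h\<close>, \<open>h0\<close> and \<open>\<beta>\<close>, but the limit is a rotation and does not
  solve \<open>X' \<in> {0}\<close>.
\<close>
definition set_valued_bound ::
  "'a measure \<Rightarrow> (nat \<Rightarrow> real) \<Rightarrow> 's measure \<Rightarrow> (nat \<Rightarrow> 'a \<Rightarrow> 's) \<Rightarrow>
   (nat \<Rightarrow> 'v::euclidean_space \<Rightarrow> 's \<Rightarrow> 'v) \<Rightarrow> ('v \<Rightarrow> 'v set) \<Rightarrow> bool" where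
  "set_valued_bound M a S \<xi> b G \<longleftrightarrow>
     (\<forall>x. G x \<noteq> {} \<and> compact (G x) \<and> convex (G x)) \<and>
     (\<exists>R. \<forall>x. G x \<subseteq> cball 0 R) \<and>
     closed {(x, y). y \<in> G x} \<and>
     (\<exists>m::nat \<Rightarrow> 'v \<Rightarrow> 's \<Rightarrow> real.
        (\<forall>n x. m n x \<in> borel_measurable S) \<and>
        (\<forall>n x. \<forall>s\<in>space S. m n x s > 0) \<and>
        (\<forall>x. \<forall>\<epsilon>>0. \<exists>\<delta>>0. \<forall>y. dist y x < \<delta> \<longrightarrow> (\<forall>n. \<forall>s\<in>space S. \<bar>m n y s - m n x s\<bar> < \<epsilon>)) \<and>
        (\<forall>n x. \<forall>s\<in>space S. b n x s \<in> {y + m n x s *\<^sub>R u | y u. y \<in> G x \<and> u \<in> cball 0 1}) \<and>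
        (\<exists>T>0. \<forall>x. averages_out M a T (\<lambda>i \<omega>. m i x (\<xi> i \<omega>))))"

end

theory Submission
  imports Defs "HOL-Complex_Analysis.Great_Picard"
begin

text \<open>
  The probabilistic hypotheses are used only to find one null set; off that set the theorem is about a
  single sequence of vectors \<open>x\<close>. They say that, for each fixed point \<open>p\<close>, the sums of
  \<open>a i *\<^sub>R (h p (\<zeta> i) - hbar p)\<close>, of \<open>a i * m i p (\<xi> i)\<close> and of \<open>a i *\<^sub>R h0 (\<zeta>' i)\<close> over late time windows of a
  fixed length are almost surely small, and continuity in \<open>p\<close>, uniform in the noise, makes the
  exceptional null set independent of \<open>p\<close>: first a countable dense set of points is treated, then
  all points are reached by approximation (\<open>AE_averages_to_zero_all\<close>).

  While the iterates stay near \<open>p\<close>, the same continuity allows to replace \<open>h (x i)\<close> and \<open>m i (x i)\<close> by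
  their values at \<open>p\<close>, and the closed graph puts \<open>G (x i)\<close> into a small neighbourhood of \<open>G p\<close>. The set
  \<open>F p = hbar p + G p\<close> is convex, so averaging the velocities stays near it: an increment of \<open>x\<close> over a
  late time window of length \<open>t\<close> lies within \<open>\<eta> * t + \<epsilon>\<close> of \<open>t *\<^sub>R y\<close> for some \<open>y \<in> F p\<close>, where \<open>\<eta>\<close> depends
  on how near to \<open>p\<close> the iterates are and \<open>\<epsilon>\<close> vanishes as the window recedes (\<open>follows\<close>). This
  gives a local bound on the speed. A bounded speed keeps the iterates near \<open>p\<close> for a fixed time, and
  compactness of the closure of the orbit makes the bound uniform (\<open>increments_at_most_linear\<close>). Hence
  the interpolated trajectory \<open>w\<close> is bounded and uniformly continuous, which is the first claim.

  Let \<open>Y\<close> be a limit of shifts \<open>w (s k + t)\<close> with \<open>s k\<close> tending to infinity. The errors \<open>\<epsilon>\<close> disappear,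
  so \<open>Y\<close> is Lipschitz, thus differentiable almost everywhere (\<open>lipschitz_differentiable_ae\<close>, an
  application of the Vitali covering theorem), and a derivative of \<open>Y\<close> at \<open>t\<close> is within any \<open>\<eta>\<close> of the
  closed set \<open>F (Y t)\<close>. So \<open>Y\<close> solves the inclusion, which is the second claim.

  The rest uses only three properties of \<open>w\<close>, collected in the locale \<open>asymptotic_trajectory\<close>: it is
  bounded, uniformly continuous, and all its shift limits are solutions. By the theorem of Arzela and
  Ascoli shift limits exist along every sequence of times, and they run inside the limit set of \<open>w\<close>.
  Therefore late pieces of \<open>w\<close> of a given length are shadowed by solutions in the limit set
  (\<open>shadowing\<close>). Cutting \<open>w\<close> between two late visits near \<open>x\<close> and \<open>y\<close> into such pieces produces the chain
  from \<open>x\<close> to \<open>y\<close>. A shift limit of \<open>w\<close> has the three properties again, so the limit sets of \<open>w\<close> and of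
  its shift limits are both internally chain transitive. For a stable set, excursions of \<open>w\<close> that
  start arbitrarily near it and reach a fixed distance would, in the limit, give a solution violating
  stability (\<open>attracted_to_stable_set\<close>).
\<close>

section \<open>Lipschitz functions on the line are differentiable almost everywhere\<close>

text \<open>
  The intervals between \<open>x\<close> and \<open>x + h\<close> on which the slope of \<open>g\<close> is below \<open>p\<close> form a Vitali cover of \<open>E\<close>. Disjoint ones
  of them, chosen inside an open set \<open>U\<close> of almost the measure of \<open>E\<close>, fill \<open>E\<close> up to a null set. On each
  of them \<open>g\<close> stretches length by at most \<open>p\<close>, and the image of the rest is null because \<open>g\<close> is Lipschitz.
\<close>
lemma image_measure_le_of_small_slopes:
  fixes g k :: "real \<Rightarrow> real"
  assumes E: "E \<in> sets borel" and p: "p > 0"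
    and kg: "\<And>x. k (g x) = x" and gk: "\<And>y. g (k y) = y"
    and k: "continuous_on UNIV k" and g_mono: "strict_mono g"
    and lip: "\<And>x y. \<bar>g x - g y\<bar> \<le> L * \<bar>x - y\<bar>"
    and slopes: "\<And>x d. x \<in> E \<Longrightarrow> d > 0 \<Longrightarrow> \<exists>h. h \<noteq> 0 \<and> \<bar>h\<bar> < d \<and> (g (x + h) - g x) / h < p"
  shows "emeasure lebesgue (g ` E) \<le> ennreal p * emeasure lebesgue E"
proof (rule ennreal_le_epsilon)
  have null: "negligible (g ` A)" if "negligible A" for A
  proof (rule negligible_locally_Lipschitz_image[OF _ that])
    show "\<exists>T B. open T \<and> x \<in> T \<and> (\<forall>y\<in>A \<inter> T. norm (g y - g x) \<le> B * norm (y - x))" for x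
      using lip by (intro exI[of _ UNIV] exI[of _ L]) auto
  qed simp
  have image_sets: "g ` A \<in> sets borel" if "A \<in> sets borel" for A
  proof -
    have "y \<in> g ` A \<longleftrightarrow> k y \<in> A" for y
      using kg gk[of y] by (auto simp del: imageI intro!: image_eqI[of y g "k y"])
    then have "g ` A = k -` A" by blast
    moreover have "k -` A \<in> sets borel"
      using measurable_sets_borel[OF borel_measurable_continuous_onI[OF k] that] by simp
    ultimately show ?thesis by simp
  qed
  have image_interval: "g ` cball c r = {g (c - r)..g (c + r)}" for c r
  proof -
    have "y \<in> g ` cball c r" if "g (c - r) \<le> y" "y \<le> g (c + r)" for y
    proof -
      have "c - r \<le> k y" "k y \<le> c + r"
        using that strict_mono_less_eq[OF g_mono, of "c - r" "k y"]
          strict_mono_less_eq[OF g_mono, of "k y" "c + r"] gk[of y] by simp_all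
      then show ?thesis
        using gk[of y] by (auto simp: image_iff dist_real_def intro!: bexI[of _ "k y"])
    qed
    then show ?thesis
      using strict_mono_less_eq[OF g_mono] by (auto simp: cball_eq_atLeastAtMost)
  qed
  fix e :: real assume "e > 0"
  define e' where "e' = e / p"
  have e': "e' > 0" using \<open>e > 0\<close> p by (simp add: e'_def)
  have E_leb: "E \<in> sets lebesgue" using E by simp
  obtain U where U: "open U" "E \<subseteq> U" "(U - E) \<in> lmeasurable" "emeasure lebesgue (U - E) < ennreal e'"
    using sets_lebesgue_outer_open[OF E_leb e'] by blast
  \<comment> \<open>An interval is coded by its centre and radius.\<close>
  define K where "K = {(c, r). r > 0 \<and> cball c r \<subseteq> U \<and> g (c + r) - g (c - r) \<le> p * (2 * r)}"
  have fine: "\<exists>i. i \<in> K \<and> x \<in> cball (fst i) (snd i) \<and> snd i < d" if x: "x \<in> E" and "d > 0" for x d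
  proof -
    obtain \<rho> where \<rho>: "\<rho> > 0" "ball x \<rho> \<subseteq> U"
      using U x by (meson open_contains_ball subsetD)
    obtain h where h: "h \<noteq> 0" "\<bar>h\<bar> < min d \<rho>" "(g (x + h) - g x) / h < p"
      using slopes[OF x, of "min d \<rho>"] \<open>d > 0\<close> \<rho> by auto
    have "cball (x + h / 2) (\<bar>h\<bar> / 2) \<subseteq> U"
      using h \<rho>(2) by (intro order_trans[OF _ \<rho>(2)]) (auto simp: dist_real_def abs_if split: if_splits)
    moreover have "g (x + h / 2 + \<bar>h\<bar> / 2) - g (x + h / 2 - \<bar>h\<bar> / 2) \<le> p * (2 * (\<bar>h\<bar> / 2))"
    proof (cases "h > 0")
      case True
      then have "x + h / 2 + \<bar>h\<bar> / 2 = x + h" "x + h / 2 - \<bar>h\<bar> / 2 = x" "2 * (\<bar>h\<bar> / 2) = h" by simp_all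
      moreover have "g (x + h) - g x \<le> p * h"
        using h(3) True by (simp add: pos_divide_less_eq)
      ultimately show ?thesis by (simp only:)
    next
      case False
      then have "h < 0" using h by simp
      then have "x + h / 2 + \<bar>h\<bar> / 2 = x" "x + h / 2 - \<bar>h\<bar> / 2 = x + h" "2 * (\<bar>h\<bar> / 2) = - h"
        by simp_all
      moreover have "g x - g (x + h) \<le> p * - h"
        using h(3) \<open>h < 0\<close> by (simp add: neg_divide_less_eq)
      ultimately show ?thesis by (simp only:)
    qed
    ultimately have "(x + h / 2, \<bar>h\<bar> / 2) \<in> K"
      using h by (simp add: K_def)
    moreover have "x \<in> cball (x + h / 2) (\<bar>h\<bar> / 2)" by (simp add: dist_real_def)
    ultimately show ?thesis using h by (intro exI[of _ "(x + h / 2, \<bar>h\<bar> / 2)"]) auto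
  qed
  obtain C where C: "countable C" "C \<subseteq> K"
     "pairwise (\<lambda>i j. disjnt (cball (fst i) (snd i)) (cball (fst j) (snd j))) C"
     "negligible (E - (\<Union>i\<in>C. cball (fst i) (snd i)))"
    by (rule Vitali_covering_theorem_cballs[of K snd E fst, OF _ fine]) (auto simp: K_def)
  let ?I = "\<lambda>i. cball (fst i) (snd i)"
  have disj: "disjoint_family_on ?I C"
    using C(3) by (auto simp: disjoint_family_on_def pairwise_def disjnt_def)
  have g_inj: "inj g" using kg by (metis injI)
  have gdisj: "disjoint_family_on (\<lambda>i. g ` ?I i) C"
    unfolding disjoint_family_on_def
  proof (intro ballI impI)
    fix i j assume "i \<in> C" "j \<in> C" "i \<noteq> j"
    then have "?I i \<inter> ?I j = {}" using disj unfolding disjoint_family_on_def by blast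
    then show "g ` ?I i \<inter> g ` ?I j = {}" using image_Int[OF g_inj, of "?I i" "?I j"] by simp
  qed
  have gI: "emeasure lebesgue (g ` ?I i) \<le> ennreal p * emeasure lebesgue (?I i)" if "i \<in> C" for i
  proof -
    have i: "snd i > 0" "g (fst i + snd i) - g (fst i - snd i) \<le> p * (2 * snd i)"
      using that C(2) by (auto simp: K_def)
    then have "g (fst i - snd i) \<le> g (fst i + snd i)"
      using strict_mono_less_eq[OF g_mono] by simp
    then have "emeasure lebesgue (g ` ?I i) = ennreal (g (fst i + snd i) - g (fst i - snd i))"
      unfolding image_interval by simp
    also have "\<dots> \<le> ennreal (p * (2 * snd i))"
      using i by (intro ennreal_leI)
    also have "\<dots> = ennreal p * emeasure lebesgue (?I i)"
      using i p by (simp add: cball_eq_atLeastAtMost ennreal_mult)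
    finally show ?thesis .
  qed
  have sets_gI: "g ` ?I i \<in> sets lebesgue" for i
    unfolding image_interval by simp
  have "g ` E \<subseteq> (\<Union>i\<in>C. g ` ?I i) \<union> g ` (E - (\<Union>i\<in>C. ?I i))" by blast
  moreover have n: "g ` (E - (\<Union>i\<in>C. ?I i)) \<in> null_sets lebesgue"
    using null[OF C(4)] by (simp add: negligible_iff_null_sets)
  moreover have UI: "(\<Union>i\<in>C. g ` ?I i) \<in> sets lebesgue"
    using C(1) sets_gI by (intro sets.countable_UN') auto
  ultimately have "emeasure lebesgue (g ` E) \<le> emeasure lebesgue ((\<Union>i\<in>C. g ` ?I i) \<union> g ` (E - (\<Union>i\<in>C. ?I i)))"
    by (intro emeasure_mono) auto
  also have "\<dots> = emeasure lebesgue (\<Union>i\<in>C. g ` ?I i)"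
    using n UI by (rule emeasure_Un_null_set[rotated])
  also have "\<dots> = (\<integral>\<^sup>+i. emeasure lebesgue (g ` ?I i) \<partial>count_space C)"
    using C(1) gdisj sets_gI by (intro emeasure_UN_countable) auto
  also have "\<dots> \<le> (\<integral>\<^sup>+i. ennreal p * emeasure lebesgue (?I i) \<partial>count_space C)"
    using gI by (intro nn_integral_mono) auto
  also have "\<dots> = ennreal p * (\<integral>\<^sup>+i. emeasure lebesgue (?I i) \<partial>count_space C)"
    by (intro nn_integral_cmult) auto
  also have "(\<integral>\<^sup>+i. emeasure lebesgue (?I i) \<partial>count_space C) = emeasure lebesgue (\<Union>i\<in>C. ?I i)"
    using C(1) disj by (intro emeasure_UN_countable[symmetric]) auto
  also have "\<dots> \<le> emeasure lebesgue U"
  proof (rule emeasure_mono)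
    have "?I i \<subseteq> U" if "i \<in> C" for i
      using subsetD[OF C(2) that] by (simp add: K_def case_prod_beta)
    then show "(\<Union>i\<in>C. ?I i) \<subseteq> U" by blast
  qed (use U(1) in auto)
  also have "emeasure lebesgue U = emeasure lebesgue (E \<union> (U - E))"
    using U(2) by (simp add: Un_absorb1)
  also have "\<dots> \<le> emeasure lebesgue E + emeasure lebesgue (U - E)"
    using E U by (intro emeasure_subadditive) (auto simp: fmeasurableD)
  also have "\<dots> \<le> emeasure lebesgue E + ennreal e'"
    using U(4) by (intro add_left_mono) simp
  finally have "emeasure lebesgue (g ` E) \<le> ennreal p * (emeasure lebesgue E + ennreal e')"
    by (simp add: mult_left_mono)
  also have "\<dots> = ennreal p * emeasure lebesgue E + ennreal e"
    using p e' by (simp add: distrib_left e'_def flip: ennreal_mult)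
  finally show "emeasure lebesgue (g ` E) \<le> ennreal p * emeasure lebesgue E + ennreal e" .
qed

text \<open>
  If \<open>E\<close> is the set of points with slopes below \<open>p\<close> and slopes above \<open>q\<close> at all scales, then the previous
  lemma bounds the measure of \<open>g ` E\<close> by \<open>p\<close> times that of \<open>E\<close>. The inverse function has slopes below
  \<open>1 / q\<close> on \<open>g ` E\<close>, so the same lemma bounds the measure of \<open>E\<close> by \<open>1 / q\<close> times that of \<open>g ` E\<close>. As
  \<open>p < q\<close>, bounded parts of \<open>E\<close> are null.
\<close>
lemma slopes_cross_null:
  fixes g k :: "real \<Rightarrow> real"
  assumes kg: "\<And>x. k (g x) = x" and gk: "\<And>y. g (k y) = y"
    and slope: "\<And>x y. x \<le> y \<Longrightarrow> y - x \<le> g y - g x \<and> g y - g x \<le> L * (y - x)"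
    and pq: "0 < p" "p < q"
  shows "negligible {x. \<forall>d>0. (\<exists>h. h \<noteq> 0 \<and> \<bar>h\<bar> < d \<and> (g (x + h) - g x) / h < p) \<and>
                              (\<exists>h. h \<noteq> 0 \<and> \<bar>h\<bar> < d \<and> (g (x + h) - g x) / h > q)}" (is "negligible ?E")
proof -
  have g_lip: "\<bar>g x - g y\<bar> \<le> L * \<bar>x - y\<bar>" and k_lip0: "\<bar>x - y\<bar> \<le> \<bar>g x - g y\<bar>" for x y
    using slope[of x y] slope[of y x] by (cases "x \<le> y"; simp add: abs_if)+
  have k_lip: "\<bar>k x - k y\<bar> \<le> 1 * \<bar>x - y\<bar>" for x y
    using k_lip0[of "k x" "k y"] gk by simp
  have cont: "continuous_on UNIV f" if "\<And>x y. \<bar>f x - f y\<bar> \<le> B * \<bar>x - y\<bar>" for f :: "real \<Rightarrow> real" and B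
  proof -
    have "\<bar>f x - f y\<bar> \<le> \<bar>B\<bar> * \<bar>x - y\<bar>" for x y
      using that[of x y] by (meson abs_ge_self abs_ge_zero mult_right_mono order_trans)
    then have "\<bar>B\<bar>-lipschitz_on UNIV f" by (intro lipschitz_onI) (auto simp: dist_real_def)
    then show ?thesis by (rule lipschitz_on_continuous_on)
  qed
  have g_cont: "continuous_on UNIV g" and k_cont: "continuous_on UNIV k"
    using cont g_lip k_lip by blast+
  have g_mono: "strict_mono g"
  proof (rule strict_monoI)
    show "g x < g y" if "x < y" for x y using slope[of x y] that by simp
  qed
  have k_mono: "strict_mono k"
  proof (rule strict_monoI)
    show "k x < k y" if "x < y" for x y
      using that strict_mono_less[OF g_mono, of "k x" "k y"] gk by simp
  qed
  have gc[continuous_intros]: "continuous_on A (\<lambda>x. g (f x))" if "continuous_on A f" for A and f :: "real \<Rightarrow> real"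
    using continuous_on_compose2[OF g_cont that] by auto
  have op: "open (\<Union>h\<in>{h. h \<noteq> 0 \<and> \<bar>h\<bar> < d}. {x. (g (x + h) - g x) / h < p})"
           "open (\<Union>h\<in>{h. h \<noteq> 0 \<and> \<bar>h\<bar> < d}. {x. (g (x + h) - g x) / h > q})" for d
    by (intro open_UN ballI open_Collect_less continuous_intros; simp)+
  \<comment> \<open>For fixed scale and fixed \<open>h\<close> the conditions are open in \<open>x\<close>, so the exceptional set is a \<open>G\<^sub>\<delta>\<close> set.\<close>
  have E_eq: "?E = (\<Inter>n::nat. (\<Union>h\<in>{h. h \<noteq> 0 \<and> \<bar>h\<bar> < 1 / Suc n}. {x. (g (x + h) - g x) / h < p}) \<inter>
                   (\<Union>h\<in>{h. h \<noteq> 0 \<and> \<bar>h\<bar> < 1 / Suc n}. {x. (g (x + h) - g x) / h > q}))" (is "_ = ?R")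
  proof
    show "?E \<subseteq> ?R"
    proof
      fix x assume x: "x \<in> ?E"
      have "1 / real (Suc n) > 0" for n by simp
      then show "x \<in> ?R" using x by (auto simp: Bex_def)
    qed
    show "?R \<subseteq> ?E"
    proof
      fix x assume x: "x \<in> ?R"
      show "x \<in> ?E"
      proof (rule CollectI, intro allI impI)
        fix d :: real assume "d > 0"
        then obtain n where "1 / real (Suc n) < d"
          using nat_approx_posE by blast
        moreover have "\<exists>h. h \<noteq> 0 \<and> \<bar>h\<bar> < 1 / real (Suc n) \<and> (g (x + h) - g x) / h < p"
          "\<exists>h. h \<noteq> 0 \<and> \<bar>h\<bar> < 1 / real (Suc n) \<and> (g (x + h) - g x) / h > q"
          using x by (auto simp del: of_nat_Suc)
        ultimately show "(\<exists>h. h \<noteq> 0 \<and> \<bar>h\<bar> < d \<and> (g (x + h) - g x) / h < p) \<and>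
                              (\<exists>h. h \<noteq> 0 \<and> \<bar>h\<bar> < d \<and> (g (x + h) - g x) / h > q)"
          by (meson less_trans)
      qed
    qed
  qed
  have E_borel: "?E \<in> sets borel"
    unfolding E_eq using op by (intro sets.countable_INT') auto
  define E where "E = ?E"
  have E_small: "\<exists>h. h \<noteq> 0 \<and> \<bar>h\<bar> < d \<and> (g (x + h) - g x) / h < p"
    and E_large: "\<exists>h. h \<noteq> 0 \<and> \<bar>h\<bar> < d \<and> (g (x + h) - g x) / h > q" if "x \<in> E" "d > 0" for x d
    using that by (simp_all add: E_def)
  have E_borel: "E \<in> sets borel" using E_borel by (simp add: E_def)
  have "negligible (E \<inter> {-real N..real N})" for N :: nat
  proof -
    define D where "D = E \<inter> {-real N..real N}"
    have DE: "D \<subseteq> E" by (simp add: D_def)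
    have D: "D \<in> sets borel" using E_borel by (simp add: D_def)
    have "emeasure lebesgue D \<le> emeasure lebesgue {-real N..real N}"
      by (intro emeasure_mono) (auto simp: D_def)
    also have "\<dots> < \<infinity>" by simp
    finally have fin: "emeasure lebesgue D < \<infinity>" .
    have 1: "emeasure lebesgue (g ` D) \<le> ennreal p * emeasure lebesgue D"
      by (rule image_measure_le_of_small_slopes[OF D pq(1) kg gk k_cont g_mono g_lip]) (use E_small DE in blast)
    have gD: "g ` D \<in> sets borel"
    proof -
      have "y \<in> g ` D \<longleftrightarrow> k y \<in> D" for y
        using kg gk[of y] by (metis imageE image_eqI)
      then have "g ` D = k -` D" by blast
      then show ?thesis
        using measurable_sets_borel[OF borel_measurable_continuous_onI[OF k_cont] D] by simp
    qed
    have q: "q > 0" using pq by simp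
    have "emeasure lebesgue (k ` (g ` D)) \<le> ennreal (1 / q) * emeasure lebesgue (g ` D)"
    proof (rule image_measure_le_of_small_slopes[OF gD _ gk kg g_cont k_mono k_lip])
      fix y d :: real assume y: "y \<in> g ` D" and d: "d > 0"
      then obtain x where x: "x \<in> D" "y = g x" by blast
      have L: "\<bar>L\<bar> + 1 > 0" by simp
      then have "d / (\<bar>L\<bar> + 1) > 0" using d by simp
      then obtain h where h: "h \<noteq> 0" "\<bar>h\<bar> < d / (\<bar>L\<bar> + 1)" "(g (x + h) - g x) / h > q"
        using E_large[of x "d / (\<bar>L\<bar> + 1)"] x DE by blast
      define h' where "h' = g (x + h) - g x"
      have "h' \<noteq> 0" using h g_mono by (simp add: h'_def strict_mono_eq)
      moreover have "\<bar>h'\<bar> < d"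
      proof -
        have "\<bar>h'\<bar> \<le> L * \<bar>h\<bar>" using g_lip[of "x + h" x] by (simp add: h'_def)
        also have "\<dots> \<le> (\<bar>L\<bar> + 1) * \<bar>h\<bar>" by (intro mult_right_mono) auto
        also have "\<dots> < d" using h(2) L by (simp add: field_simps)
        finally show ?thesis .
      qed
      moreover have "(k (y + h') - k y) / h' = 1 / ((g (x + h) - g x) / h)"
        using x kg by (simp add: h'_def)
      moreover have "\<dots> < 1 / q"
        using h(3) q by (intro divide_strict_left_mono mult_pos_pos) (auto intro: less_trans)
      ultimately show "\<exists>h'. h' \<noteq> 0 \<and> \<bar>h'\<bar> < d \<and> (k (y + h') - k y) / h' < 1 / q"
        by (metis)
    qed (use q in auto)
    also have "k ` (g ` D) = D" using kg by (simp add: image_image)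
    also have "ennreal (1 / q) * emeasure lebesgue (g ` D) \<le> ennreal (1 / q) * (ennreal p * emeasure lebesgue D)"
      using 1 by (intro mult_left_mono) auto
    also have "\<dots> = ennreal (p / q) * emeasure lebesgue D"
      using pq q by (simp add: ennreal_mult[symmetric] mult.assoc[symmetric])
    finally have *: "emeasure lebesgue D \<le> ennreal (p / q) * emeasure lebesgue D" .
    obtain c where c: "c \<ge> 0" "emeasure lebesgue D = ennreal c"
      using fin by (cases "emeasure lebesgue D") auto
    have "c \<le> p / q * c"
      using * c pq q by (simp add: ennreal_mult[symmetric])
    then have "(q - p) * c \<le> 0"
      using q by (simp add: field_simps)
    then have "c \<le> 0"
      using pq by (simp add: mult_le_0_iff)
    then have "emeasure lebesgue D = 0" using c by simp
    then show ?thesis using D by (simp add: negligible_iff_null_sets null_sets_def D_def)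
  qed
  then have "negligible (\<Union>N::nat. E \<inter> {-real N..real N})" by (intro negligible_countable_Union) auto
  moreover have "E \<subseteq> (\<Union>N::nat. E \<inter> {-real N..real N})"
  proof
    fix x assume "x \<in> E"
    moreover obtain N :: nat where "\<bar>x\<bar> \<le> real N" using real_arch_simple by blast
    ultimately show "x \<in> (\<Union>N::nat. E \<inter> {-real N..real N})" by (auto intro!: exI[of _ N])
  qed
  ultimately show ?thesis unfolding E_def[symmetric] by (rule negligible_subset)
qed


text \<open>
  The slopes at \<open>x\<close> stay in the compact interval \<open>[1, L]\<close>, so they accumulate at some \<open>D\<close> as \<open>h\<close> tends to \<open>0\<close>.
  Were \<open>D\<close> not their limit, two rationals would fit between \<open>D\<close> and slopes
  at all scales that stay away from it, and these rationals would be crossed.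
\<close>
lemma differentiable_if_slopes_do_not_cross:
  fixes g :: "real \<Rightarrow> real"
  assumes slope: "\<And>x y. x \<le> y \<Longrightarrow> y - x \<le> g y - g x \<and> g y - g x \<le> L * (y - x)"
    and no_cross: "\<And>p q. p \<in> \<rat> \<Longrightarrow> q \<in> \<rat> \<Longrightarrow> 0 < p \<Longrightarrow> p < q \<Longrightarrow>
      \<not> (\<forall>d>0. (\<exists>h. h \<noteq> 0 \<and> \<bar>h\<bar> < d \<and> (g (x + h) - g x) / h < p) \<and>
               (\<exists>h. h \<noteq> 0 \<and> \<bar>h\<bar> < d \<and> (g (x + h) - g x) / h > q))"
  shows "g differentiable at x"
proof -
  define \<phi> where "\<phi> h = (g (x + h) - g x) / h" for h
  have \<phi>: "1 \<le> \<phi> h \<and> \<phi> h \<le> L" if "h \<noteq> 0" for h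
    using slope[of x "x + h"] slope[of "x + h" x] that
    by (cases "h > 0") (auto simp: \<phi>_def field_simps)
  have "\<forall>n. \<phi> (1 / real (Suc n)) \<in> {1..L}" using \<phi> by simp
  then obtain D r where D: "D \<in> {1..L}" "strict_mono r" "((\<lambda>n. \<phi> (1 / real (Suc n))) \<circ> r) \<longlonglongrightarrow> D"
    using compact_Icc[of 1 L] unfolding compact_def by (metis (no_types, lifting))
  have "((\<lambda>n. 1 / real (Suc n)) \<circ> r) \<longlonglongrightarrow> 0"
    using LIMSEQ_subseq_LIMSEQ[OF lim_const_over_n[of 1, THEN LIMSEQ_Suc] D(2)] by simp
  then have approx: "\<exists>h. h \<noteq> 0 \<and> \<bar>h\<bar> < d \<and> \<bar>\<phi> h - D\<bar> < e" if "d > 0" "e > 0" for d e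
  proof -
    have "\<forall>\<^sub>F n in sequentially. dist (((\<lambda>n. 1 / real (Suc n)) \<circ> r) n) 0 < d"
      "\<forall>\<^sub>F n in sequentially. dist (((\<lambda>n. \<phi> (1 / real (Suc n))) \<circ> r) n) D < e"
      using tendstoD[OF \<open>((\<lambda>n. 1 / real (Suc n)) \<circ> r) \<longlonglongrightarrow> 0\<close> that(1)] tendstoD[OF D(3) that(2)] by auto
    then have "\<forall>\<^sub>F n in sequentially. \<exists>h. h \<noteq> 0 \<and> \<bar>h\<bar> < d \<and> \<bar>\<phi> h - D\<bar> < e"
    proof eventually_elim
      case (elim n)
      then show ?case by (intro exI[of _ "1 / real (Suc (r n))"]) (auto simp: dist_real_def simp del: of_nat_Suc)
    qed
    then show ?thesis using eventually_happens'[OF sequentially_bot] by blast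
  qed
  have "(\<phi> \<longlongrightarrow> D) (at 0)"
  proof (rule tendstoI, rule ccontr)
    fix e :: real assume e: "e > 0" and "\<not> (\<forall>\<^sub>F h in at 0. dist (\<phi> h) D < e)"
    then have far: "\<exists>h. h \<noteq> 0 \<and> \<bar>h\<bar> < d \<and> \<bar>\<phi> h - D\<bar> \<ge> e" if "d > 0" for d
      using that by (force simp: eventually_at dist_real_def not_less)
    consider "\<forall>d>0. \<exists>h. h \<noteq> 0 \<and> \<bar>h\<bar> < d \<and> \<phi> h \<ge> D + e"
      | d where "d > 0" "\<forall>h. h \<noteq> 0 \<longrightarrow> \<bar>h\<bar> < d \<longrightarrow> \<phi> h < D + e" by (meson not_le)
    then show False
    proof cases
      case 1
      obtain p where p: "p \<in> \<rat>" "D < p" "p < D + e" using Rats_dense_in_real[of D "D + e"] e by auto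
      obtain q where q: "q \<in> \<rat>" "p < q" "q < D + e" using Rats_dense_in_real[of p "D + e"] p by auto
      have "(\<exists>h. h \<noteq> 0 \<and> \<bar>h\<bar> < d \<and> \<phi> h < p) \<and> (\<exists>h. h \<noteq> 0 \<and> \<bar>h\<bar> < d \<and> \<phi> h > q)" if "d > 0" for d
      proof
        show "\<exists>h. h \<noteq> 0 \<and> \<bar>h\<bar> < d \<and> \<phi> h < p" using approx[OF that, of "p - D"] p by fastforce
        show "\<exists>h. h \<noteq> 0 \<and> \<bar>h\<bar> < d \<and> \<phi> h > q" using 1 that q by (meson less_le_trans)
      qed
      moreover have "0 < p" using D(1) p by simp
      ultimately show False using no_cross[OF p(1) q(1) _ q(2)] unfolding \<phi>_def by blast
    next
      case (2 d0)
      have low: "\<exists>h. h \<noteq> 0 \<and> \<bar>h\<bar> < d \<and> \<phi> h \<le> D - e" if d: "d > 0" for d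
      proof -
        have "min d d0 > 0" using d 2(1) by simp
        then obtain h where "h \<noteq> 0" "\<bar>h\<bar> < min d d0" "\<bar>\<phi> h - D\<bar> \<ge> e" using far by blast
        moreover then have "\<phi> h < D + e" using 2 by simp
        ultimately show ?thesis by (intro exI[of _ h]) (auto simp: abs_if split: if_splits)
      qed
      have "D - e > 0" using low[of 1] \<phi> by (smt (verit))
      obtain p where p: "p \<in> \<rat>" "D - e < p" "p < D" using Rats_dense_in_real[of "D - e" D] e by auto
      obtain q where q: "q \<in> \<rat>" "p < q" "q < D" using Rats_dense_in_real[of p D] p by auto
      have "(\<exists>h. h \<noteq> 0 \<and> \<bar>h\<bar> < d \<and> \<phi> h < p) \<and> (\<exists>h. h \<noteq> 0 \<and> \<bar>h\<bar> < d \<and> \<phi> h > q)" if "d > 0" for d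
      proof
        show "\<exists>h. h \<noteq> 0 \<and> \<bar>h\<bar> < d \<and> \<phi> h > q" using approx[OF that, of "D - q"] q by fastforce
        show "\<exists>h. h \<noteq> 0 \<and> \<bar>h\<bar> < d \<and> \<phi> h < p" using low that p by (meson le_less_trans)
      qed
      moreover have "0 < p" using \<open>D - e > 0\<close> p by simp
      ultimately show False using no_cross[OF p(1) q(1) _ q(2)] unfolding \<phi>_def by blast
    qed
  qed
  moreover have "\<phi> = (\<lambda>h. (g (x + h) - g x) / h)" by (simp add: \<phi>_def fun_eq_iff)
  ultimately have "(g has_field_derivative D) (at x)" by (simp add: DERIV_def)
  then show ?thesis by (auto simp: real_differentiable_def)
qed

lemma steep_lipschitz_differentiable_ae:
  fixes g :: "real \<Rightarrow> real"
  assumes slope: "\<And>x y. x \<le> y \<Longrightarrow> y - x \<le> g y - g x \<and> g y - g x \<le> L * (y - x)"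
  shows "negligible {x. \<not> g differentiable at x}"
proof -
  have "\<bar>g x - g y\<bar> \<le> \<bar>L\<bar> * \<bar>x - y\<bar>" for x y
  proof -
    have "\<bar>g x - g y\<bar> \<le> L * \<bar>x - y\<bar>"
      using slope[of x y] slope[of y x] by (cases "x \<le> y"; simp add: abs_if)
    also have "\<dots> \<le> \<bar>L\<bar> * \<bar>x - y\<bar>" by (intro mult_right_mono) auto
    finally show ?thesis .
  qed
  then have "\<bar>L\<bar>-lipschitz_on UNIV g" by (intro lipschitz_onI) (auto simp: dist_real_def)
  then have cont: "continuous_on UNIV g" by (rule lipschitz_on_continuous_on)
  have "\<exists>x. g x = y" for y
  proof -
    let ?c = "\<bar>y - g 0\<bar>"
    have "g (- ?c) \<le> y" "y \<le> g ?c" using slope[of "- ?c" 0] slope[of 0 ?c] by auto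
    then show ?thesis
      using IVT'[of g "- ?c" y ?c] continuous_on_subset[OF cont] by (metis abs_ge_zero neg_le_0_iff_le order_trans subset_UNIV)
  qed
  then obtain k where gk: "\<And>y. g (k y) = y" by metis
  have kg: "k (g x) = x" for x
    using slope[of "k (g x)" x] slope[of x "k (g x)"] gk[of "g x"] by (cases "x \<le> k (g x)") auto
  let ?E = "\<lambda>(p, q). {x. \<forall>d>0. (\<exists>h. h \<noteq> 0 \<and> \<bar>h\<bar> < d \<and> (g (x + h) - g x) / h < p) \<and>
                              (\<exists>h. h \<noteq> 0 \<and> \<bar>h\<bar> < d \<and> (g (x + h) - g x) / h > q)}"
  let ?Q = "{(p, q). p \<in> \<rat> \<and> q \<in> \<rat> \<and> 0 < p \<and> p < (q :: real)}"
  have "countable ?Q"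
    by (rule countable_subset[of _ "\<rat> \<times> \<rat>"]) (auto simp: countable_rat)
  moreover have "negligible (?E pq)" if "pq \<in> ?Q" for pq
    using slopes_cross_null[OF kg gk slope] that by (auto split: prod.splits)
  ultimately have "negligible (\<Union>pq\<in>?Q. ?E pq)"
    by (intro negligible_countable_Union) auto
  moreover have "{x. \<not> g differentiable at x} \<subseteq> (\<Union>pq\<in>?Q. ?E pq)"
  proof
    fix x assume "x \<in> {x. \<not> g differentiable at x}"
    then have x: "\<not> g differentiable at x" by simp
    show "x \<in> (\<Union>pq\<in>?Q. ?E pq)"
    proof (rule ccontr)
      assume "x \<notin> (\<Union>pq\<in>?Q. ?E pq)"
      then have none: "x \<notin> ?E (p, q)" if "p \<in> \<rat>" "q \<in> \<rat>" "0 < p" "p < q" for p q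
        using that by blast
      show False
        using differentiable_if_slopes_do_not_cross[OF slope, of x] none x by (simp only: prod.case mem_Collect_eq) blast
    qed
  qed
  ultimately show ?thesis by (rule negligible_subset)
qed

text \<open>
  One-dimensional Rademacher theorem. Adding a steep linear function to a component gives a function to
  which the preceding lemma applies.
\<close>
theorem lipschitz_differentiable_ae:
  fixes f :: "real \<Rightarrow> 'v::euclidean_space"
  assumes lip: "\<And>s t. norm (f t - f s) \<le> C * \<bar>t - s\<bar>"
  shows "AE t in lborel. f differentiable at t"
proof -
  have "negligible {t. \<not> (\<lambda>t. f t \<bullet> i) differentiable at t}" if i: "i \<in> Basis" for i
  proof -
    \<comment> \<open>The slopes of \<open>f t \<bullet> i\<close> are at least \<open>- C\<close>; those of \<open>g\<close> are at least \<open>1\<close>.\<close>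
    define g where "g t = f t \<bullet> i + (C + 1) * t" for t
    have bound: "\<bar>f t \<bullet> i - f s \<bullet> i\<bar> \<le> C * \<bar>t - s\<bar>" for s t
      using Basis_le_norm[OF i, of "f t - f s"] lip[of t s] by (simp add: inner_diff_left)
    have "y - x \<le> g y - g x \<and> g y - g x \<le> (2 * C + 1) * (y - x)" if "x \<le> y" for x y
      using bound[of y x] that by (auto simp: g_def abs_le_iff algebra_simps)
    then have "negligible {t. \<not> g differentiable at t}" by (rule steep_lipschitz_differentiable_ae)
    moreover have "(\<lambda>t. f t \<bullet> i) differentiable at t" if "g differentiable at t" for t
    proof -
      have "(\<lambda>t. g t - (C + 1) * t) differentiable at t"
        by (intro differentiable_diff that differentiable_mult) auto
      then show ?thesis by (simp add: g_def)
    qed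
    ultimately show ?thesis by (elim negligible_subset) auto
  qed
  then have "negligible (\<Union>i\<in>Basis. {t. \<not> (\<lambda>t. f t \<bullet> i) differentiable at t})"
    by (intro negligible_Union) auto
  then have "AE t in lebesgue. t \<notin> (\<Union>i\<in>Basis. {t. \<not> (\<lambda>t. f t \<bullet> i) differentiable at t})"
    by (intro AE_not_in) (simp add: negligible_iff_null_sets)
  then have "AE t in lebesgue. f differentiable at t"
    by eventually_elim (subst differentiable_componentwise_within, auto)
  then show ?thesis by (simp add: AE_completion_iff)
qed

section \<open>The time scale\<close>

locale step_sizes =
  fixes a :: "nat \<Rightarrow> real"
  assumes a_pos: "\<And>n. a n > 0" and a_lim: "a \<longlonglongrightarrow> 0" and a_sum: "\<not> summable a"
begin

abbreviation "time \<equiv> step_time a"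
abbreviation "idx \<equiv> step_index a"

lemma time_0 [simp]: "time 0 = 0" by (simp add: step_time_def)

lemma time_Suc: "time (Suc n) = time n + a n" by (simp add: step_time_def)

lemma time_strict_mono: "strict_mono time"
  using a_pos by (auto simp: strict_mono_Suc_iff time_Suc)

lemma time_le_iff [simp]: "time m \<le> time n \<longleftrightarrow> m \<le> n"
  using strict_mono_less_eq[OF time_strict_mono] .

lemma time_less_iff [simp]: "time m < time n \<longleftrightarrow> m < n"
  using strict_mono_less[OF time_strict_mono] .

lemma time_nonneg [simp]: "0 \<le> time n"
  using time_le_iff[of 0 n] by simp

lemma time_diff: "n \<le> m \<Longrightarrow> time m - time n = (\<Sum>i\<in>{n..<m}. a i)"
  unfolding step_time_def by (simp add: sum_diff_nat_ivl lessThan_atLeast0)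

lemma time_at_top: "filterlim time at_top sequentially"
proof (rule filterlim_at_top_mono[OF _ eventually_sequentiallyI[of 0]])
  have "\<not> bounded (range time)"
  proof
    assume "bounded (range time)"
    then obtain B where "\<And>n. \<bar>time n\<bar> \<le> B" by (auto simp: bounded_iff)
    then have "(\<Sum>i\<le>n. a i) \<le> B" for n
      by (metis abs_le_D1 lessThan_Suc_atMost step_time_def)
    then have "summable a"
      by (intro bounded_imp_summable) (auto intro: less_imp_le a_pos)
    then show False using a_sum by simp
  qed
  have "\<exists>n. time n \<ge> B" for B
  proof (rule ccontr)
    assume "\<nexists>n. time n \<ge> B"
    then have "\<bar>time n\<bar> \<le> B" for n by (simp add: not_le less_imp_le)
    then show False using \<open>\<not> bounded (range time)\<close> by (auto simp: bounded_iff)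
  qed
  then show "filterlim time at_top sequentially"
    unfolding filterlim_at_top eventually_sequentially by (meson order_trans time_le_iff)
qed simp

lemma idx_works:
  assumes "t \<ge> 0"
  shows "time (idx t) \<le> t" "t < time (Suc (idx t))"
proof -
  let ?A = "{n. time n \<le> t}"
  obtain N where N: "\<And>n. n \<ge> N \<Longrightarrow> time n \<ge> t + 1"
    using time_at_top unfolding filterlim_at_top eventually_sequentially by meson
  have fin: "finite ?A"
  proof (rule finite_subset)
    show "?A \<subseteq> {..<N}"
    proof
      fix n assume "n \<in> ?A"
      then show "n \<in> {..<N}" using N[of n] by (cases "n < N") auto
    qed
  qed simp
  have ne: "0 \<in> ?A" using assms by simp
  have eq: "idx t = Max ?A" using assms by (simp add: step_index_def)
  show "time (idx t) \<le> t" using Max_in[OF fin] ne unfolding eq by blast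
  show "t < time (Suc (idx t))"
    using Max_ge[OF fin, of "Suc (idx t)"] unfolding eq by (auto simp: not_le[symmetric])
qed

lemma idx_eqI:
  assumes "time n \<le> t" "t < time (Suc n)"
  shows "idx t = n"
proof -
  have t: "t \<ge> 0" using assms(1) time_nonneg[of n] by linarith
  have "time n < time (Suc (idx t))" "time (idx t) < time (Suc n)"
    using idx_works[OF t] assms by linarith+
  then show ?thesis by simp
qed

lemma idx_time [simp]: "idx (time n) = n"
  by (rule idx_eqI) auto

lemma idx_mono:
  assumes "0 \<le> s" "s \<le> t"
  shows "idx s \<le> idx t"
proof -
  have "time (idx s) < time (Suc (idx t))"
    using idx_works[of s] idx_works[of t] assms by linarith
  then show ?thesis by simp
qed

lemma le_idx:
  assumes "time n \<le> t" shows "n \<le> idx t"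
  using idx_mono[of "time n" t] assms by simp

lemma idx_at_top: "filterlim idx at_top at_top"
  unfolding filterlim_at_top
proof
  fix n show "\<forall>\<^sub>F t in at_top. n \<le> idx t"
    using eventually_ge_at_top[of "time n"] by eventually_elim (rule le_idx)
qed



section \<open>Vanishing averages\<close>

text \<open>
  The sums run over all late windows of length at most \<open>T\<close>, not only over those starting at multiples of
  \<open>T\<close>. This form is stable under sums, smaller windows and uniform approximation.
\<close>
definition averages_to_zero :: "real \<Rightarrow> (nat \<Rightarrow> 'v::real_normed_vector) \<Rightarrow> bool" where
  "averages_to_zero T z \<longleftrightarrow>
     (\<forall>\<epsilon>>0. \<forall>\<^sub>F n in sequentially. \<forall>m\<ge>n. time m - time n \<le> T \<longrightarrow>
        norm (\<Sum>i\<in>{n..<m}. a i *\<^sub>R z i) \<le> \<epsilon>)"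

lemma averages_to_zero_mono: "averages_to_zero T z \<Longrightarrow> T' \<le> T \<Longrightarrow> averages_to_zero T' z"
  unfolding averages_to_zero_def
proof (intro allI impI)
  fix \<epsilon> :: real
  assume *: "\<forall>\<epsilon>>0. \<forall>\<^sub>F n in sequentially. \<forall>m\<ge>n. time m - time n \<le> T \<longrightarrow>
      norm (\<Sum>i\<in>{n..<m}. a i *\<^sub>R z i) \<le> \<epsilon>" and "T' \<le> T" "\<epsilon> > 0"
  then have "\<forall>\<^sub>F n in sequentially. \<forall>m\<ge>n. time m - time n \<le> T \<longrightarrow>
      norm (\<Sum>i\<in>{n..<m}. a i *\<^sub>R z i) \<le> \<epsilon>" by blast
  then show "\<forall>\<^sub>F n in sequentially. \<forall>m\<ge>n. time m - time n \<le> T' \<longrightarrow>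
      norm (\<Sum>i\<in>{n..<m}. a i *\<^sub>R z i) \<le> \<epsilon>"
    by eventually_elim (use \<open>T' \<le> T\<close> in auto)
qed

lemma averages_to_zero_add:
  assumes "averages_to_zero T z" "averages_to_zero T z'"
  shows "averages_to_zero T (\<lambda>i. z i + z' i)"
  unfolding averages_to_zero_def
proof (intro allI impI)
  fix \<epsilon> :: real assume "\<epsilon> > 0"
  then have "\<epsilon> / 2 > 0" by simp
  then have "\<forall>\<^sub>F n in sequentially. \<forall>m\<ge>n. time m - time n \<le> T \<longrightarrow> norm (\<Sum>i\<in>{n..<m}. a i *\<^sub>R z i) \<le> \<epsilon> / 2"
    "\<forall>\<^sub>F n in sequentially. \<forall>m\<ge>n. time m - time n \<le> T \<longrightarrow> norm (\<Sum>i\<in>{n..<m}. a i *\<^sub>R z' i) \<le> \<epsilon> / 2"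
    using assms unfolding averages_to_zero_def by blast+
  then show "\<forall>\<^sub>F n in sequentially. \<forall>m\<ge>n. time m - time n \<le> T \<longrightarrow>
      norm (\<Sum>i\<in>{n..<m}. a i *\<^sub>R (z i + z' i)) \<le> \<epsilon>"
  proof eventually_elim
    case (elim n)
    show ?case
    proof (intro allI impI)
      fix m assume "n \<le> m" "time m - time n \<le> T"
      then have "norm (\<Sum>i\<in>{n..<m}. a i *\<^sub>R z i) \<le> \<epsilon> / 2" "norm (\<Sum>i\<in>{n..<m}. a i *\<^sub>R z' i) \<le> \<epsilon> / 2"
        using elim by blast+
      then show "norm (\<Sum>i\<in>{n..<m}. a i *\<^sub>R (z i + z' i)) \<le> \<epsilon>"
        unfolding scaleR_add_right sum.distrib by (intro order_trans[OF norm_triangle_ineq]) simp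
    qed
  qed
qed

lemma norm_weighted_sum_le:
  assumes "\<And>i. i \<in> {n..<m} \<Longrightarrow> norm (z i) \<le> c" "n \<le> m"
  shows "norm (\<Sum>i\<in>{n..<m}. a i *\<^sub>R z i) \<le> c * (time m - time n)"
proof -
  have "norm (\<Sum>i\<in>{n..<m}. a i *\<^sub>R z i) \<le> (\<Sum>i\<in>{n..<m}. a i * c)"
    using assms a_pos by (intro sum_norm_le) (auto simp: less_imp_le abs_of_pos intro!: mult_left_mono)
  then show ?thesis by (simp add: time_diff[OF assms(2)] sum_distrib_left mult.commute)
qed

lemma averages_to_zero_approx:
  assumes T: "T > 0"
    and approx: "\<And>\<eta>. \<eta> > 0 \<Longrightarrow> \<exists>z'. averages_to_zero T z' \<and> (\<forall>\<^sub>F i in sequentially. norm (z i - z' i) \<le> \<eta>)"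
  shows "averages_to_zero T z"
  unfolding averages_to_zero_def
proof (intro allI impI)
  fix \<epsilon> :: real assume \<epsilon>: "\<epsilon> > 0"
  define \<eta> where "\<eta> = \<epsilon> / (2 * T)"
  have \<eta>: "\<eta> > 0" using \<epsilon> T by (simp add: \<eta>_def)
  obtain z' where z': "averages_to_zero T z'" "\<forall>\<^sub>F i in sequentially. norm (z i - z' i) \<le> \<eta>"
    using approx[OF \<eta>] by blast
  have "\<epsilon> / 2 > 0" using \<epsilon> by simp
  then have "\<forall>\<^sub>F n in sequentially. \<forall>m\<ge>n. time m - time n \<le> T \<longrightarrow> norm (\<Sum>i\<in>{n..<m}. a i *\<^sub>R z' i) \<le> \<epsilon> / 2"
    using z'(1) unfolding averages_to_zero_def by blast
  moreover have "\<forall>\<^sub>F n in sequentially. \<forall>i\<ge>n. norm (z i - z' i) \<le> \<eta>"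
    using z'(2) by (rule eventually_all_ge_at_top)
  ultimately show "\<forall>\<^sub>F n in sequentially. \<forall>m\<ge>n. time m - time n \<le> T \<longrightarrow>
      norm (\<Sum>i\<in>{n..<m}. a i *\<^sub>R z i) \<le> \<epsilon>"
  proof eventually_elim
    case (elim n)
    show ?case
    proof (intro allI impI)
      fix m assume m: "n \<le> m" "time m - time n \<le> T"
      then have 1: "norm (\<Sum>i\<in>{n..<m}. a i *\<^sub>R z' i) \<le> \<epsilon> / 2"
        using elim by blast
      have "norm (\<Sum>i\<in>{n..<m}. a i *\<^sub>R (z i - z' i)) \<le> \<eta> * (time m - time n)"
        using elim m by (intro norm_weighted_sum_le) auto
      also have "\<dots> \<le> \<eta> * T" using m \<eta> by (intro mult_left_mono) auto
      also have "\<dots> = \<epsilon> / 2" using T by (simp add: \<eta>_def)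
      finally have 2: "norm (\<Sum>i\<in>{n..<m}. a i *\<^sub>R (z i - z' i)) \<le> \<epsilon> / 2" .
      have "(\<Sum>i\<in>{n..<m}. a i *\<^sub>R z i) = (\<Sum>i\<in>{n..<m}. a i *\<^sub>R z' i) + (\<Sum>i\<in>{n..<m}. a i *\<^sub>R (z i - z' i))"
        by (simp add: sum.distrib[symmetric] algebra_simps)
      then show "norm (\<Sum>i\<in>{n..<m}. a i *\<^sub>R z i) \<le> \<epsilon>"
        using 1 2 by (metis (no_types, lifting) field_sum_of_halves norm_triangle_le add_mono)
    qed
  qed
qed

lemma averages_to_zero_vanishing:
  fixes z :: "nat \<Rightarrow> 'v::real_normed_vector"
  assumes "T > 0" "z \<longlonglongrightarrow> 0"
  shows "averages_to_zero T z"
proof (rule averages_to_zero_approx[OF assms(1)])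
  fix \<eta> :: real assume "\<eta> > 0"
  then have "\<forall>\<^sub>F i in sequentially. norm (z i) < \<eta>"
    using assms(2) by (auto simp: tendsto_iff)
  then have "\<forall>\<^sub>F i in sequentially. norm (z i - 0) \<le> \<eta>"
    by eventually_elim simp
  moreover have "averages_to_zero T (\<lambda>i. 0 :: 'v)"
    by (simp add: averages_to_zero_def)
  ultimately show "\<exists>z'. averages_to_zero T z' \<and> (\<forall>\<^sub>F i in sequentially. norm (z i - z' i) \<le> \<eta>)"
    by (intro exI[of _ "\<lambda>i. 0"]) auto
qed

text \<open>
  A window of length at most \<open>T\<close> meets at most two consecutive windows of the grid \<open>{j * T..(j + 1) * T}\<close>, so its
  sum is a combination of at most three sums of the grid.
\<close>
lemma averages_to_zero_if_window_sums_vanish: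
  fixes z :: "nat \<Rightarrow> 'v::real_normed_vector"
  assumes T: "T > 0"
    and windows: "\<And>\<epsilon>. \<epsilon> > 0 \<Longrightarrow> \<exists>n0. \<forall>j\<ge>n0. \<forall>t\<in>{0..T}. norm (window_sum a T z j t) \<le> \<epsilon>"
  shows "averages_to_zero T z"
  unfolding averages_to_zero_def
proof (intro allI impI)
  fix \<epsilon> :: real assume \<epsilon>: "\<epsilon> > 0"
  \<comment> \<open>All sums in question are differences of the partial sums \<open>P\<close>.\<close>
  define P where "P k = (\<Sum>i<k. a i *\<^sub>R z i)" for k
  have P_diff: "P m - P n = (\<Sum>i\<in>{n..<m}. a i *\<^sub>R z i)" if "n \<le> m" for n m
    unfolding P_def using sum_diff_nat_ivl[of 0 n m "\<lambda>i. a i *\<^sub>R z i"] that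
    by (simp add: lessThan_atLeast0)
  have window: "window_sum a T z j t = P (idx (real j * T + t)) - P (idx (real j * T))" if "t \<ge> 0" for j t
    using that T by (subst P_diff) (auto simp: window_sum_def intro!: idx_mono)
  obtain n0 where n0: "\<And>j t. j \<ge> n0 \<Longrightarrow> t \<in> {0..T} \<Longrightarrow> norm (window_sum a T z j t) \<le> \<epsilon> / 3"
    using windows[of "\<epsilon> / 3"] \<epsilon> by (metis divide_pos_pos zero_less_numeral)
  have "\<forall>\<^sub>F n in sequentially. time n \<ge> real n0 * T"
    using time_at_top by (auto simp: filterlim_at_top)
  then show "\<forall>\<^sub>F n in sequentially. \<forall>m\<ge>n. time m - time n \<le> T \<longrightarrow>
      norm (\<Sum>i\<in>{n..<m}. a i *\<^sub>R z i) \<le> \<epsilon>"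
  proof eventually_elim
    case (elim n)
    show ?case
    proof (intro allI impI)
      fix m assume m: "n \<le> m" "time m - time n \<le> T"
      define j where "j = nat \<lfloor>time n / T\<rfloor>"
      have j_real: "real j = of_int \<lfloor>time n / T\<rfloor>"
        using T by (simp add: j_def)
      have "real j \<le> time n / T" "time n / T < real j + 1"
        unfolding j_real by linarith+
      then have j: "real j * T \<le> time n" "time n < (real j + 1) * T"
        using T by (simp_all add: field_simps)
      have "real n0 * T < (real j + 1) * T" using elim j by linarith
      then have jn0: "n0 \<le> j" using T by simp
      have near: "norm (P k - P (idx (real i * T))) \<le> \<epsilon> / 3"
        if "real i * T \<le> time k" "time k \<le> (real i + 1) * T" "n0 \<le> i" for i k
      proof -
        have "window_sum a T z i (time k - real i * T) = P k - P (idx (real i * T))"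
          using window[of "time k - real i * T" i] that(1) by simp
        moreover have "norm (window_sum a T z i (time k - real i * T)) \<le> \<epsilon> / 3"
          using that by (intro n0) (auto simp: algebra_simps)
        ultimately show ?thesis by simp
      qed
      have Pn: "norm (P n - P (idx (real j * T))) \<le> \<epsilon> / 3"
        using near j jn0 by simp
      have "norm (P m - P n) \<le> \<epsilon>"
      proof (cases "time m \<le> (real j + 1) * T")
        case True
        have "real j * T \<le> time m" using j m by (meson order_trans time_le_iff)
        then have "norm (P m - P (idx (real j * T))) \<le> \<epsilon> / 3"
          using near True jn0 by simp
        then have "norm ((P m - P (idx (real j * T))) - (P n - P (idx (real j * T)))) \<le> \<epsilon> / 3 + \<epsilon> / 3"
          using Pn norm_triangle_ineq4 by (meson add_mono order_trans)
        then show ?thesis using \<epsilon> by simp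
      next
        case False
        have "real (Suc j) * T \<le> time m" "time m \<le> (real (Suc j) + 1) * T"
          using False m j by (auto simp: algebra_simps)
        then have 1: "norm (P m - P (idx (real (Suc j) * T))) \<le> \<epsilon> / 3"
          using near[of "Suc j" m] jn0 by simp
        have 2: "norm (P (idx (real (Suc j) * T)) - P (idx (real j * T))) \<le> \<epsilon> / 3"
          using n0[OF jn0, of T] window[of T j] T by (simp add: algebra_simps)
        have "P m - P n = (P m - P (idx (real (Suc j) * T))) + (P (idx (real (Suc j) * T)) - P (idx (real j * T)))
            - (P n - P (idx (real j * T)))" by simp
        also have "norm \<dots> \<le> (\<epsilon> / 3 + \<epsilon> / 3) + \<epsilon> / 3"
          by (intro order_trans[OF norm_triangle_ineq4] add_mono order_trans[OF norm_triangle_ineq] 1 2 Pn)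
        finally show ?thesis by simp
      qed
      then show "norm (\<Sum>i\<in>{n..<m}. a i *\<^sub>R z i) \<le> \<epsilon>" by (simp add: P_diff[OF m(1)])
    qed
  qed
qed

text \<open>
  The window sums depend on the time \<open>t\<close> only through its index, so the supremum over the interval \<open>{0..T}\<close>
  is one over a countable set.
\<close>
lemma window_sup_measurable:
  fixes \<Phi> :: "nat \<Rightarrow> 'a \<Rightarrow> 'v::euclidean_space"
  assumes [measurable]: "\<And>i. \<Phi> i \<in> borel_measurable M"
  shows "(\<lambda>\<omega>. window_sup T n (\<lambda>j t. norm (window_sum a T (\<lambda>i. \<Phi> i \<omega>) j t))) \<in> borel_measurable M"
proof -
  have *: "(SUP t\<in>{0..T}. ereal (norm (window_sum a T (\<lambda>i. \<Phi> i \<omega>) j t))) =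
    (SUP k\<in>(\<lambda>t. idx (real j * T + t)) ` {0..T}. ereal (norm (\<Sum>i\<in>{idx (real j * T)..<k}. a i *\<^sub>R \<Phi> i \<omega>)))" for \<omega> j
    by (simp add: window_sum_def image_image)
  show ?thesis
    unfolding window_sup_def *
    by (intro borel_measurable_SUP) (auto intro: countable_subset[OF subset_UNIV])
qed

text \<open>
  The events in the hypothesis decrease with \<open>n\<close> and their probabilities tend to \<open>0\<close>, so their intersection
  is null for each of the countably many \<open>\<epsilon> = 1 / Suc k\<close>.
\<close>
lemma AE_averages_to_zero:
  fixes \<Phi> :: "nat \<Rightarrow> 'a \<Rightarrow> 'v::euclidean_space"
  assumes M: "prob_space M" and [measurable]: "\<And>i. \<Phi> i \<in> borel_measurable M"
    and T: "T > 0" and avg: "averages_out M a T \<Phi>"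
  shows "AE \<omega> in M. averages_to_zero T (\<lambda>i. \<Phi> i \<omega>)"
proof -
  interpret prob_space M by fact
  define A where "A \<epsilon> n = {\<omega>\<in>space M. window_sup T n (\<lambda>j t. norm (window_sum a T (\<lambda>i. \<Phi> i \<omega>) j t)) \<ge> ereal \<epsilon>}"
    for \<epsilon> n
  have A_sets: "A \<epsilon> n \<in> sets M" for \<epsilon> n
    unfolding A_def using window_sup_measurable[of \<Phi> M] by measurable
  have "AE \<omega> in M. \<omega> \<notin> (\<Inter>n. A (1 / Suc k) n)" for k
  proof -
    have "prob (\<Inter>n. A (1 / Suc k) n) \<le> 0"
    proof (rule LIMSEQ_le_const)
      show "(\<lambda>n. prob (A (1 / Suc k) n)) \<longlonglongrightarrow> 0"
        using avg unfolding averages_out_def A_def by simp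
      show "\<exists>N. \<forall>n\<ge>N. prob (\<Inter>n. A (1 / Suc k) n) \<le> prob (A (1 / Suc k) n)"
        by (intro exI allI impI finite_measure_mono A_sets) auto
    qed
    then have "(\<Inter>n. A (1 / Suc k) n) \<in> null_sets M"
      using A_sets by (auto simp: null_sets_def emeasure_eq_measure measure_le_0_iff)
    then show ?thesis by (rule AE_not_in)
  qed
  then have "AE \<omega> in M. \<forall>k. \<omega> \<notin> (\<Inter>n. A (1 / Suc k) n)" by (simp add: AE_all_countable)
  with AE_space show ?thesis
  proof eventually_elim
    case (elim \<omega>)
    show ?case
    proof (rule averages_to_zero_if_window_sums_vanish[OF T])
      fix \<epsilon> :: real assume "\<epsilon> > 0"
      then obtain k where k: "1 / real (Suc k) < \<epsilon>" using nat_approx_posE by blast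
      obtain n where "\<omega> \<notin> A (1 / Suc k) n" using elim by blast
      then have n: "window_sup T n (\<lambda>j t. norm (window_sum a T (\<lambda>i. \<Phi> i \<omega>) j t)) < ereal (1 / Suc k)"
        using elim by (simp add: A_def not_le del: of_nat_Suc)
      have "norm (window_sum a T (\<lambda>i. \<Phi> i \<omega>) j t) \<le> \<epsilon>" if "j \<ge> n" "t \<in> {0..T}" for j t
      proof -
        have "ereal (norm (window_sum a T (\<lambda>i. \<Phi> i \<omega>) j t)) \<le> window_sup T n (\<lambda>j t. norm (window_sum a T (\<lambda>i. \<Phi> i \<omega>) j t))"
          unfolding window_sup_def using that by (intro SUP_upper2[of j] SUP_upper2[of t]) auto
        then have "ereal (norm (window_sum a T (\<lambda>i. \<Phi> i \<omega>) j t)) < ereal (1 / Suc k)" using n by (rule le_less_trans)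
        then show ?thesis using k by (simp del: of_nat_Suc)
      qed
      then show "\<exists>n0. \<forall>j\<ge>n0. \<forall>t\<in>{0..T}. norm (window_sum a T (\<lambda>i. \<Phi> i \<omega>) j t) \<le> \<epsilon>" by blast
    qed
  qed
qed

text \<open>
  Countably many points are dealt with on one null set; equicontinuity carries the conclusion from a dense
  set to all points, on the same null set.
\<close>
lemma AE_averages_to_zero_all:
  fixes \<Phi> :: "'x::euclidean_space \<Rightarrow> nat \<Rightarrow> 'a \<Rightarrow> 'v::euclidean_space"
  assumes M: "prob_space M" and meas: "\<And>x i. \<Phi> x i \<in> borel_measurable M"
    and T: "T > 0" and avg: "\<And>x. averages_out M a T (\<Phi> x)"
    and equi: "\<And>x \<epsilon>. \<epsilon> > 0 \<Longrightarrow>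
      \<exists>\<delta>>0. \<forall>y. dist y x < \<delta> \<longrightarrow> (\<forall>i. \<forall>\<omega>\<in>space M. norm (\<Phi> y i \<omega> - \<Phi> x i \<omega>) \<le> \<epsilon>)"
  shows "AE \<omega> in M. \<forall>x. averages_to_zero T (\<lambda>i. \<Phi> x i \<omega>)"
proof -
  obtain D :: "'x set" where D: "countable D" "\<And>U. open U \<Longrightarrow> U \<noteq> {} \<Longrightarrow> \<exists>d\<in>D. d \<in> U"
    using countable_dense_setE by blast
  have "AE \<omega> in M. \<forall>x\<in>D. averages_to_zero T (\<lambda>i. \<Phi> x i \<omega>)"
    using D(1) AE_averages_to_zero[OF M meas T avg] by (simp add: AE_ball_countable)
  with AE_space show ?thesis
  proof eventually_elim
    case (elim \<omega>)
    show ?case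
    proof (intro allI averages_to_zero_approx[OF T])
      fix x :: 'x and \<eta> :: real assume "\<eta> > 0"
      then obtain \<delta> where \<delta>: "\<delta> > 0" "\<And>y i. dist y x < \<delta> \<Longrightarrow> norm (\<Phi> y i \<omega> - \<Phi> x i \<omega>) \<le> \<eta>"
        using equi elim(1) by meson
      obtain y where y: "y \<in> D" "y \<in> ball x \<delta>" using D(2)[of "ball x \<delta>"] \<delta>(1) by auto
      then have "norm (\<Phi> x i \<omega> - \<Phi> y i \<omega>) \<le> \<eta>" for i
        using \<delta>(2)[of y i] by (simp add: dist_commute norm_minus_commute)
      then show "\<exists>z'. averages_to_zero T z' \<and> (\<forall>\<^sub>F i in sequentially. norm (\<Phi> x i \<omega> - z' i) \<le> \<eta>)"
        using y elim(2) by (intro exI[of _ "\<lambda>i. \<Phi> y i \<omega>"]) auto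
    qed
  qed
qed

end

section \<open>The iteration follows the inclusion over short times\<close>

text \<open>
  Otherwise points \<open>g n \<in> G (x n)\<close> with \<open>x n\<close> tending to \<open>x0\<close> stay away from \<open>G x0\<close>; a limit point of them
  lies in \<open>G x0\<close> because the graph is closed.
\<close>
lemma upper_semicontinuous_if_closed_graph:
  fixes G :: "'v::euclidean_space \<Rightarrow> 'v set"
  assumes bound: "\<And>x. G x \<subseteq> cball 0 R" and graph: "closed {(x, y). y \<in> G x}" and \<eta>: "\<eta> > 0"
  shows "\<exists>\<delta>>0. \<forall>x. dist x x0 < \<delta> \<longrightarrow> (\<forall>g\<in>G x. \<exists>g'\<in>G x0. dist g g' < \<eta>)"
proof (rule ccontr)
  assume contra: "\<not> ?thesis"
  have "\<exists>x g. dist x x0 < 1 / real (Suc n) \<and> g \<in> G x \<and> (\<forall>g'\<in>G x0. dist g g' \<ge> \<eta>)" for n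
  proof -
    have "1 / real (Suc n) > 0" by simp
    then show ?thesis using contra by (meson not_le)
  qed
  then obtain x g where xg: "\<And>n. dist (x n) x0 < 1 / real (Suc n)" "\<And>n. g n \<in> G (x n)"
    "\<And>n g'. g' \<in> G x0 \<Longrightarrow> dist (g n) g' \<ge> \<eta>" by metis
  have "\<forall>n. g n \<in> cball 0 R" using bound xg(2) by blast
  then obtain l r where l: "strict_mono (r :: nat \<Rightarrow> nat)" "(g \<circ> r) \<longlonglongrightarrow> l"
    using compact_cball[of "0 :: 'v" R] unfolding compact_def by metis
  have "x \<longlonglongrightarrow> x0"
  proof (rule metric_LIMSEQ_I)
    fix e :: real assume "e > 0"
    then obtain N where N: "1 / real (Suc N) < e" using nat_approx_posE by blast
    have "dist (x n) x0 < e" if "n \<ge> N" for n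
    proof -
      have "1 / real (Suc n) \<le> 1 / real (Suc N)" using that by (simp add: frac_le)
      then show ?thesis using xg(1)[of n] N by linarith
    qed
    then show "\<exists>N. \<forall>n\<ge>N. dist (x n) x0 < e" by blast
  qed
  then have "(x \<circ> r) \<longlonglongrightarrow> x0" using l(1) by (rule LIMSEQ_subseq_LIMSEQ)
  then have lim: "(\<lambda>n. ((x \<circ> r) n, (g \<circ> r) n)) \<longlonglongrightarrow> (x0, l)" using l(2) by (rule tendsto_Pair)
  have "((x \<circ> r) n, (g \<circ> r) n) \<in> {(x, y). y \<in> G x}" for n using xg(2)[of "r n"] by simp
  then have "(x0, l) \<in> {(x, y). y \<in> G x}"
    by (rule closed_sequentially[OF graph _ lim])
  then have far: "\<eta> \<le> dist ((g \<circ> r) n) l" for n using xg(3) by simp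
  have "\<forall>\<^sub>F n in sequentially. dist ((g \<circ> r) n) l < \<eta>" using l(2) \<eta> by (rule tendstoD)
  then obtain n where "dist ((g \<circ> r) n) l < \<eta>" using eventually_happens'[OF sequentially_bot] by blast
  then show False using far[of n] by simp
qed

context step_sizes
begin

text \<open>
  A discrete form of the inclusion. While \<open>x\<close> stays near \<open>p\<close>, its increments are \<open>F p\<close> times the elapsed
  time, up to an error of two kinds: \<open>\<eta>\<close> per unit of time, which the neighbourhood of \<open>p\<close> controls, and \<open>\<epsilon>\<close>,
  which vanishes at late times. The radius and the window length may depend on \<open>\<eta>\<close> but not on \<open>\<epsilon>\<close>.
\<close>
definition follows :: "('v::euclidean_space \<Rightarrow> 'v set) \<Rightarrow> (nat \<Rightarrow> 'v) \<Rightarrow> bool" where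
  "follows F x \<longleftrightarrow> (\<forall>p. \<forall>\<eta>>0. \<exists>\<delta>>0. \<exists>T>0. \<forall>\<epsilon>>0. \<forall>\<^sub>F n in sequentially. \<forall>m\<ge>n.
     time m - time n \<le> T \<longrightarrow> (\<forall>i\<in>{n..<m}. dist (x i) p < \<delta>) \<longrightarrow>
     (\<exists>y\<in>F p. norm (x m - x n - (time m - time n) *\<^sub>R y) \<le> \<eta> * (time m - time n) + \<epsilon>))"

text \<open>
  Up to the noise \<open>r\<close>, whose sums are negligible, every velocity is within \<open>\<eta> + \<mu> i\<close> of \<open>K\<close>. The average of the
  nearby points of \<open>K\<close>, weighted by the step sizes, is in \<open>K\<close> by convexity.
\<close>
lemma increments_near_convex_set:
  fixes x :: "nat \<Rightarrow> 'v::euclidean_space"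
  assumes K: "convex K" "K \<noteq> {}"
    and x: "\<And>i. x (Suc i) = x i + a i *\<^sub>R v i"
    and r: "averages_to_zero T r" and \<mu>: "averages_to_zero T \<mu>"
    and near: "\<And>i. dist (x i) p < \<delta> \<Longrightarrow> \<exists>y\<in>K. norm (v i - r i - y) \<le> \<eta> + \<mu> i"
    and \<epsilon>: "\<epsilon> > 0"
  shows "\<forall>\<^sub>F n in sequentially. \<forall>m\<ge>n.
     time m - time n \<le> T \<longrightarrow> (\<forall>i\<in>{n..<m}. dist (x i) p < \<delta>) \<longrightarrow>
     (\<exists>y\<in>K. norm (x m - x n - (time m - time n) *\<^sub>R y) \<le> \<eta> * (time m - time n) + \<epsilon>)"
proof -
  have "\<epsilon> / 2 > 0" using \<epsilon> by simp
  then have "\<forall>\<^sub>F n in sequentially. \<forall>m\<ge>n. time m - time n \<le> T \<longrightarrow> norm (\<Sum>i\<in>{n..<m}. a i *\<^sub>R r i) \<le> \<epsilon> / 2"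
    "\<forall>\<^sub>F n in sequentially. \<forall>m\<ge>n. time m - time n \<le> T \<longrightarrow> norm (\<Sum>i\<in>{n..<m}. a i *\<^sub>R \<mu> i) \<le> \<epsilon> / 2"
    using r \<mu> unfolding averages_to_zero_def by blast+
  then show ?thesis
  proof eventually_elim
    case (elim n)
    show ?case
    proof (intro allI impI)
      fix m assume m: "n \<le> m" "time m - time n \<le> T" and close: "\<forall>i\<in>{n..<m}. dist (x i) p < \<delta>"
      define \<tau> where "\<tau> = time m - time n"
      have incr: "x m - x n = (\<Sum>i\<in>{n..<m}. a i *\<^sub>R v i)"
        using m(1)
      proof (induction m rule: dec_induct)
        case (step k)
        then show ?case by (simp add: x algebra_simps)
      qed simp
      show "\<exists>y\<in>K. norm (x m - x n - (time m - time n) *\<^sub>R y) \<le> \<eta> * (time m - time n) + \<epsilon>"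
      proof (cases "n = m")
        case True
        then show ?thesis using K(2) \<epsilon> by auto
      next
        case False
        then have \<tau>: "\<tau> > 0" using m by (simp add: \<tau>_def)
        obtain Y where Y: "\<And>i. i \<in> {n..<m} \<Longrightarrow> Y i \<in> K \<and> norm (v i - r i - Y i) \<le> \<eta> + \<mu> i"
          using near close by metis
        define y where "y = (\<Sum>i\<in>{n..<m}. (a i / \<tau>) *\<^sub>R Y i)"
        have \<tau>_sum: "\<tau> = (\<Sum>i\<in>{n..<m}. a i)" using time_diff[OF m(1)] by (simp add: \<tau>_def)
        have "y \<in> K" unfolding y_def
        proof (rule convex_sum[OF _ K(1)])
          show "(\<Sum>i\<in>{n..<m}. a i / \<tau>) = 1"
            using \<tau> by (simp add: \<tau>_sum sum_divide_distrib[symmetric])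
        qed (use Y \<tau> a_pos in \<open>auto intro: less_imp_le\<close>)
        have "\<tau> *\<^sub>R y = (\<Sum>i\<in>{n..<m}. a i *\<^sub>R Y i)"
          using \<tau> by (simp add: y_def scaleR_sum_right)
        then have "x m - x n - \<tau> *\<^sub>R y = (\<Sum>i\<in>{n..<m}. a i *\<^sub>R v i) - (\<Sum>i\<in>{n..<m}. a i *\<^sub>R Y i)"
          by (simp add: incr)
        also have "\<dots> = (\<Sum>i\<in>{n..<m}. a i *\<^sub>R r i) + (\<Sum>i\<in>{n..<m}. a i *\<^sub>R (v i - r i - Y i))"
          by (simp add: sum.distrib[symmetric] sum_subtractf[symmetric] algebra_simps)
        finally have "norm (x m - x n - \<tau> *\<^sub>R y) \<le>
          norm (\<Sum>i\<in>{n..<m}. a i *\<^sub>R r i) + norm (\<Sum>i\<in>{n..<m}. a i *\<^sub>R (v i - r i - Y i))"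
          by (simp add: norm_triangle_ineq)
        also have "norm (\<Sum>i\<in>{n..<m}. a i *\<^sub>R (v i - r i - Y i)) \<le> (\<Sum>i\<in>{n..<m}. a i * (\<eta> + \<mu> i))"
          using Y a_pos by (intro sum_norm_le) (auto simp: abs_of_pos intro!: mult_left_mono less_imp_le[OF a_pos])
        also have "\<dots> = \<eta> * \<tau> + (\<Sum>i\<in>{n..<m}. a i *\<^sub>R \<mu> i)"
          by (simp add: \<tau>_sum distrib_left sum.distrib sum_distrib_left mult.commute)
        also have "(\<Sum>i\<in>{n..<m}. a i *\<^sub>R \<mu> i) \<le> \<epsilon> / 2" using elim m by (smt (verit) real_norm_def)
        also have "norm (\<Sum>i\<in>{n..<m}. a i *\<^sub>R r i) \<le> \<epsilon> / 2" using elim m by blast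
        finally have "norm (x m - x n - \<tau> *\<^sub>R y) \<le> \<eta> * \<tau> + \<epsilon>" by simp
        then show ?thesis using \<open>y \<in> K\<close> by (auto simp: \<tau>_def)
      qed
    qed
  qed
qed

text \<open>
  The noise at \<open>p\<close> in the sense of the previous lemma is \<open>H i p - hbar p + e i\<close>. Near \<open>p\<close> the three remaining
  errors, in \<open>G\<close>, in \<open>m\<close> and in \<open>H\<close>, are at most a third of \<open>\<eta>\<close> each.
\<close>
lemma follows_if_noise_averages:
  fixes x :: "nat \<Rightarrow> 'v::euclidean_space"
  assumes G: "\<And>x. G x \<noteq> {}" "\<And>x. convex (G x)" "\<And>x. G x \<subseteq> cball 0 R" "closed {(x, y). y \<in> G x}"
    and x: "\<And>i. x (Suc i) = x i + a i *\<^sub>R (B i (x i) + H i (x i) + e i)"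
    and B: "\<And>i y. B i y \<in> {g + m i y *\<^sub>R u | g u. g \<in> G y \<and> u \<in> cball 0 1}"
    and m_pos: "\<And>i y. m i y > 0"
    and m_cont: "\<And>p \<eta>. \<eta> > 0 \<Longrightarrow> \<exists>\<delta>>0. \<forall>y. dist y p < \<delta> \<longrightarrow> (\<forall>i. \<bar>m i y - m i p\<bar> < \<eta>)"
    and H_cont: "\<And>p \<eta>. \<eta> > 0 \<Longrightarrow> \<exists>\<delta>>0. \<forall>y. dist y p < \<delta> \<longrightarrow> (\<forall>i. dist (H i y) (H i p) < \<eta>)"
    and T: "T > 0" and m_avg: "\<And>p. averages_to_zero T (\<lambda>i. m i p)"
    and H_avg: "\<And>p. averages_to_zero T (\<lambda>i. H i p - hbar p)" and e: "averages_to_zero T e"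
  shows "follows (\<lambda>x. {hbar x + y | y. y \<in> G x}) x"
  unfolding follows_def
proof (intro allI impI)
  fix p and \<eta> :: real assume "\<eta> > 0"
  define \<eta>' where "\<eta>' = \<eta> / 3"
  have \<eta>': "\<eta>' > 0" using \<open>\<eta> > 0\<close> by (simp add: \<eta>'_def)
  let ?K = "{hbar p + y | y. y \<in> G p}"
  have K_image: "?K = (+) (hbar p) ` G p" by auto
  have K: "convex ?K" "?K \<noteq> {}"
    unfolding K_image using G(1,2) by (auto intro: convex_translation)
  obtain \<delta>1 where \<delta>1: "\<delta>1 > 0" "\<And>y i. dist y p < \<delta>1 \<Longrightarrow> \<bar>m i y - m i p\<bar> < \<eta>'" using m_cont[OF \<eta>'] by meson
  obtain \<delta>2 where \<delta>2: "\<delta>2 > 0" "\<And>y i. dist y p < \<delta>2 \<Longrightarrow> dist (H i y) (H i p) < \<eta>'" using H_cont[OF \<eta>'] by meson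
  obtain \<delta>3 where \<delta>3: "\<delta>3 > 0" "\<And>y g. dist y p < \<delta>3 \<Longrightarrow> g \<in> G y \<Longrightarrow> \<exists>g'\<in>G p. dist g g' < \<eta>'"
    using upper_semicontinuous_if_closed_graph[OF G(3,4) \<eta>'] by meson
  define \<delta> where "\<delta> = min \<delta>1 (min \<delta>2 \<delta>3)"
  define v where "v i = B i (x i) + H i (x i) + e i" for i
  define r where "r i = (H i p - hbar p) + e i" for i
  have near: "\<exists>y\<in>?K. norm (v i - r i - y) \<le> \<eta> + m i p" if close: "dist (x i) p < \<delta>" for i
  proof -
    have close': "dist (x i) p < \<delta>1" "dist (x i) p < \<delta>2" "dist (x i) p < \<delta>3"
      using close by (simp_all add: \<delta>_def)
    obtain g u where gu: "B i (x i) = g + m i (x i) *\<^sub>R u" "g \<in> G (x i)" "norm u \<le> 1"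
      using B[of i "x i"] by auto
    obtain g' where g': "g' \<in> G p" "dist g g' < \<eta>'"
      using \<delta>3(2)[OF close'(3) gu(2)] by blast
    have "norm (m i (x i) *\<^sub>R u) \<le> m i (x i) * 1"
      using gu(3) m_pos[of i "x i"] by (simp add: mult_left_le)
    also have "\<dots> \<le> m i p + \<eta>'" using \<delta>1(2)[OF close'(1), of i] by simp
    finally have mu: "norm (m i (x i) *\<^sub>R u) \<le> m i p + \<eta>'" .
    have "v i - r i - (hbar p + g') = (g - g') + m i (x i) *\<^sub>R u + (H i (x i) - H i p)"
      by (simp add: v_def r_def gu(1))
    also have "norm \<dots> \<le> \<eta>' + (m i p + \<eta>') + \<eta>'"
      using g'(2) mu \<delta>2(2)[OF close'(2), of i]
      by (intro order_trans[OF norm_triangle_ineq] add_mono) (auto simp: dist_norm)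
    finally show ?thesis using g'(1) by (intro bexI[of _ "hbar p + g'"]) (auto simp: \<eta>'_def)
  qed
  have "averages_to_zero T r" unfolding r_def by (intro averages_to_zero_add H_avg e)
  moreover have "x (Suc i) = x i + a i *\<^sub>R v i" for i using x by (simp add: v_def)
  ultimately have "\<forall>\<epsilon>>0. \<forall>\<^sub>F n in sequentially. \<forall>m\<ge>n. time m - time n \<le> T \<longrightarrow> (\<forall>i\<in>{n..<m}. dist (x i) p < \<delta>) \<longrightarrow>
     (\<exists>y\<in>?K. norm (x m - x n - (time m - time n) *\<^sub>R y) \<le> \<eta> * (time m - time n) + \<epsilon>)"
    using increments_near_convex_set[OF K _ _ m_avg near] by blast
  moreover have "\<delta> > 0" using \<delta>1 \<delta>2 \<delta>3 by (simp add: \<delta>_def)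
  ultimately show "\<exists>\<delta>>0. \<exists>T>0. \<forall>\<epsilon>>0. \<forall>\<^sub>F n in sequentially. \<forall>m\<ge>n. time m - time n \<le> T \<longrightarrow> (\<forall>i\<in>{n..<m}. dist (x i) p < \<delta>) \<longrightarrow>
     (\<exists>y\<in>?K. norm (x m - x n - (time m - time n) *\<^sub>R y) \<le> \<eta> * (time m - time n) + \<epsilon>)"
    using T by blast
qed

text \<open>
  Near each point the speed is bounded as long as the iterates stay in a ball around the point, and with
  bounded speed they cannot leave the ball within a short time; the induction over \<open>m\<close> makes this
  precise. Finitely many balls cover the orbit, which gives one speed and one time.
\<close>
lemma increments_at_most_linear:
  fixes x :: "nat \<Rightarrow> 'v::euclidean_space"
  assumes follows: "follows F x" and F: "\<And>p. bounded (F p)" and x: "bounded (range x)"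
  obtains C T where "C \<ge> 0" "T > 0"
    "\<And>\<epsilon>. \<epsilon> > 0 \<Longrightarrow> \<forall>\<^sub>F n in sequentially. \<forall>m\<ge>n. time m - time n \<le> T \<longrightarrow>
       norm (x m - x n) \<le> C * (time m - time n) + \<epsilon>"
proof -
  define near where "near p \<delta> T \<epsilon> n \<longleftrightarrow> (\<forall>m\<ge>n.
     time m - time n \<le> T \<longrightarrow> (\<forall>i\<in>{n..<m}. dist (x i) p < \<delta>) \<longrightarrow>
     (\<exists>y\<in>F p. norm (x m - x n - (time m - time n) *\<^sub>R y) \<le> 1 * (time m - time n) + \<epsilon>))"
    for p \<delta> T \<epsilon> n
  define good where "good p \<delta> T \<longleftrightarrow>
      \<delta> > 0 \<and> T > 0 \<and> (\<forall>\<epsilon>>0. \<forall>\<^sub>F n in sequentially. near p \<delta> T \<epsilon> n)" for p \<delta> T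
  have "\<exists>\<delta> T. good p \<delta> T" for p
    using mp[OF spec[OF spec[OF follows[unfolded follows_def], of p], of 1] zero_less_one]
    unfolding good_def near_def by (elim exE conjE) (intro exI conjI; assumption)
  then obtain \<delta> T where good: "\<And>p. good p (\<delta> p) (T p)" by metis
  have \<delta>: "\<delta> p > 0" and T: "T p > 0" and local:
    "\<And>\<epsilon>. \<epsilon> > 0 \<Longrightarrow> \<forall>\<^sub>F n in sequentially. near p (\<delta> p) (T p) \<epsilon> n" for p
    using good[of p] by (simp_all add: good_def)
  have "\<exists>R. \<forall>y\<in>F p. norm y \<le> R" for p using F by (simp add: bounded_iff)
  then obtain R where R: "\<And>p y. y \<in> F p \<Longrightarrow> norm y \<le> R p" by metis
  have cover: "closure (range x) \<subseteq> (\<Union>p\<in>closure (range x). ball p (\<delta> p / 2))" using \<delta> by force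
  obtain P where P: "P \<subseteq> closure (range x)" "finite P" "closure (range x) \<subseteq> (\<Union>p\<in>P. ball p (\<delta> p / 2))"
  proof (rule compactE_image[OF _ _ cover])
    show "compact (closure (range x))" using x by simp
  qed auto
  \<comment> \<open>The iterates move at speed at most \<open>C\<close>: at most \<open>1\<close> more than the points of \<open>F p\<close>. The time \<open>T1\<close> is so
    short that they move by at most \<open>\<delta>0 / 4\<close>, including the error \<open>\<epsilon>'\<close>, and thus do not leave the ball.\<close>
  define \<delta>0 where "\<delta>0 = Min (insert 1 (\<delta> ` P))"
  define T0 where "T0 = Min (insert 1 (T ` P))"
  define C where "C = Max (insert 0 (R ` P)) + 1"
  have \<delta>0: "\<delta>0 > 0" "\<And>p. p \<in> P \<Longrightarrow> \<delta>0 \<le> \<delta> p" using P(2) \<delta> by (auto simp: \<delta>0_def)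
  have T0: "T0 > 0" "\<And>p. p \<in> P \<Longrightarrow> T0 \<le> T p" using P(2) T by (auto simp: T0_def)
  have C: "C \<ge> 1" "\<And>p. p \<in> P \<Longrightarrow> R p + 1 \<le> C" using P(2) by (auto simp: C_def)
  define T1 where "T1 = min T0 (\<delta>0 / (8 * C))"
  have T1: "T1 > 0" using T0 \<delta>0 C by (simp add: T1_def)
  have CT1: "C * T1 \<le> \<delta>0 / 8"
  proof -
    have "C * T1 \<le> C * (\<delta>0 / (8 * C))" using C by (intro mult_left_mono) (auto simp: T1_def)
    then show ?thesis using C by simp
  qed
  show thesis
  proof (rule that[of C T1])
    show "C \<ge> 0" "T1 > 0" using C T1 by auto
    fix \<epsilon> :: real assume "\<epsilon> > 0"
    define \<epsilon>' where "\<epsilon>' = min \<epsilon> (\<delta>0 / 8)"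
    have \<epsilon>': "\<epsilon>' > 0" using \<open>\<epsilon> > 0\<close> \<delta>0 by (simp add: \<epsilon>'_def)
    have "\<forall>\<^sub>F n in sequentially. \<forall>p\<in>P. near p (\<delta> p) (T p) \<epsilon>' n"
      using P(2) local[OF \<epsilon>'] by (intro eventually_ball_finite) auto
    then show "\<forall>\<^sub>F n in sequentially. \<forall>m\<ge>n. time m - time n \<le> T1 \<longrightarrow>
       norm (x m - x n) \<le> C * (time m - time n) + \<epsilon>"
    proof eventually_elim
      case (elim n)
      have "x n \<in> closure (range x)" by (rule subsetD[OF closure_subset]) simp
      then obtain p where p: "p \<in> P" "dist p (x n) < \<delta> p / 2" using P(3) by (auto simp: subset_iff)
      have "norm (x m - x n) \<le> C * (time m - time n) + \<epsilon>'" if "n \<le> m" "time m - time n \<le> T1" for m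
        using that
      proof (induction m rule: less_induct)
        case (less m)
        have "dist (x i) p < \<delta> p" if i: "i \<in> {n..<m}" for i
        proof -
          have "time i \<le> time m" using i by simp
          then have time_i: "time i - time n \<le> T1" using less.prems(2) by linarith
          have "norm (x i - x n) \<le> C * (time i - time n) + \<epsilon>'"
            using i by (intro less.IH time_i) auto
          also have "C * (time i - time n) \<le> C * T1"
            using time_i C(1) by (intro mult_left_mono) auto
          also have "C * T1 + \<epsilon>' \<le> \<delta>0 / 4" using CT1 by (simp add: \<epsilon>'_def)
          finally have "dist (x i) (x n) \<le> \<delta>0 / 4" by (simp add: dist_norm)
          then have "dist p (x i) < \<delta> p"
            using p(2) \<delta>0(2)[OF p(1)] \<delta>[of p] dist_triangle[of p "x i" "x n"] dist_commute[of "x n" "x i"]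
            by linarith
          then show ?thesis by (simp only: dist_commute)
        qed
        moreover have "time m - time n \<le> T p" using less.prems T0(2)[OF p(1)] by (simp add: T1_def)
        ultimately obtain y where y: "y \<in> F p"
          "norm (x m - x n - (time m - time n) *\<^sub>R y) \<le> 1 * (time m - time n) + \<epsilon>'"
          using bspec[OF elim p(1), unfolded near_def, rule_format, OF less.prems(1)] by blast
        define \<tau> where "\<tau> = time m - time n"
        have \<tau>: "\<tau> \<ge> 0" using less.prems by (simp add: \<tau>_def)
        have "norm (x m - x n) \<le> norm (x m - x n - \<tau> *\<^sub>R y) + norm (\<tau> *\<^sub>R y)"
          using norm_triangle_ineq[of "x m - x n - \<tau> *\<^sub>R y" "\<tau> *\<^sub>R y"] by simp
        also have "norm (\<tau> *\<^sub>R y) \<le> \<tau> * R p" using R[OF y(1)] \<tau> by (simp add: mult_left_mono)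
        also have "norm (x m - x n - \<tau> *\<^sub>R y) + \<tau> * R p \<le> \<tau> * (R p + 1) + \<epsilon>'"
          using y(2) by (simp add: \<tau>_def algebra_simps)
        also have "\<tau> * (R p + 1) \<le> \<tau> * C" using C(2)[OF p(1)] \<tau> by (intro mult_left_mono) auto
        finally show ?case by (simp add: \<tau>_def mult.commute)
      qed
      moreover have "\<epsilon>' \<le> \<epsilon>" by (simp add: \<epsilon>'_def)
      ultimately show ?case by fastforce
    qed
  qed
qed

end

section \<open>From the iterates to the interpolated trajectory\<close>

context step_sizes
begin

text \<open>
  The interpolation, continued by its initial value to negative times. All shifted interpolations are
  translates of this one function.
\<close>
definition trajectory :: "(nat \<Rightarrow> 'v::real_normed_vector) \<Rightarrow> real \<Rightarrow> 'v" where
  "trajectory x t = (if 0 \<le> t then interpolation a x t else x 0)"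

lemma shifted_interpolation_eq_trajectory: "shifted_interpolation a x n t = trajectory x (t + time n)"
proof -
  have "- time n \<le> t \<longleftrightarrow> 0 \<le> t + time n" by linarith
  then show ?thesis by (simp add: shifted_interpolation_def trajectory_def)
qed

lemma trajectory_in_cell:
  assumes "time n \<le> t" "t \<le> time (Suc n)"
  shows "trajectory x t = x n + ((t - time n) / a n) *\<^sub>R (x (Suc n) - x n)"
proof -
  have t: "0 \<le> t" using assms(1) time_nonneg[of n] by linarith
  have an: "a n \<noteq> 0" using a_pos[of n] by simp
  show ?thesis
  proof (cases "t < time (Suc n)")
    case True
    then have "idx t = n" using assms by (intro idx_eqI) auto
    then have "trajectory x t = ((a n - (t - time n)) / a n) *\<^sub>R x n + ((t - time n) / a n) *\<^sub>R x (Suc n)"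
      using t by (simp add: trajectory_def interpolation_def time_Suc algebra_simps)
    also have "(a n - (t - time n)) / a n = 1 - (t - time n) / a n"
      using an by (simp add: diff_divide_distrib)
    finally show ?thesis by (simp add: algebra_simps)
  next
    case False
    then have t_eq: "t = time (Suc n)" using assms by simp
    then have "idx t = Suc n" by simp
    then have "trajectory x t = x (Suc n)"
      using a_pos[of "Suc n"] t by (simp add: trajectory_def interpolation_def t_eq time_Suc[of "Suc n"])
    then show ?thesis using an by (simp add: t_eq time_Suc)
  qed
qed

lemma trajectory_time [simp]: "trajectory x (time n) = x n"
  using trajectory_in_cell[of n "time n" x] by simp

lemma cell_fraction:
  assumes "time n \<le> t" "t \<le> time (Suc n)"
  shows "0 \<le> (t - time n) / a n" "(t - time n) / a n \<le> 1"
  using assms a_pos[of n] by (auto simp: time_Suc)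

lemma trajectory_near_vertex:
  assumes "t \<ge> 0"
  shows "norm (trajectory x t - x (idx t)) \<le> norm (x (Suc (idx t)) - x (idx t))"
proof -
  let ?n = "idx t"
  have t: "time ?n \<le> t" "t \<le> time (Suc ?n)" using idx_works[OF assms] by auto
  have "norm (trajectory x t - x ?n) = (t - time ?n) / a ?n * norm (x (Suc ?n) - x ?n)"
    using abs_of_nonneg[OF cell_fraction(1)[OF t]]
    by (simp only: trajectory_in_cell[OF t] add_diff_cancel_left' norm_scaleR)
  also have "\<dots> \<le> 1 * norm (x (Suc ?n) - x ?n)"
    by (intro mult_right_mono cell_fraction t) auto
  finally show ?thesis by simp
qed

lemma trajectory_in_convex_hull: "trajectory x t \<in> convex hull (range x)"
proof (cases "t \<ge> 0")
  case True
  let ?n = "idx t"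
  have t: "time ?n \<le> t" "t \<le> time (Suc ?n)" using idx_works[OF True] by auto
  have "trajectory x t = (1 - (t - time ?n) / a ?n) *\<^sub>R x ?n + ((t - time ?n) / a ?n) *\<^sub>R x (Suc ?n)"
    by (simp add: trajectory_in_cell[OF t] algebra_simps)
  also have "\<dots> \<in> convex hull (range x)"
    using cell_fraction[OF t] by (intro convexD convex_convex_hull hull_inc) auto
  finally show ?thesis .
next
  case False
  then show ?thesis by (auto simp: trajectory_def intro: hull_inc)
qed

lemma bounded_trajectory: "bounded (range x) \<Longrightarrow> bounded (range (trajectory x))"
  using bounded_subset[OF bounded_convex_hull, of "range x" "range (trajectory x)"]
    trajectory_in_convex_hull by blast

text \<open>
  On each closed cell the trajectory is affine, and finitely many cells are glued.
\<close>
lemma continuous_on_trajectory: "continuous_on {..time n} (trajectory x)"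
proof (induction n)
  case 0
  have "continuous_on {..time 0} (\<lambda>t. x 0)" by simp
  moreover have "x 0 = trajectory x t" if "t \<in> {..time 0}" for t
    using that trajectory_time[of x 0] by (cases "t = 0") (auto simp: trajectory_def)
  ultimately show ?case by (rule continuous_on_eq)
next
  case (Suc n)
  have "continuous_on {time n..time (Suc n)} (\<lambda>t. x n + ((t - time n) / a n) *\<^sub>R (x (Suc n) - x n))"
    using a_pos[of n] by (intro continuous_intros) auto
  moreover have "x n + ((t - time n) / a n) *\<^sub>R (x (Suc n) - x n) = trajectory x t" if "t \<in> {time n..time (Suc n)}" for t
    using that by (intro trajectory_in_cell[symmetric]) auto
  ultimately have "continuous_on {time n..time (Suc n)} (trajectory x)"
    by (rule continuous_on_eq)
  then have "continuous_on ({..time n} \<union> {time n..time (Suc n)}) (trajectory x)"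
    using Suc by (intro continuous_on_closed_Un) auto
  moreover have "{..time n} \<union> {time n..time (Suc n)} = {..time (Suc n)}"
    using time_le_iff[of n "Suc n"] by (auto simp del: time_le_iff)
  ultimately show ?case by simp
qed

text \<open>
  This and the next definition are the continuous-time forms of the increment estimates. The additive
  errors \<open>\<epsilon>\<close> are what disappears in a limit of shifts.
\<close>
definition asymptotically_lipschitz :: "real \<Rightarrow> real \<Rightarrow> (real \<Rightarrow> 'v::real_normed_vector) \<Rightarrow> bool" where
  "asymptotically_lipschitz C T w \<longleftrightarrow>
     (\<forall>\<epsilon>>0. \<exists>S. \<forall>s\<ge>S. \<forall>t\<in>{s..s + T}. norm (w t - w s) \<le> C * (t - s) + \<epsilon>)"

definition asymptotically_follows :: "('v::real_normed_vector \<Rightarrow> 'v set) \<Rightarrow> (real \<Rightarrow> 'v) \<Rightarrow> bool" where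
  "asymptotically_follows F w \<longleftrightarrow>
     (\<forall>p. \<forall>\<eta>>0. \<exists>\<delta>>0. \<exists>T>0. \<forall>\<epsilon>>0. \<exists>S. \<forall>s\<ge>S. \<forall>t\<in>{s..s + T}. (\<forall>u\<in>{s..t}. dist (w u) p < \<delta>) \<longrightarrow>
        (\<exists>y\<in>F p. norm (w t - w s - (t - s) *\<^sub>R y) \<le> \<eta> * (t - s) + \<epsilon>))"

lemma eventually_idx:
  assumes "eventually P sequentially"
  obtains S where "S \<ge> 0" "\<And>s. s \<ge> S \<Longrightarrow> P (idx s)"
proof -
  have "\<forall>\<^sub>F s in at_top. P (idx s)"
    using assms idx_at_top unfolding filterlim_iff by blast
  then obtain S where "\<And>s. s \<ge> S \<Longrightarrow> P (idx s)" by (auto simp: eventually_at_top_linorder)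
  then show thesis by (intro that[of "max 0 S"]) auto
qed

text \<open>
  The increment estimates between vertices hold for arbitrary times with a slightly larger error, because
  steps tend to \<open>0\<close> both in time and in space.
\<close>
lemma trajectory_asymptotics:
  fixes x :: "nat \<Rightarrow> 'v::euclidean_space"
  assumes follows: "follows F x" and F: "\<And>p. bounded (F p)" and x: "bounded (range x)"
  obtains C T where "C \<ge> 0" "T > 0" "asymptotically_lipschitz C T (trajectory x)" "asymptotically_follows F (trajectory x)"
proof -
  let ?w = "trajectory x"
  have tri: "norm (u + v - z) \<le> norm u + norm v + norm z" for u v z :: 'v
    using norm_triangle_ineq4[of "u + v" z] norm_triangle_ineq[of u v] by linarith
  obtain C T where C: "C \<ge> 0" and T: "T > 0" and lin:
    "\<And>\<epsilon>. \<epsilon> > 0 \<Longrightarrow> \<forall>\<^sub>F n in sequentially. \<forall>m\<ge>n. time m - time n \<le> T \<longrightarrow>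
       norm (x m - x n) \<le> C * (time m - time n) + \<epsilon>"
    using increments_at_most_linear[OF follows F x] by blast
  have a_small: "\<forall>\<^sub>F n in sequentially. a n < \<epsilon>" if "\<epsilon> > 0" for \<epsilon>
    using order_tendstoD(2)[OF a_lim that] .
  have x_small: "\<forall>\<^sub>F n in sequentially. norm (x (Suc n) - x n) \<le> \<epsilon>" if \<epsilon>: "\<epsilon> > 0" for \<epsilon>
  proof -
    have 1: "\<epsilon> / 2 > 0" "min T (\<epsilon> / (2 * (C + 1))) > 0" using \<epsilon> T C by auto
    show ?thesis using lin[OF 1(1)] a_small[OF 1(2)]
    proof eventually_elim
      case (elim n)
      have "norm (x (Suc n) - x n) \<le> C * a n + \<epsilon> / 2"
        using elim(1)[rule_format, of "Suc n"] elim(2) by (simp add: time_Suc)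
      also have "C * a n \<le> (C + 1) * (\<epsilon> / (2 * (C + 1)))"
        using C elim(2) a_pos[of n] by (intro mult_mono) auto
      also have "\<dots> = \<epsilon> / 2" using C by (simp add: field_simps)
      finally show ?case by simp
    qed
  qed
  \<comment> \<open>Rounding the times down to vertices costs arbitrarily little, eventually.\<close>
  have rounding: "\<exists>S\<ge>0. \<forall>s\<ge>S. \<forall>t\<ge>s. idx s \<le> idx t \<and> norm (?w s - x (idx s)) \<le> \<kappa> \<and> norm (?w t - x (idx t)) \<le> \<kappa> \<and>
      \<bar>(time (idx t) - time (idx s)) - (t - s)\<bar> \<le> \<kappa>" if \<kappa>: "\<kappa> > 0" for \<kappa>
  proof -
    have "\<forall>\<^sub>F n in sequentially. a n < \<kappa> \<and> norm (x (Suc n) - x n) \<le> \<kappa>"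
      using a_small[OF \<kappa>] x_small[OF \<kappa>] by (rule eventually_conj)
    then obtain S where S: "S \<ge> 0" "\<And>s. s \<ge> S \<Longrightarrow> a (idx s) < \<kappa> \<and> norm (x (Suc (idx s)) - x (idx s)) \<le> \<kappa>"
      using eventually_idx by blast
    have one: "norm (?w s - x (idx s)) \<le> \<kappa>" "time (idx s) \<le> s" "s < time (idx s) + \<kappa>" if "s \<ge> S" for s
    proof -
      have "s \<ge> 0" using S(1) that by simp
      then show "norm (?w s - x (idx s)) \<le> \<kappa>" "time (idx s) \<le> s" "s < time (idx s) + \<kappa>"
        using trajectory_near_vertex[of s x] S(2)[OF that] idx_works[of s] by (auto simp: time_Suc)
    qed
    have "idx s \<le> idx t \<and> norm (?w s - x (idx s)) \<le> \<kappa> \<and> norm (?w t - x (idx t)) \<le> \<kappa> \<and>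
      \<bar>(time (idx t) - time (idx s)) - (t - s)\<bar> \<le> \<kappa>" if "s \<ge> S" "t \<ge> s" for s t
      using one[OF that(1)] one[of t] that S(1) by (auto intro!: idx_mono)
    then show ?thesis using S(1) by blast
  qed
  have lip: "asymptotically_lipschitz C (T / 2) ?w"
    unfolding asymptotically_lipschitz_def
  proof (intro allI impI)
    fix \<epsilon> :: real assume \<epsilon>: "\<epsilon> > 0"
    define \<kappa> where "\<kappa> = min (T / 2) (\<epsilon> / (4 * (C + 1)))"
    have \<kappa>: "\<kappa> > 0" "\<kappa> \<le> T / 2" "C * \<kappa> \<le> \<epsilon> / 4" "\<kappa> \<le> \<epsilon> / 4"
    proof -
      show "\<kappa> > 0" using \<epsilon> T C by (auto simp: \<kappa>_def)
      show "\<kappa> \<le> T / 2" unfolding \<kappa>_def by (rule min.cobounded1)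
      have "(C + 1) * \<kappa> \<le> (C + 1) * (\<epsilon> / (4 * (C + 1)))" using C by (intro mult_left_mono) (auto simp: \<kappa>_def)
      also have "\<dots> = \<epsilon> / 4" using C by (simp add: field_simps)
      finally have "(C + 1) * \<kappa> \<le> \<epsilon> / 4" .
      moreover have "C * \<kappa> \<ge> 0" using C \<open>\<kappa> > 0\<close> by simp
      ultimately show "C * \<kappa> \<le> \<epsilon> / 4" "\<kappa> \<le> \<epsilon> / 4" using \<open>\<kappa> > 0\<close> by (auto simp: distrib_right)
    qed
    have "\<epsilon> / 4 > 0" using \<epsilon> by simp
    from eventually_idx[OF lin[OF this]] obtain S1 where S1: "S1 \<ge> 0" "\<And>s. s \<ge> S1 \<Longrightarrow> \<forall>m\<ge>idx s. time m - time (idx s) \<le> T \<longrightarrow>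
       norm (x m - x (idx s)) \<le> C * (time m - time (idx s)) + \<epsilon> / 4" by blast
    obtain S2 where S2: "\<And>s t. s \<ge> S2 \<Longrightarrow> t \<ge> s \<Longrightarrow> idx s \<le> idx t \<and> norm (?w s - x (idx s)) \<le> \<kappa> \<and> norm (?w t - x (idx t)) \<le> \<kappa> \<and>
      \<bar>(time (idx t) - time (idx s)) - (t - s)\<bar> \<le> \<kappa>" using rounding[OF \<kappa>(1)] by blast
    have "norm (?w t - ?w s) \<le> C * (t - s) + \<epsilon>" if s: "s \<ge> max S1 S2" and t: "t \<in> {s..s + T / 2}" for s t
    proof -
      have r: "idx s \<le> idx t" "norm (?w s - x (idx s)) \<le> \<kappa>" "norm (?w t - x (idx t)) \<le> \<kappa>"
          "\<bar>(time (idx t) - time (idx s)) - (t - s)\<bar> \<le> \<kappa>" using S2[of s t] s t by auto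
      have "time (idx t) - time (idx s) \<le> T" using r(4) t \<kappa>(2) by (auto simp: abs_le_iff)
      then have 1: "norm (x (idx t) - x (idx s)) \<le> C * (time (idx t) - time (idx s)) + \<epsilon> / 4"
        using S1(2)[of s] s r(1) by auto
      have "C * (time (idx t) - time (idx s)) \<le> C * (t - s + \<kappa>)" using r(4) C by (intro mult_left_mono) auto
      then have 2: "C * (time (idx t) - time (idx s)) \<le> C * (t - s) + \<epsilon> / 4" using \<kappa>(3) by (simp add: distrib_left)
      have "?w t - ?w s = (?w t - x (idx t)) + (x (idx t) - x (idx s)) - (?w s - x (idx s))" by simp
      also have "norm \<dots> \<le> norm (?w t - x (idx t)) + norm (x (idx t) - x (idx s)) + norm (?w s - x (idx s))"
        by (rule tri)
      also have "\<dots> \<le> (\<kappa> + (C * (t - s) + \<epsilon> / 4 + \<epsilon> / 4)) + \<kappa>"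
        using r 1 2 by linarith
      also have "\<dots> \<le> C * (t - s) + \<epsilon>" using \<kappa>(4) by simp
      finally show ?thesis .
    qed
    then show "\<exists>S. \<forall>s\<ge>S. \<forall>t\<in>{s..s + T / 2}. norm (?w t - ?w s) \<le> C * (t - s) + \<epsilon>" by blast
  qed
  have fol: "asymptotically_follows F ?w"
    unfolding asymptotically_follows_def
  proof (intro allI impI)
    fix p and \<eta> :: real assume \<eta>: "\<eta> > 0"
    obtain \<delta> T where \<delta>: "\<delta> > 0" and T: "T > 0" and loc: "\<forall>\<epsilon>>0. \<forall>\<^sub>F n in sequentially. \<forall>m\<ge>n.
      time m - time n \<le> T \<longrightarrow> (\<forall>i\<in>{n..<m}. dist (x i) p < \<delta>) \<longrightarrow>
       (\<exists>y\<in>F p. norm (x m - x n - (time m - time n) *\<^sub>R y) \<le> \<eta> * (time m - time n) + \<epsilon>)"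
      using mp[OF spec[OF spec[OF follows[unfolded follows_def], of p], of \<eta>] \<eta>]
      by (elim exE conjE) (rule that; assumption)
    obtain R where R: "\<And>y. y \<in> F p \<Longrightarrow> norm y \<le> R" "R \<ge> 0"
      using F[of p] by (metis bounded_pos less_imp_le)
    have "\<exists>S. \<forall>s\<ge>S. \<forall>t\<in>{s..s + T / 2}. (\<forall>u\<in>{s..t}. dist (?w u) p < \<delta> / 2) \<longrightarrow>
        (\<exists>y\<in>F p. norm (?w t - ?w s - (t - s) *\<^sub>R y) \<le> \<eta> * (t - s) + \<epsilon>)" if \<epsilon>: "\<epsilon> > 0" for \<epsilon>
    proof -
      define \<kappa> where "\<kappa> = min (min (T / 2) (\<delta> / 2)) (\<epsilon> / (4 * (\<eta> + R + 2)))"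
      have \<kappa>: "\<kappa> > 0" "\<kappa> \<le> T / 2" "\<kappa> \<le> \<delta> / 2" "\<kappa> \<le> \<epsilon> / (4 * (\<eta> + R + 2))"
      proof -
        show "\<kappa> > 0" using \<epsilon> T \<delta> \<eta> R by (auto simp: \<kappa>_def)
        show "\<kappa> \<le> T / 2" "\<kappa> \<le> \<delta> / 2" "\<kappa> \<le> \<epsilon> / (4 * (\<eta> + R + 2))"
          unfolding \<kappa>_def by (meson min.cobounded1 min.cobounded2 order_trans)+
      qed
      have "(\<eta> + R + 2) * \<kappa> \<le> (\<eta> + R + 2) * (\<epsilon> / (4 * (\<eta> + R + 2)))"
        using \<eta> R(2) by (intro mult_left_mono \<kappa>) auto
      also have "\<dots> = \<epsilon> / 4" using \<eta> R(2) by (simp add: field_simps)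
      finally have \<kappa>': "\<eta> * \<kappa> + R * \<kappa> + 2 * \<kappa> \<le> \<epsilon> / 4" by (simp add: distrib_right)
      have "\<epsilon> / 4 > 0" using \<epsilon> by simp
      from eventually_idx[OF mp[OF spec[OF loc] this]] obtain S1 where S1: "S1 \<ge> 0" "\<And>s. s \<ge> S1 \<Longrightarrow> \<forall>m\<ge>idx s.
        time m - time (idx s) \<le> T \<longrightarrow> (\<forall>i\<in>{idx s..<m}. dist (x i) p < \<delta>) \<longrightarrow>
         (\<exists>y\<in>F p. norm (x m - x (idx s) - (time m - time (idx s)) *\<^sub>R y) \<le> \<eta> * (time m - time (idx s)) + \<epsilon> / 4)"
        by blast
      obtain S2 where S2: "S2 \<ge> 0" "\<And>s t. s \<ge> S2 \<Longrightarrow> t \<ge> s \<Longrightarrow> idx s \<le> idx t \<and> norm (?w s - x (idx s)) \<le> \<kappa> \<and> norm (?w t - x (idx t)) \<le> \<kappa> \<and>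
        \<bar>(time (idx t) - time (idx s)) - (t - s)\<bar> \<le> \<kappa>" using rounding[OF \<kappa>(1)] by blast
      have "\<exists>y\<in>F p. norm (?w t - ?w s - (t - s) *\<^sub>R y) \<le> \<eta> * (t - s) + \<epsilon>"
        if s: "s \<ge> max S1 S2" and t: "t \<in> {s..s + T / 2}" and close: "\<forall>u\<in>{s..t}. dist (?w u) p < \<delta> / 2" for s t
      proof -
        let ?n = "idx s" and ?m = "idx t"
        define \<tau> where "\<tau> = time ?m - time ?n"
        have r: "?n \<le> ?m" "norm (?w s - x ?n) \<le> \<kappa>" "norm (?w t - x ?m) \<le> \<kappa>" "\<bar>\<tau> - (t - s)\<bar> \<le> \<kappa>"
          using S2(2)[of s t] s t by (auto simp: \<tau>_def)
        have s0: "s \<ge> 0" and st: "s \<le> t" using s t S2(1) by auto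
        have "dist (x i) p < \<delta>" if i: "i \<in> {?n..<?m}" for i
        proof (cases "i = ?n")
          case True
          have "dist (x ?n) p \<le> dist (x ?n) (?w s) + dist (?w s) p" by (rule dist_triangle)
          moreover have "dist (?w s) p < \<delta> / 2" using close st by simp
          moreover have "dist (x ?n) (?w s) \<le> \<delta> / 2" using r(2) \<kappa>(3) by (simp add: dist_norm norm_minus_commute)
          ultimately show ?thesis using True by simp
        next
          case False
          then have "time (Suc ?n) \<le> time i" "time i \<le> time ?m" using i by auto
          then have "s \<le> time i" "time i \<le> t"
            using idx_works(2)[OF s0] idx_works(1)[of t] s0 st by linarith+
          then have "time i \<in> {s..t}" by simp
          then have "dist (?w (time i)) p < \<delta> / 2" using close by blast
          then show ?thesis using \<delta> by simp
        qed
        moreover have "time ?m - time ?n \<le> T" using r(4) \<kappa>(2) t by (auto simp: \<tau>_def abs_le_iff)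
        ultimately obtain y where y: "y \<in> F p" "norm (x ?m - x ?n - \<tau> *\<^sub>R y) \<le> \<eta> * \<tau> + \<epsilon> / 4"
          using S1(2)[of s] s r(1) unfolding \<tau>_def by auto
        have "norm ((\<tau> - (t - s)) *\<^sub>R y) \<le> \<kappa> * R"
          unfolding norm_scaleR using r(4) R(1)[OF y(1)] \<kappa>(1) by (intro mult_mono) auto
        moreover have "\<eta> * \<tau> \<le> \<eta> * (t - s + \<kappa>)" using r(4) \<eta> by (intro mult_left_mono) auto
        moreover have "norm (?w t - ?w s - (t - s) *\<^sub>R y) \<le>
          norm (?w t - x ?m) + (norm (x ?m - x ?n - \<tau> *\<^sub>R y) + norm ((\<tau> - (t - s)) *\<^sub>R y)) + norm (?w s - x ?n)"
        proof -
          have "?w t - ?w s - (t - s) *\<^sub>R y =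
            (?w t - x ?m) + ((x ?m - x ?n - \<tau> *\<^sub>R y) + (\<tau> - (t - s)) *\<^sub>R y) - (?w s - x ?n)"
            by (simp add: algebra_simps)
          also have "norm \<dots> \<le> norm (?w t - x ?m) + norm ((x ?m - x ?n - \<tau> *\<^sub>R y) + (\<tau> - (t - s)) *\<^sub>R y) + norm (?w s - x ?n)"
            by (rule tri)
          also have "\<dots> \<le> norm (?w t - x ?m) + (norm (x ?m - x ?n - \<tau> *\<^sub>R y) + norm ((\<tau> - (t - s)) *\<^sub>R y)) + norm (?w s - x ?n)"
            by (intro add_mono norm_triangle_ineq order_refl)
          finally show ?thesis .
        qed
        ultimately have "norm (?w t - ?w s - (t - s) *\<^sub>R y) \<le> \<kappa> + (\<eta> * (t - s + \<kappa>) + \<epsilon> / 4 + \<kappa> * R) + \<kappa>"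
          using y(2) r(2,3) by linarith
        also have "\<dots> \<le> \<eta> * (t - s) + \<epsilon>" using \<kappa>' \<epsilon> by (simp add: algebra_simps)
        finally show ?thesis using y(1) by blast
      qed
      then show ?thesis by blast
    qed
    then show "\<exists>\<delta>>0. \<exists>T>0. \<forall>\<epsilon>>0. \<exists>S. \<forall>s\<ge>S. \<forall>t\<in>{s..s + T}. (\<forall>u\<in>{s..t}. dist (?w u) p < \<delta>) \<longrightarrow>
        (\<exists>y\<in>F p. norm (?w t - ?w s - (t - s) *\<^sub>R y) \<le> \<eta> * (t - s) + \<epsilon>)"
      using \<delta> T by (intro exI[of _ "\<delta> / 2"] conjI exI[of _ "T / 2"]) auto
  qed
  show thesis using that[OF C _ lip fol] T by simp
qed

text \<open>
  At late times this is the asymptotic Lipschitz estimate, and the rest is a compact time interval and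
  the constant past.
\<close>
lemma uniformly_continuous_trajectory:
  fixes x :: "nat \<Rightarrow> 'v::euclidean_space"
  assumes C: "C \<ge> 0" and T: "T > 0" and lip: "asymptotically_lipschitz C T (trajectory x)"
  shows "uniformly_continuous_on UNIV (trajectory x)"
  unfolding uniformly_continuous_on_def
proof (intro allI impI)
  fix e :: real assume e: "e > 0"
  have "e / 2 > 0" using e by simp
  then obtain S where S: "\<And>s t. s \<ge> S \<Longrightarrow> t \<in> {s..s + T} \<Longrightarrow> norm (trajectory x t - trajectory x s) \<le> C * (t - s) + e / 2"
    using mp[OF spec[OF lip[unfolded asymptotically_lipschitz_def]] \<open>e / 2 > 0\<close>] by blast
  obtain N where N: "time N \<ge> max S 0 + 1"
    using time_at_top unfolding filterlim_at_top eventually_sequentially by blast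
  have "uniformly_continuous_on {-1..time N} (trajectory x)"
    by (intro compact_uniformly_continuous continuous_on_subset[OF continuous_on_trajectory[of N]]) auto
  then obtain d where d: "d > 0" "\<And>s t. s \<in> {-1..time N} \<Longrightarrow> t \<in> {-1..time N} \<Longrightarrow> dist t s < d \<Longrightarrow> dist (trajectory x t) (trajectory x s) < e"
    using e unfolding uniformly_continuous_on_def by blast
  define \<delta> where "\<delta> = min (min 1 d) (min T (e / (2 * (C + 1))))"
  have \<delta>: "\<delta> > 0" "\<delta> \<le> 1" "\<delta> \<le> d" "\<delta> \<le> T" using d T C e by (auto simp: \<delta>_def)
  have C\<delta>: "C * r < e / 2" if "r < \<delta>" "r \<ge> 0" for r
  proof -
    have "C * r \<le> (C + 1) * r" using that C by (intro mult_right_mono) auto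
    also have "\<dots> < (C + 1) * (e / (2 * (C + 1)))" using that C by (intro mult_strict_left_mono) (auto simp: \<delta>_def)
    also have "\<dots> = e / 2" using C by (simp add: field_simps)
    finally show ?thesis .
  qed
  have ordered: "dist (trajectory x t) (trajectory x s) < e" if st: "s \<le> t" "t - s < \<delta>" for s t
  proof -
    consider "t \<le> 0" | "t > 0" "t \<le> time N" | "t > time N" by linarith
    then show ?thesis
    proof cases
      case 1
      have "trajectory x u = x 0" if "u \<le> 0" for u using that trajectory_time[of x 0] by (cases "u = 0") (auto simp: trajectory_def)
      then show ?thesis using 1 st e by simp
    next
      case 2
      then show ?thesis using st \<delta> by (intro d(2)) (auto simp: dist_real_def)
    next
      case 3
      then have "s \<ge> S" using N st \<delta>(2) by simp
      then have "norm (trajectory x t - trajectory x s) \<le> C * (t - s) + e / 2" using st \<delta>(4) by (intro S) auto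
      then show ?thesis using C\<delta>[of "t - s"] st by (simp add: dist_norm)
    qed
  qed
  have "dist (trajectory x t) (trajectory x s) < e" if "dist t s < \<delta>" for s t
    using ordered[of s t] ordered[of t s] that by (cases "s \<le> t") (auto simp: dist_commute dist_real_def)
  then show "\<exists>d>0. \<forall>s\<in>UNIV. \<forall>t\<in>UNIV. dist t s < d \<longrightarrow> dist (trajectory x t) (trajectory x s) < e"
    using \<delta>(1) by blast
qed

end

section \<open>Shift limits solve the inclusion\<close>

text \<open>
  With \<open>w\<close> the trajectory of a sequence, these include the limits of subsequences of its shifted
  interpolations, where the times \<open>s k\<close> are vertices.
\<close>
definition shift_limit :: "(real \<Rightarrow> 'v::metric_space) \<Rightarrow> (real \<Rightarrow> 'v) \<Rightarrow> bool" where
  "shift_limit w Y \<longleftrightarrow> (\<exists>s::nat \<Rightarrow> real. filterlim s at_top sequentially \<and>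
     (\<forall>c d. uniform_limit {c..d} (\<lambda>k t. w (s k + t)) Y sequentially))"

lemma shift_limitE:
  assumes "shift_limit w Y"
  obtains s where "filterlim s at_top sequentially" "\<And>t. (\<lambda>k. w (s k + t)) \<longlonglongrightarrow> Y t"
    "\<And>c d. uniform_limit {c..d} (\<lambda>k t. w (s k + t)) Y sequentially"
proof -
  obtain s where s: "filterlim s at_top sequentially" "\<And>c d. uniform_limit {c..d} (\<lambda>k t. w (s k + t)) Y sequentially"
    using assms unfolding shift_limit_def by blast
  have "(\<lambda>k. w (s k + t)) \<longlonglongrightarrow> Y t" for t
    using tendsto_uniform_limitI[OF s(2)[of t t], of t] by simp
  then show thesis using that s by blast
qed

lemma absolutely_continuous_if_lipschitz:
  assumes lip: "\<And>s t. norm (f t - f s) \<le> C * \<bar>t - s\<bar>"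
  shows "absolutely_continuous_interval f c d"
  unfolding absolutely_continuous_interval_def
proof (intro allI impI)
  fix \<epsilon> :: real assume \<epsilon>: "\<epsilon> > 0"
  have "(\<Sum>(s, t)\<in>P. norm (f t - f s)) < \<epsilon>"
    if P: "\<forall>(s, t)\<in>P. c \<le> s \<and> s \<le> t \<and> t \<le> d" "(\<Sum>(s, t)\<in>P. t - s) < \<epsilon> / (\<bar>C\<bar> + 1)" for P
  proof -
    have "norm (f t - f s) \<le> (\<bar>C\<bar> + 1) * (t - s)" if "s \<le> t" for s t
    proof -
      have "norm (f t - f s) \<le> C * (t - s)" using lip[of t s] that by simp
      also have "\<dots> \<le> (\<bar>C\<bar> + 1) * (t - s)" using that by (intro mult_right_mono) auto
      finally show ?thesis .
    qed
    then have "(\<Sum>(s, t)\<in>P. norm (f t - f s)) \<le> (\<Sum>(s, t)\<in>P. (\<bar>C\<bar> + 1) * (t - s))"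
      using P(1) by (intro sum_mono) fastforce
    also have "\<dots> = (\<bar>C\<bar> + 1) * (\<Sum>(s, t)\<in>P. t - s)"
      by (simp add: sum_distrib_left case_prod_beta)
    also have "\<dots> < (\<bar>C\<bar> + 1) * (\<epsilon> / (\<bar>C\<bar> + 1))"
      using P(2) by (intro mult_strict_left_mono) auto
    finally show ?thesis by simp
  qed
  moreover have "\<epsilon> / (\<bar>C\<bar> + 1) > 0" using \<epsilon> by simp
  ultimately show "\<exists>\<delta>>0. \<forall>P. finite P \<longrightarrow> (\<forall>(s, t)\<in>P. c \<le> s \<and> s \<le> t \<and> t \<le> d) \<longrightarrow>
        pairwise (\<lambda>p q. {fst p<..<snd p} \<inter> {fst q<..<snd q} = {}) P \<longrightarrow>
        (\<Sum>(s, t)\<in>P. t - s) < \<delta> \<longrightarrow> (\<Sum>(s, t)\<in>P. norm (f t - f s)) < \<epsilon>"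
    by blast
qed

lemma lipschitz_if_locally:
  fixes f :: "real \<Rightarrow> 'v::real_normed_vector"
  assumes T: "T > 0" and loc: "\<And>s t. s \<le> t \<Longrightarrow> t \<le> s + T \<Longrightarrow> norm (f t - f s) \<le> C * (t - s)"
  shows "norm (f t - f s) \<le> C * \<bar>t - s\<bar>"
proof -
  have chain: "norm (f t - f s) \<le> C * (t - s)" if "s \<le> t" "t - s \<le> real n * T" for n s t
    using that
  proof (induction n arbitrary: t)
    case (Suc n)
    show ?case
    proof (cases "t \<le> s + T")
      case True
      then show ?thesis using Suc.prems loc by simp
    next
      case False
      have "norm (f (t - T) - f s) \<le> C * (t - T - s)"
        using False Suc.prems by (intro Suc.IH) (auto simp: algebra_simps)
      moreover have "norm (f t - f (t - T)) \<le> C * (t - (t - T))" using T by (intro loc) auto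
      moreover have "norm (f t - f s) \<le> norm (f t - f (t - T)) + norm (f (t - T) - f s)"
        using norm_triangle_ineq[of "f t - f (t - T)" "f (t - T) - f s"] by simp
      ultimately show ?thesis by (simp add: algebra_simps)
    qed
  qed simp
  have "norm (f t - f s) \<le> C * (t - s)" if "s \<le> t" for s t
  proof -
    obtain n :: nat where "(t - s) / T \<le> real n" using real_arch_simple by blast
    then show ?thesis using chain[OF that, of n] T by (simp add: field_simps)
  qed
  from this[of s t] this[of t s] show ?thesis
    by (cases "s \<le> t") (auto simp: norm_minus_commute)
qed

context step_sizes
begin

lemma shift_limit_lipschitz:
  fixes w :: "real \<Rightarrow> 'v::real_normed_vector"
  assumes T: "T > 0" and lip: "asymptotically_lipschitz C T w" and Y: "shift_limit w Y"
  shows "norm (Y t - Y s) \<le> C * \<bar>t - s\<bar>"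
proof (rule lipschitz_if_locally[OF T])
  fix s t :: real assume st: "s \<le> t" "t \<le> s + T"
  obtain \<sigma> where \<sigma>: "filterlim \<sigma> at_top sequentially" "\<And>t. (\<lambda>k. w (\<sigma> k + t)) \<longlonglongrightarrow> Y t"
    "\<And>c d. uniform_limit {c..d} (\<lambda>k t. w (\<sigma> k + t)) Y sequentially"
    by (rule shift_limitE[OF Y]) (rule that)
  have lim: "(\<lambda>k. norm (w (\<sigma> k + t) - w (\<sigma> k + s))) \<longlonglongrightarrow> norm (Y t - Y s)"
    by (intro tendsto_intros \<sigma>(2))
  show "norm (Y t - Y s) \<le> C * (t - s)"
  proof (rule field_le_epsilon)
    fix \<epsilon> :: real assume "\<epsilon> > 0"
    obtain S where S: "\<And>s t. s \<ge> S \<Longrightarrow> t \<in> {s..s + T} \<Longrightarrow> norm (w t - w s) \<le> C * (t - s) + \<epsilon>"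
      using mp[OF spec[OF lip[unfolded asymptotically_lipschitz_def]] \<open>\<epsilon> > 0\<close>] by blast
    have "\<forall>\<^sub>F k in sequentially. \<sigma> k \<ge> S - s" using \<sigma>(1) unfolding filterlim_at_top by blast
    then have "\<forall>\<^sub>F k in sequentially. norm (w (\<sigma> k + t) - w (\<sigma> k + s)) \<le> C * (t - s) + \<epsilon>"
    proof eventually_elim
      case (elim k)
      then show ?case using S[of "\<sigma> k + s" "\<sigma> k + t"] st by simp
    qed
    then show "norm (Y t - Y s) \<le> C * (t - s) + \<epsilon>"
      by (rule tendsto_upperbound[OF lim]) simp
  qed
qed

text \<open>
  Over a short time \<open>h\<close> the increment of \<open>Y\<close> is within a multiple of \<open>\<eta> * h\<close> both of \<open>h *\<^sub>R D\<close> and of \<open>h *\<^sub>R y\<close>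
  for some \<open>y \<in> F (Y t0)\<close>: the latter holds for shifts \<open>w (\<sigma> k + t)\<close> that are uniformly close to \<open>Y\<close>. Hence
  \<open>D\<close> is within a multiple of \<open>\<eta>\<close> of \<open>F (Y t0)\<close>, for every \<open>\<eta>\<close>.
\<close>
lemma shift_limit_derivative:
  fixes w :: "real \<Rightarrow> 'v::euclidean_space"
  assumes fol: "asymptotically_follows F w" and lipY: "\<And>s t. norm (Y t - Y s) \<le> C * \<bar>t - s\<bar>"
    and Y: "shift_limit w Y" and F: "closed (F (Y t0))" and D: "(Y has_vector_derivative D) (at t0)"
  shows "D \<in> F (Y t0)"
proof -
  obtain \<sigma> where \<sigma>: "filterlim \<sigma> at_top sequentially" "\<And>t. (\<lambda>k. w (\<sigma> k + t)) \<longlonglongrightarrow> Y t"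
    "\<And>c d. uniform_limit {c..d} (\<lambda>k t. w (\<sigma> k + t)) Y sequentially"
    by (rule shift_limitE[OF Y]) (rule that)
  have "\<exists>y\<in>F (Y t0). dist y D < e" if e: "e > 0" for e
  proof -
    define \<eta> where "\<eta> = e / 4"
    have \<eta>: "\<eta> > 0" using e by (simp add: \<eta>_def)
    obtain \<delta> T where \<delta>: "\<delta> > 0" and T: "T > 0" and
      loc: "\<forall>\<epsilon>>0. \<exists>S. \<forall>s\<ge>S. \<forall>t\<in>{s..s + T}. (\<forall>u\<in>{s..t}. dist (w u) (Y t0) < \<delta>) \<longrightarrow>
        (\<exists>y\<in>F (Y t0). norm (w t - w s - (t - s) *\<^sub>R y) \<le> \<eta> * (t - s) + \<epsilon>)"
      using mp[OF spec[OF spec[OF fol[unfolded asymptotically_follows_def], of "Y t0"], of \<eta>] \<eta>]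
      by (elim exE conjE) (rule that; assumption)
    have "\<exists>d>0. \<forall>t. norm (t - t0) < d \<longrightarrow> norm (Y t - Y t0 - (t - t0) *\<^sub>R D) \<le> \<eta> * norm (t - t0)"
      using D \<eta> unfolding has_vector_derivative_def has_derivative_at_alt by blast
    then obtain d where d: "d > 0" "\<And>t. norm (t - t0) < d \<Longrightarrow> norm (Y t - Y t0 - (t - t0) *\<^sub>R D) \<le> \<eta> * norm (t - t0)"
      by blast
    \<comment> \<open>Within time \<open>r\<close> the limit \<open>Y\<close> moves by at most \<open>\<delta> / 2\<close>, so nearby shifts of \<open>w\<close> stay within \<open>\<delta>\<close> of \<open>Y t0\<close>.\<close>
    define r where "r = min (min d T) (\<delta> / (2 * (\<bar>C\<bar> + 1)))"
    have r: "r > 0" "r \<le> d" "r \<le> T" "r \<le> \<delta> / (2 * (\<bar>C\<bar> + 1))"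
    proof -
      show "r > 0" using d(1) T \<delta> by (auto simp: r_def)
      show "r \<le> d" "r \<le> T" "r \<le> \<delta> / (2 * (\<bar>C\<bar> + 1))"
        unfolding r_def by (meson min.cobounded1 min.cobounded2 order_trans)+
    qed
    define h where "h = r / 2"
    have h: "h > 0" "h < r" using r(1) by (auto simp: h_def)
    have closeY: "dist (Y u) (Y t0) \<le> \<delta> / 2" if "u \<in> {t0..t0 + h}" for u
    proof -
      have "norm (Y u - Y t0) \<le> C * \<bar>u - t0\<bar>" by (rule lipY)
      also have "\<dots> \<le> (\<bar>C\<bar> + 1) * \<bar>u - t0\<bar>" by (intro mult_right_mono) auto
      also have "\<dots> \<le> (\<bar>C\<bar> + 1) * (\<delta> / (2 * (\<bar>C\<bar> + 1)))"
        using that h(2) r(4) by (intro mult_left_mono) auto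
      also have "\<dots> = \<delta> / 2" by (simp add: field_simps)
      finally show ?thesis by (simp add: dist_norm)
    qed
    have "\<eta> * h / 3 > 0" using \<eta> h by simp
    then obtain S where S: "\<And>s t. s \<ge> S \<Longrightarrow> t \<in> {s..s + T} \<Longrightarrow> (\<forall>u\<in>{s..t}. dist (w u) (Y t0) < \<delta>) \<Longrightarrow>
        \<exists>y\<in>F (Y t0). norm (w t - w s - (t - s) *\<^sub>R y) \<le> \<eta> * (t - s) + \<eta> * h / 3"
      using mp[OF spec[OF loc]] by blast
    define \<kappa> where "\<kappa> = min (\<delta> / 2) (\<eta> * h / 3)"
    have \<kappa>: "\<kappa> > 0" "\<kappa> \<le> \<delta> / 2" "\<kappa> \<le> \<eta> * h / 3" using \<delta> \<open>\<eta> * h / 3 > 0\<close> by (auto simp: \<kappa>_def)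
    have "\<forall>\<^sub>F k in sequentially. \<sigma> k \<ge> S - t0" using \<sigma>(1) unfolding filterlim_at_top by blast
    moreover have "\<forall>\<^sub>F k in sequentially. \<forall>u\<in>{t0..t0 + h}. dist (w (\<sigma> k + u)) (Y u) < \<kappa>"
      using uniform_limitD[OF \<sigma>(3) \<kappa>(1)] .
    ultimately have "\<forall>\<^sub>F k in sequentially. \<sigma> k \<ge> S - t0 \<and> (\<forall>u\<in>{t0..t0 + h}. dist (w (\<sigma> k + u)) (Y u) < \<kappa>)"
      by (rule eventually_conj)
    then obtain k where k: "\<sigma> k \<ge> S - t0" and near: "\<And>u. u \<in> {t0..t0 + h} \<Longrightarrow> dist (w (\<sigma> k + u)) (Y u) < \<kappa>"
      using eventually_happens'[OF sequentially_bot] by blast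
    have "dist (w u) (Y t0) < \<delta>" if "u \<in> {\<sigma> k + t0..\<sigma> k + (t0 + h)}" for u
    proof -
      have u: "u - \<sigma> k \<in> {t0..t0 + h}" using that by auto
      have "dist (w u) (Y t0) \<le> dist (w (\<sigma> k + (u - \<sigma> k))) (Y (u - \<sigma> k)) + dist (Y (u - \<sigma> k)) (Y t0)"
        using dist_triangle by simp
      then show ?thesis using near[OF u] closeY[OF u] \<kappa>(2) by linarith
    qed
    then obtain y where y: "y \<in> F (Y t0)"
      "norm (w (\<sigma> k + (t0 + h)) - w (\<sigma> k + t0) - h *\<^sub>R y) \<le> \<eta> * h + \<eta> * h / 3"
      using S[of "\<sigma> k + t0" "\<sigma> k + (t0 + h)"] k h r(3) by auto
    have n1: "norm (w (\<sigma> k + (t0 + h)) - Y (t0 + h)) \<le> \<eta> * h / 3" "norm (w (\<sigma> k + t0) - Y t0) \<le> \<eta> * h / 3"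
      using near[of "t0 + h"] near[of t0] h(1) \<kappa>(3) by (auto simp: dist_norm)
    have n2: "norm (Y (t0 + h) - Y t0 - h *\<^sub>R D) \<le> \<eta> * h"
      using d(2)[of "t0 + h"] h r(2) by simp
    have tri: "norm (p + q + u - v) \<le> norm p + norm q + norm u + norm v" for p q u v :: 'v
      using norm_triangle_ineq4[of "p + q + u" v] norm_triangle_ineq[of "p + q" u] norm_triangle_ineq[of p q] by linarith
    have "h *\<^sub>R (y - D) = (w (\<sigma> k + (t0 + h)) - Y (t0 + h)) + (Y (t0 + h) - Y t0 - h *\<^sub>R D)
        + (Y t0 - w (\<sigma> k + t0)) - (w (\<sigma> k + (t0 + h)) - w (\<sigma> k + t0) - h *\<^sub>R y)"
      by (simp add: algebra_simps)
    also have "norm \<dots> \<le> \<eta> * h / 3 + \<eta> * h + \<eta> * h / 3 + (\<eta> * h + \<eta> * h / 3)"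
      using n1 n2 y(2) by (intro order_trans[OF tri] add_mono) (auto simp: norm_minus_commute)
    also have "\<dots> = h * (3 * \<eta>)" by (simp add: field_simps)
    finally have "h * norm (y - D) \<le> h * (3 * \<eta>)" using h(1) by simp
    then have "norm (y - D) \<le> 3 * \<eta>" using h(1) by simp
    then have "dist y D < e" using e by (simp add: dist_norm \<eta>_def)
    then show ?thesis using y(1) by blast
  qed
  then have "D \<in> closure (F (Y t0))" by (simp add: closure_approachable)
  then show ?thesis using F by simp
qed

lemma shift_limit_solution:
  fixes w :: "real \<Rightarrow> 'v::euclidean_space"
  assumes T: "T > 0" and lip: "asymptotically_lipschitz C T w" and fol: "asymptotically_follows F w"
    and F: "\<And>p. closed (F p)" and Y: "shift_limit w Y"
  shows "di_solution F UNIV Y"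
proof -
  have lipY: "norm (Y t - Y s) \<le> C * \<bar>t - s\<bar>" for s t by (rule shift_limit_lipschitz[OF T lip Y])
  have "AE t in lborel. t \<in> UNIV \<longrightarrow> (\<exists>v\<in>F (Y t). (Y has_vector_derivative v) (at t within UNIV))"
    using lipschitz_differentiable_ae[OF lipY]
  proof eventually_elim
    case (elim t)
    then have "(Y has_vector_derivative vector_derivative Y (at t)) (at t)" by (simp add: vector_derivative_works)
    then show ?case using shift_limit_derivative[OF fol lipY Y F] by blast
  qed
  then show ?thesis
    unfolding di_solution_def using absolutely_continuous_if_lipschitz[OF lipY] by blast
qed

end

section \<open>Compactness of shifts and limit sets\<close>

text \<open>
  Shifts of a uniformly continuous function are equicontinuous. The theorem of Arzela and Ascoli gives
  convergence on each interval \<open>{- real i..real i}\<close>, and a diagonal sequence works for all of them.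
\<close>
lemma shift_subsequence_converges:
  fixes w :: "real \<Rightarrow> 'v::euclidean_space" and s :: "nat \<Rightarrow> real"
  assumes bounded: "bounded (range w)" and unif: "uniformly_continuous_on UNIV w"
  obtains r Y where "strict_mono (r :: nat \<Rightarrow> nat)"
    "\<And>c d. uniform_limit {c..d} (\<lambda>k t. w (s (r k) + t)) Y sequentially"
proof -
  obtain B where B: "\<And>t. norm (w t) \<le> B" using bounded by (auto simp: bounded_iff)
  define P where "P i \<sigma> \<longleftrightarrow> (\<exists>g. uniform_limit {- real i..real i} (\<lambda>n t. w (\<sigma> n + t)) g sequentially)"
    for i :: nat and \<sigma> :: "nat \<Rightarrow> real"
  have sub: "\<exists>k. strict_mono (k :: nat \<Rightarrow> nat) \<and> P i (\<sigma> \<circ> k)" for i \<sigma>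
  proof -
    have equi: "\<exists>d. 0 < d \<and> (\<forall>n y. y \<in> {- real i..real i} \<and> norm (x - y) < d \<longrightarrow> norm (w (\<sigma> n + x) - w (\<sigma> n + y)) < e)"
      if "0 < e" for x e
    proof -
      obtain d where d: "d > 0" "\<And>u v. dist u v < d \<Longrightarrow> dist (w u) (w v) < e"
        using unif \<open>0 < e\<close> unfolding uniformly_continuous_on_def by (metis UNIV_I dist_commute)
      then have "norm (w (\<sigma> n + x) - w (\<sigma> n + y)) < e" if "norm (x - y) < d" for n y
        using d(2)[of "\<sigma> n + x" "\<sigma> n + y"] that by (simp add: dist_norm)
      then show ?thesis using d(1) by blast
    qed
    obtain g k where k: "strict_mono (k :: nat \<Rightarrow> nat)"
      "\<And>e. 0 < e \<Longrightarrow> \<exists>N. \<forall>n x. n \<ge> N \<and> x \<in> {- real i..real i} \<longrightarrow> norm (w (\<sigma> (k n) + x) - g x) < e"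
      by (rule Arzela_Ascoli[of "{- real i..real i}" "\<lambda>n t. w (\<sigma> n + t)" B]) (use B equi in auto)
    have "uniform_limit {- real i..real i} (\<lambda>n t. w ((\<sigma> \<circ> k) n + t)) g sequentially"
      unfolding uniform_limit_sequentially_iff
    proof (intro allI impI)
      fix e :: real assume "e > 0"
      then obtain N where "\<forall>n x. n \<ge> N \<and> x \<in> {- real i..real i} \<longrightarrow> norm (w (\<sigma> (k n) + x) - g x) < e"
        using k(2) by blast
      then show "\<exists>N. \<forall>n\<ge>N. \<forall>x\<in>{- real i..real i}. dist (w ((\<sigma> \<circ> k) n + x)) (g x) < e"
        by (intro exI[of _ N]) (simp add: dist_norm)
    qed
    then show ?thesis using k(1) unfolding P_def by blast
  qed
  have P_P: "P i (\<sigma> \<circ> k2)" if P1: "P i (\<sigma> \<circ> k1)" and k12: "\<And>j. N \<le> j \<Longrightarrow> \<exists>j'. j \<le> j' \<and> k2 j = k1 j'"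
    for i \<sigma> and k1 k2 :: "nat \<Rightarrow> nat" and N
  proof -
    obtain g where g: "uniform_limit {- real i..real i} (\<lambda>n t. w ((\<sigma> \<circ> k1) n + t)) g sequentially"
      using P1 unfolding P_def by blast
    have "uniform_limit {- real i..real i} (\<lambda>n t. w ((\<sigma> \<circ> k2) n + t)) g sequentially"
      unfolding uniform_limit_sequentially_iff
    proof (intro allI impI)
      fix e :: real assume "e > 0"
      then obtain N1 where N1: "\<And>n t. n \<ge> N1 \<Longrightarrow> t \<in> {- real i..real i} \<Longrightarrow> dist (w ((\<sigma> \<circ> k1) n + t)) (g t) < e"
        using g unfolding uniform_limit_sequentially_iff by blast
      have "dist (w ((\<sigma> \<circ> k2) n + t)) (g t) < e" if n: "n \<ge> max N N1" and t: "t \<in> {- real i..real i}" for n t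
      proof -
        obtain j' where "n \<le> j'" "k2 n = k1 j'" using k12[of n] n by auto
        then show ?thesis using N1[of j' t] n t by simp
      qed
      then show "\<exists>N. \<forall>n\<ge>N. \<forall>t\<in>{- real i..real i}. dist (w ((\<sigma> \<circ> k2) n + t)) (g t) < e" by blast
    qed
    then show ?thesis unfolding P_def by blast
  qed
  obtain r where r: "strict_mono (r :: nat \<Rightarrow> nat)" "\<And>i. P i (s \<circ> r)"
    by (rule subsequence_diagonalization_lemma[where P = P and r = s, OF sub P_P]) auto
  define Y where "Y t = lim (\<lambda>k. w (s (r k) + t))" for t
  have "uniform_limit {c..d} (\<lambda>k t. w (s (r k) + t)) Y sequentially" for c d
  proof -
    obtain i :: nat where i: "max \<bar>c\<bar> \<bar>d\<bar> \<le> real i" using real_arch_simple by blast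
    obtain g where g: "uniform_limit {- real i..real i} (\<lambda>n t. w ((s \<circ> r) n + t)) g sequentially"
      using r(2) unfolding P_def by blast
    have "Y t = g t" if "t \<in> {- real i..real i}" for t
      using tendsto_uniform_limitI[OF g that] by (simp add: Y_def limI)
    then have "uniform_limit {- real i..real i} (\<lambda>k t. w (s (r k) + t)) Y sequentially"
      using g unfolding uniform_limit_sequentially_iff by simp
    then show ?thesis by (rule uniform_limit_on_subset) (use i in auto)
  qed
  then show thesis by (rule that[OF r(1)])
qed

lemma di_solution_restrict:
  assumes "di_solution F UNIV Y"
  shows "di_solution F I Y"
proof -
  have "AE t in lborel. \<exists>v\<in>F (Y t). (Y has_vector_derivative v) (at t)"
    using assms by (simp add: di_solution_def)
  then have "AE t in lborel. t \<in> I \<longrightarrow> (\<exists>v\<in>F (Y t). (Y has_vector_derivative v) (at t within I))"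
    by eventually_elim (blast intro: has_vector_derivative_at_within)
  then show ?thesis using assms by (simp add: di_solution_def)
qed

lemma limit_set_iff:
  fixes w :: "real \<Rightarrow> 'v::metric_space"
  shows "x \<in> limit_set w \<longleftrightarrow> (\<forall>S. \<forall>e>0. \<exists>s\<ge>S. dist (w s) x < e)"
proof -
  have "x \<in> limit_set w \<longleftrightarrow> (\<forall>S\<ge>0. \<forall>e>0. \<exists>s\<ge>S. dist (w s) x < e)"
    by (auto simp: limit_set_def closure_approachable Bex_def)
  also have "\<dots> \<longleftrightarrow> (\<forall>S. \<forall>e>0. \<exists>s\<ge>S. dist (w s) x < e)"
    by (meson linear order_trans)
  finally show ?thesis .
qed

lemma limit_in_limit_set:
  fixes w :: "real \<Rightarrow> 'v::metric_space"
  assumes s: "filterlim s at_top sequentially" and lim: "(\<lambda>k. w (s k)) \<longlonglongrightarrow> x"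
  shows "x \<in> limit_set w"
  unfolding limit_set_iff
proof (intro allI impI)
  fix S e :: real assume e: "e > 0"
  have "\<forall>\<^sub>F k in sequentially. S \<le> s k" using s unfolding filterlim_at_top by blast
  with tendstoD[OF lim e] have "\<forall>\<^sub>F k in sequentially. S \<le> s k \<and> dist (w (s k)) x < e"
    by eventually_elim simp
  then show "\<exists>s\<ge>S. dist (w s) x < e" using eventually_happens'[OF sequentially_bot] by blast
qed

lemma filterlim_shift_at_top:
  fixes s :: "'b \<Rightarrow> real"
  assumes "filterlim s at_top A"
  shows "filterlim (\<lambda>k. s k + t) at_top A"
  unfolding filterlim_at_top
proof
  fix Z
  have "\<forall>\<^sub>F k in A. Z - t \<le> s k" using assms unfolding filterlim_at_top by blast
  then show "\<forall>\<^sub>F k in A. Z \<le> s k + t" by eventually_elim simp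
qed

text \<open>
  A diagonal argument: the \<open>j\<close>-th shift of \<open>Y\<close> is matched, on an interval of length growing with \<open>j\<close>, by a
  shift of \<open>w\<close> up to an error \<open>1 / Suc j\<close>.
\<close>
lemma shift_limit_of_shift_limit:
  fixes w :: "real \<Rightarrow> 'v::metric_space"
  assumes "shift_limit w Y" "shift_limit Y Z"
  shows "shift_limit w Z"
proof -
  obtain s where s: "filterlim s at_top sequentially" "\<And>c d. uniform_limit {c..d} (\<lambda>k t. w (s k + t)) Y sequentially"
    using assms(1) unfolding shift_limit_def by auto
  obtain \<sigma> where \<sigma>: "filterlim \<sigma> at_top sequentially" "\<And>c d. uniform_limit {c..d} (\<lambda>k t. Y (\<sigma> k + t)) Z sequentially"
    using assms(2) unfolding shift_limit_def by auto
  have "\<exists>k. real j - \<sigma> j \<le> s k \<and> (\<forall>u\<in>{\<sigma> j - real j..\<sigma> j + real j}. dist (w (s k + u)) (Y u) < 1 / real (Suc j))" for j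
  proof -
    have "\<forall>\<^sub>F k in sequentially. real j - \<sigma> j \<le> s k" using s(1) unfolding filterlim_at_top by blast
    moreover have "\<forall>\<^sub>F k in sequentially. \<forall>u\<in>{\<sigma> j - real j..\<sigma> j + real j}. dist (w (s k + u)) (Y u) < 1 / real (Suc j)"
      by (rule uniform_limitD[OF s(2)]) simp
    ultimately have "\<forall>\<^sub>F k in sequentially. real j - \<sigma> j \<le> s k \<and>
      (\<forall>u\<in>{\<sigma> j - real j..\<sigma> j + real j}. dist (w (s k + u)) (Y u) < 1 / real (Suc j))" by (rule eventually_conj)
    then show ?thesis using eventually_happens'[OF sequentially_bot] by blast
  qed
  then obtain k where k: "\<And>j. real j - \<sigma> j \<le> s (k j)"
    "\<And>j u. u \<in> {\<sigma> j - real j..\<sigma> j + real j} \<Longrightarrow> dist (w (s (k j) + u)) (Y u) < 1 / real (Suc j)" by metis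
  define s' where "s' j = s (k j) + \<sigma> j" for j
  have "filterlim s' at_top sequentially"
  proof (rule filterlim_at_top_mono[OF filterlim_real_sequentially])
    show "\<forall>\<^sub>F j in sequentially. real j \<le> s' j" using k(1) by (auto simp: s'_def algebra_simps)
  qed
  moreover have "uniform_limit {c..d} (\<lambda>j t. w (s' j + t)) Z sequentially" for c d
  proof (rule uniform_limitI)
    fix e :: real assume e: "e > 0"
    then have e2: "e / 2 > 0" by simp
    then obtain N where N: "1 / real (Suc N) < e / 2" using nat_approx_posE by blast
    have "\<forall>\<^sub>F j in sequentially. \<forall>t\<in>{c..d}. dist (Y (\<sigma> j + t)) (Z t) < e / 2" by (rule uniform_limitD[OF \<sigma>(2) e2])
    moreover have "\<forall>\<^sub>F j in sequentially. j \<ge> N" by (rule eventually_ge_at_top)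
    moreover have "\<forall>\<^sub>F j in sequentially. real j \<ge> max \<bar>c\<bar> \<bar>d\<bar>"
      using filterlim_real_sequentially unfolding filterlim_at_top by blast
    ultimately show "\<forall>\<^sub>F j in sequentially. \<forall>t\<in>{c..d}. dist (w (s' j + t)) (Z t) < e"
    proof eventually_elim
      case (elim j)
      show ?case
      proof
        fix t assume t: "t \<in> {c..d}"
        have "\<sigma> j + t \<in> {\<sigma> j - real j..\<sigma> j + real j}" using t elim(3) by auto
        then have "dist (w (s (k j) + (\<sigma> j + t))) (Y (\<sigma> j + t)) < 1 / real (Suc j)" by (rule k(2))
        moreover have "1 / real (Suc j) \<le> 1 / real (Suc N)" using elim(2) by (simp add: frac_le)
        moreover have "dist (Y (\<sigma> j + t)) (Z t) < e / 2" using elim(1) t by blast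
        moreover have "dist (w (s' j + t)) (Z t) \<le> dist (w (s (k j) + (\<sigma> j + t))) (Y (\<sigma> j + t)) + dist (Y (\<sigma> j + t)) (Z t)"
          using dist_triangle by (simp add: s'_def add.assoc)
        ultimately show "dist (w (s' j + t)) (Z t) < e" using N by linarith
      qed
    qed
  qed
  ultimately show ?thesis unfolding shift_limit_def by blast
qed



section \<open>Chain transitivity and attraction\<close>

text \<open>
  The three properties of the trajectory from which everything about its long-time behaviour follows.
\<close>
locale asymptotic_trajectory =
  fixes F :: "'v::euclidean_space \<Rightarrow> 'v set" and w :: "real \<Rightarrow> 'v"
  assumes bounded: "bounded (range w)" and unif: "uniformly_continuous_on UNIV w"
    and solution: "\<And>Y. shift_limit w Y \<Longrightarrow> di_solution F UNIV Y"
begin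

lemma shift_limit_exists:
  assumes s: "filterlim s at_top sequentially"
  obtains r Y where "strict_mono (r :: nat \<Rightarrow> nat)" "filterlim (\<lambda>k. s (r k)) at_top sequentially"
    "\<And>c d. uniform_limit {c..d} (\<lambda>k t. w (s (r k) + t)) Y sequentially" "shift_limit w Y"
proof -
  obtain r Y where r: "strict_mono (r :: nat \<Rightarrow> nat)"
    "\<And>c d. uniform_limit {c..d} (\<lambda>k t. w (s (r k) + t)) Y sequentially"
    by (rule shift_subsequence_converges[OF bounded unif, of s]) (rule that)
  have "filterlim (\<lambda>k. s (r k)) at_top sequentially"
    using filterlim_compose[OF s filterlim_subseq[OF r(1)]] .
  moreover then have "shift_limit w Y" unfolding shift_limit_def using r(2) by (intro exI conjI allI)
  ultimately show thesis using r by (intro that)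
qed

lemma shift_limit_in_limit_set:
  assumes "shift_limit w Y"
  shows "Y t \<in> limit_set w"
proof -
  obtain s where s: "filterlim s at_top sequentially" "\<And>t. (\<lambda>k. w (s k + t)) \<longlonglongrightarrow> Y t"
    "\<And>c d. uniform_limit {c..d} (\<lambda>k t. w (s k + t)) Y sequentially"
    by (rule shift_limitE[OF assms]) (rule that)
  show ?thesis by (rule limit_in_limit_set[OF filterlim_shift_at_top[OF s(1)] s(2)])
qed

text \<open>
  Makes every conclusion about \<open>w\<close> available for its shift limits, in particular chain transitivity of
  their limit sets.
\<close>
lemma shift_limit_asymptotic_trajectory:
  assumes Y: "shift_limit w Y"
  shows "asymptotic_trajectory F Y"
proof
  obtain s where s: "filterlim s at_top sequentially" "\<And>t. (\<lambda>k. w (s k + t)) \<longlonglongrightarrow> Y t"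
    "\<And>c d. uniform_limit {c..d} (\<lambda>k t. w (s k + t)) Y sequentially"
    by (rule shift_limitE[OF Y]) (rule that)
  have "Y t \<in> closure (range w)" for t
    using closed_sequentially[OF closed_closure _ s(2)[of t]] closure_subset[of "range w"] by blast
  then show "bounded (range Y)" using bounded_subset[OF bounded_closure[OF bounded], of "range Y"] by blast
  show "uniformly_continuous_on UNIV Y"
    unfolding uniformly_continuous_on_def
  proof (intro allI impI)
    fix e :: real assume "e > 0"
    then have "e / 2 > 0" by simp
    then obtain d where d: "d > 0" "\<And>u v. dist u v < d \<Longrightarrow> dist (w u) (w v) < e / 2"
      using unif unfolding uniformly_continuous_on_def by (metis UNIV_I dist_commute)
    have "dist (Y t) (Y u) < e" if "dist t u < d" for t u
    proof -
      have lim: "(\<lambda>k. dist (w (s k + t)) (w (s k + u))) \<longlonglongrightarrow> dist (Y t) (Y u)" by (intro tendsto_dist s(2))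
      have "dist (w (s k + t)) (w (s k + u)) \<le> e / 2" for k
        using d(2)[of "s k + t" "s k + u"] that by (simp add: dist_norm less_imp_le)
      then have "dist (Y t) (Y u) \<le> e / 2" by (intro LIMSEQ_le_const2[OF lim]) simp
      then show ?thesis using \<open>e > 0\<close> by simp
    qed
    then show "\<exists>d>0. \<forall>x\<in>UNIV. \<forall>x'\<in>UNIV. dist x' x < d \<longrightarrow> dist (Y x') (Y x) < e" using d(1) by blast
  qed
  show "di_solution F UNIV Z" if "shift_limit Y Z" for Z
    using solution shift_limit_of_shift_limit[OF Y that] .
qed

lemma compact_limit_set: "compact (limit_set w)"
proof -
  have "closed (limit_set w)" unfolding limit_set_def by (intro closed_INT) auto
  moreover have "limit_set w \<subseteq> closure (range w)"
    unfolding limit_set_def using closure_mono[of "w ` {0..}" "range w"] by auto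
  ultimately show ?thesis
    using bounded_subset[OF bounded_closure[OF bounded]] by (simp add: compact_eq_bounded_closed)
qed

text \<open>
  If late pieces of \<open>w\<close> without a shadowing solution existed, a subsequence of the corresponding shifts
  would converge uniformly on \<open>{0..T}\<close> to a shift limit, which is such a solution.
\<close>
lemma shadowing:
  assumes \<epsilon>: "\<epsilon> > 0"
  obtains S where "\<And>s. s \<ge> S \<Longrightarrow>
    \<exists>Y. di_solution F UNIV Y \<and> range Y \<subseteq> limit_set w \<and> (\<forall>u\<in>{0..T}. dist (w (s + u)) (Y u) < \<epsilon>)"
proof (rule ccontr)
  assume contra: "\<not> thesis"
  have "\<exists>s. s \<ge> real k \<and> (\<nexists>Y. di_solution F UNIV Y \<and> range Y \<subseteq> limit_set w \<and>
      (\<forall>u\<in>{0..T}. dist (w (s + u)) (Y u) < \<epsilon>))" for k :: nat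
    using contra that by blast
  then obtain s where s: "\<And>k. s k \<ge> real k" and none:
    "\<And>k. \<nexists>Y. di_solution F UNIV Y \<and> range Y \<subseteq> limit_set w \<and> (\<forall>u\<in>{0..T}. dist (w (s k + u)) (Y u) < \<epsilon>)"
    by metis
  have "filterlim s at_top sequentially"
    using s by (intro filterlim_at_top_mono[OF filterlim_real_sequentially]) auto
  then obtain r Y where r: "strict_mono (r :: nat \<Rightarrow> nat)" "filterlim (\<lambda>k. s (r k)) at_top sequentially"
    "\<And>c d. uniform_limit {c..d} (\<lambda>k t. w (s (r k) + t)) Y sequentially" "shift_limit w Y"
    by (rule shift_limit_exists) (rule that)
  have "\<forall>\<^sub>F k in sequentially. \<forall>u\<in>{0..T}. dist (w (s (r k) + u)) (Y u) < \<epsilon>"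
    by (rule uniform_limitD[OF r(3) \<epsilon>])
  then obtain k where "\<forall>u\<in>{0..T}. dist (w (s (r k) + u)) (Y u) < \<epsilon>"
    using eventually_happens'[OF sequentially_bot] by blast
  then show False
    using none[of "r k"] solution[OF r(4)] shift_limit_in_limit_set[OF r(4)] by blast
qed

text \<open>
  The piece of \<open>w\<close> between a late visit near \<open>x\<close> and a later one near \<open>y\<close> is cut into \<open>n\<close> parts of equal length
  \<open>\<tau>\<close> between \<open>T + 1\<close> and \<open>2 * (T + 1)\<close>. Each part is shadowed by a solution in the limit set; consecutive
  solutions are both near \<open>w\<close> at the common time, so the jumps are small.
\<close>
lemma limit_set_chain_connected:
  assumes x: "x \<in> limit_set w" and y: "y \<in> limit_set w"
  shows "chain_connected_in F (limit_set w) x y"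
  unfolding chain_connected_in_def
proof (intro allI impI)
  fix \<epsilon> T :: real assume \<epsilon>: "\<epsilon> > 0" and T: "T > 0"
  have \<epsilon>2: "\<epsilon> / 2 > 0" using \<epsilon> by simp
  obtain S where S: "\<And>s. s \<ge> S \<Longrightarrow> \<exists>Y. di_solution F UNIV Y \<and> range Y \<subseteq> limit_set w \<and>
      (\<forall>u\<in>{0..2 * (T + 1)}. dist (w (s + u)) (Y u) < \<epsilon> / 2)"
    by (rule shadowing[OF \<epsilon>2, of "2 * (T + 1)"]) (rule that)
  obtain s1 where s1: "s1 \<ge> S" "dist (w s1) x < \<epsilon> / 2" using x \<epsilon>2 unfolding limit_set_iff by blast
  obtain s2 where s2: "s2 \<ge> s1 + (T + 1)" "dist (w s2) y < \<epsilon> / 2" using y \<epsilon>2 unfolding limit_set_iff by blast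
  define n where "n = nat \<lfloor>(s2 - s1) / (T + 1)\<rfloor>"
  have ge1: "(s2 - s1) / (T + 1) \<ge> 1" using s2(1) T by (simp add: field_simps)
  then have n: "n \<ge> 1" "real n = of_int \<lfloor>(s2 - s1) / (T + 1)\<rfloor>" by (auto simp: n_def le_nat_iff)
  have bounds: "real n \<le> (s2 - s1) / (T + 1)" "(s2 - s1) / (T + 1) < real n + 1"
    unfolding n(2) by linarith+
  define \<tau> where "\<tau> = (s2 - s1) / real n"
  have \<tau>: "\<tau> \<ge> T + 1" "\<tau> \<le> 2 * (T + 1)"
  proof -
    show "\<tau> \<ge> T + 1" using bounds(1) n(1) T by (simp add: \<tau>_def field_simps)
    have "s2 - s1 \<le> (real n + 1) * (T + 1)" using bounds(2) T by (simp add: field_simps)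
    also have "\<dots> \<le> (2 * real n) * (T + 1)" using n(1) T by (intro mult_right_mono) auto
    finally show "\<tau> \<le> 2 * (T + 1)" using n(1) by (simp add: \<tau>_def field_simps)
  qed
  define s where "s i = s1 + (real i - 1) * \<tau>" for i :: nat
  have s_ge: "s i \<ge> S" if "i \<ge> 1" for i
    using s1(1) that \<tau>(1) T by (simp add: s_def add_increasing2)
  have "\<forall>i. \<exists>Y. i \<ge> 1 \<longrightarrow> di_solution F UNIV Y \<and> range Y \<subseteq> limit_set w \<and>
      (\<forall>u\<in>{0..2 * (T + 1)}. dist (w (s i + u)) (Y u) < \<epsilon> / 2)"
    using S[OF s_ge] by blast
  then obtain Y where Y: "\<And>i. i \<ge> 1 \<Longrightarrow> di_solution F UNIV (Y i)" "\<And>i. i \<ge> 1 \<Longrightarrow> range (Y i) \<subseteq> limit_set w"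
    "\<And>i u. i \<ge> 1 \<Longrightarrow> u \<in> {0..2 * (T + 1)} \<Longrightarrow> dist (w (s i + u)) (Y i u) < \<epsilon> / 2"
    by metis
  have in_range: "0 \<in> {0..2 * (T + 1)}" "\<tau> \<in> {0..2 * (T + 1)}" using \<tau> T by simp_all
  have near1: "dist (w (s i)) (Y i 0) < \<epsilon> / 2" if "i \<ge> 1" for i
    using Y(3)[OF that in_range(1)] by (simp only: add_0_right)
  have s_Suc: "s (Suc i) = s i + \<tau>" for i by (simp add: s_def algebra_simps)
  have near2: "dist (w (s (Suc i))) (Y i \<tau>) < \<epsilon> / 2" if "i \<ge> 1" for i
    unfolding s_Suc by (rule Y(3)[OF that in_range(2)])
  have pieces: "\<forall>i\<in>{1..n}. di_solution F {0..} (Y i) \<and> T < \<tau> \<and> (\<forall>s\<in>{0..\<tau>}. Y i s \<in> limit_set w)"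
  proof
    fix i assume i: "i \<in> {1..n}"
    have "di_solution F {0..} (Y i)" using i by (intro di_solution_restrict[OF Y(1)]) simp
    moreover have "Y i u \<in> limit_set w" for u using i Y(2)[of i] by auto
    ultimately show "di_solution F {0..} (Y i) \<and> T < \<tau> \<and> (\<forall>s\<in>{0..\<tau>}. Y i s \<in> limit_set w)"
      using \<tau>(1) by simp
  qed
  have jumps: "\<forall>i\<in>{1..<n}. norm (Y i \<tau> - Y (Suc i) 0) \<le> \<epsilon>"
  proof
    fix i assume i: "i \<in> {1..<n}"
    have "dist (Y i \<tau>) (Y (Suc i) 0) \<le> dist (w (s (Suc i))) (Y i \<tau>) + dist (w (s (Suc i))) (Y (Suc i) 0)"
      by (rule dist_triangle3)
    then have "dist (Y i \<tau>) (Y (Suc i) 0) \<le> \<epsilon>"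
      using near2[of i] near1[of "Suc i"] i by simp
    then show "norm (Y i \<tau> - Y (Suc i) 0) \<le> \<epsilon>" by (simp only: dist_norm)
  qed
  have start: "norm (Y 1 0 - x) \<le> \<epsilon>"
  proof -
    have "s 1 = s1" by (simp add: s_def)
    moreover have "dist (Y 1 0) x \<le> dist (w s1) (Y 1 0) + dist (w s1) x" by (rule dist_triangle3)
    ultimately have "dist (Y 1 0) x \<le> \<epsilon>" using near1[of 1] s1(2) by simp
    then show ?thesis by (simp only: dist_norm)
  qed
  have finish: "norm (Y n \<tau> - y) \<le> \<epsilon>"
  proof -
    have "s (Suc n) = s2" using n(1) by (simp add: s_def \<tau>_def)
    moreover have "dist (Y n \<tau>) y \<le> dist (w s2) (Y n \<tau>) + dist (w s2) y" by (rule dist_triangle3)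
    ultimately have "dist (Y n \<tau>) y \<le> \<epsilon>" using near2[of n] n(1) s2(2) by simp
    then show ?thesis by (simp only: dist_norm)
  qed
  show "\<exists>n\<ge>1. \<exists>Y \<tau>. (\<forall>i\<in>{1..n}. di_solution F {0..} (Y i) \<and> T < \<tau> i \<and> (\<forall>s\<in>{0..\<tau> i}. Y i s \<in> limit_set w)) \<and>
        (\<forall>i\<in>{1..<n}. norm (Y i (\<tau> i) - Y (Suc i) 0) \<le> \<epsilon>) \<and>
        norm (Y 1 0 - x) \<le> \<epsilon> \<and> norm (Y n (\<tau> n) - y) \<le> \<epsilon>"
    by (rule exI[where x = n], rule conjI[OF n(1)], rule exI[where x = Y], rule exI[where x = "\<lambda>_. \<tau>"])
       (use pieces jumps start finish in simp)
qed

lemma limit_set_internally_chain_transitive: "internally_chain_transitive F (limit_set w)"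
  unfolding internally_chain_transitive_def using compact_limit_set limit_set_chain_connected by blast

lemma limit_set_chain_recurrent: "limit_set w \<subseteq> chain_recurrent_points F"
proof
  fix x assume "x \<in> limit_set w"
  then have chain: "chain_connected_in F (limit_set w) x x" by (intro limit_set_chain_connected)
  show "x \<in> chain_recurrent_points F"
    unfolding chain_recurrent_points_def
  proof (intro CollectI allI impI)
    fix \<epsilon> T :: real assume \<epsilon>: "\<epsilon> > 0" and T: "T > 0"
    obtain n Y \<tau> where n: "1 \<le> n"
      and sol: "\<forall>i\<in>{1..n}. di_solution F {0..} (Y i) \<and> T < \<tau> i \<and> (\<forall>s\<in>{0..\<tau> i}. Y i s \<in> limit_set w)"
      and jumps: "\<forall>i\<in>{1..<n}. norm (Y i (\<tau> i) - Y (Suc i) 0) \<le> \<epsilon>"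
      and ends: "norm (Y 1 0 - x) \<le> \<epsilon>" "norm (Y n (\<tau> n) - x) \<le> \<epsilon>"
      using mp[OF spec[OF mp[OF spec[OF chain[unfolded chain_connected_in_def]] \<epsilon>]] T]
      by (elim exE conjE) (rule that; assumption)
    show "\<exists>n\<ge>1. \<exists>Y \<tau>. (\<forall>i\<in>{1..n}. di_solution F {0..} (Y i) \<and> T < \<tau> i) \<and> norm (Y 1 0 - x) \<le> \<epsilon> \<and>
        (\<forall>i\<in>{1..<n}. norm (Y i (\<tau> i) - Y (Suc i) 0) \<le> \<epsilon>) \<and> norm (Y n (\<tau> n) - x) \<le> \<epsilon>"
      by (rule exI[where x = n], rule conjI[OF n], rule exI[where x = Y], rule exI[where x = \<tau>])
         (use sol jumps ends in simp)
  qed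
qed

text \<open>
  A shift limit along the visits starts in \<open>K\<close> and is attracted, so \<open>w\<close> comes arbitrarily near \<open>\<Lambda>\<close> again
  and again. If \<open>w\<close> also kept leaving the \<open>\<epsilon>\<close>-neighbourhood, consider the excursions: \<open>\<sigma> k\<close> is the last time
  at distance at most \<open>\<delta>\<close> before a time \<open>\<tau> k\<close> at distance at least \<open>\<epsilon>\<close>. A shift limit along \<open>\<sigma>\<close> starts so near to \<open>\<Lambda>\<close>
  that it stays within \<open>\<epsilon> / 2\<close> and is attracted; its return below \<open>\<delta>\<close> bounds the durations \<open>\<tau> k - \<sigma> k\<close>, and
  on a bounded time interval \<open>w\<close> cannot be \<open>\<epsilon> / 2\<close> away from it.
\<close>
lemma attracted_to_stable_set:
  assumes stable: "locally_asymptotically_stable F \<Lambda>" and K: "closed K" "K \<subseteq> domain_of_attraction F \<Lambda>"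
    and visits: "filterlim s at_top sequentially" "\<And>k. w (s k) \<in> K"
  shows "((\<lambda>t. infdist (w t) \<Lambda>) \<longlongrightarrow> 0) at_top"
proof (rule tendstoI)
  let ?D = "\<lambda>t. infdist (w t) \<Lambda>"
  have w_cont: "continuous_on A w" for A
    by (rule continuous_on_subset[OF uniformly_continuous_imp_continuous[OF unif]]) simp
  have D_cont: "continuous_on A ?D" for A by (intro continuous_intros w_cont)
  have halfline: "di_solution F {0..} Y" if "shift_limit w Y" for Y
    by (rule di_solution_restrict[OF solution[OF that]])
  obtain \<delta>0 where \<delta>0: "\<delta>0 > 0" "\<And>X. di_solution F {0..} X \<Longrightarrow> infdist (X 0) \<Lambda> < \<delta>0 \<Longrightarrow>
        ((\<lambda>t. infdist (X t) \<Lambda>) \<longlongrightarrow> 0) at_top"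
    using stable[unfolded locally_asymptotically_stable_def] by (elim conjE exE) (rule that; blast)
  have small: "\<exists>U>0. infdist (Y U) \<Lambda> < \<delta>" if "((\<lambda>t. infdist (Y t) \<Lambda>) \<longlongrightarrow> 0) at_top" "\<delta> > 0" for Y :: "real \<Rightarrow> 'v" and \<delta>
  proof -
    have "\<forall>\<^sub>F t in at_top. infdist (Y t) \<Lambda> < \<delta>" using order_tendstoD(2)[OF that] .
    then have "\<forall>\<^sub>F t in at_top. 0 < t \<and> infdist (Y t) \<Lambda> < \<delta>"
      using eventually_gt_at_top[of 0] by eventually_elim simp
    then show ?thesis using eventually_happens'[OF trivial_limit_at_top_linorder] by blast
  qed
  have enters: "\<exists>t\<ge>T. ?D t < \<delta>" if \<delta>: "\<delta> > 0" for T \<delta>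
  proof -
    obtain r Y where r: "strict_mono (r :: nat \<Rightarrow> nat)" "filterlim (\<lambda>k. s (r k)) at_top sequentially"
      "\<And>c d. uniform_limit {c..d} (\<lambda>k t. w (s (r k) + t)) Y sequentially" "shift_limit w Y"
      by (rule shift_limit_exists[OF visits(1)]) (rule that)
    have lim: "(\<lambda>k. w (s (r k) + t)) \<longlonglongrightarrow> Y t" for t
      using tendsto_uniform_limitI[OF r(3)[of t t], of t] by simp
    have "Y 0 \<in> K" using closed_sequentially[OF K(1) _ lim[of 0]] visits(2) by simp
    then have "((\<lambda>t. infdist (Y t) \<Lambda>) \<longlongrightarrow> 0) at_top"
      using K(2) halfline[OF r(4)] unfolding domain_of_attraction_def by blast
    then obtain U where "U > 0" "infdist (Y U) \<Lambda> < \<delta>" using small \<delta> by blast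
    moreover have "(\<lambda>k. ?D (s (r k) + U)) \<longlonglongrightarrow> infdist (Y U) \<Lambda>" by (intro tendsto_infdist lim)
    ultimately have "\<forall>\<^sub>F k in sequentially. ?D (s (r k) + U) < \<delta>" by (intro order_tendstoD(2))
    moreover have "\<forall>\<^sub>F k in sequentially. T \<le> s (r k)" using r(2) unfolding filterlim_at_top by blast
    ultimately have "\<forall>\<^sub>F k in sequentially. ?D (s (r k) + U) < \<delta> \<and> T \<le> s (r k)" by (rule eventually_conj)
    then obtain k where "?D (s (r k) + U) < \<delta>" "T \<le> s (r k)" using eventually_happens'[OF sequentially_bot] by blast
    then show ?thesis using \<open>U > 0\<close> by (intro exI[of _ "s (r k) + U"]) auto
  qed
  fix \<epsilon> :: real assume \<epsilon>: "\<epsilon> > 0"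
  then have "\<epsilon> / 2 > 0" by simp
  obtain \<delta>1 where \<delta>1: "\<delta>1 > 0" "\<And>X t. di_solution F {0..} X \<Longrightarrow> infdist (X 0) \<Lambda> < \<delta>1 \<Longrightarrow> t \<ge> 0 \<Longrightarrow>
        infdist (X t) \<Lambda> < \<epsilon> / 2"
    using mp[OF spec[OF conjunct1[OF conjunct2[OF stable[unfolded locally_asymptotically_stable_def]]]]
        \<open>\<epsilon> / 2 > 0\<close>] by blast
  \<comment> \<open>Solutions starting within \<open>\<delta>\<close> of \<open>\<Lambda>\<close> are attracted to \<open>\<Lambda>\<close> and never reach the distance \<open>\<epsilon> / 2\<close>.\<close>
  define \<delta> where "\<delta> = min \<delta>0 \<delta>1 / 2"
  have \<delta>: "\<delta> > 0" "\<delta> < \<delta>0" "\<delta> < \<delta>1" using \<delta>0(1) \<delta>1(1) by (auto simp: \<delta>_def min_def)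
  show "\<forall>\<^sub>F t in at_top. dist (?D t) 0 < \<epsilon>"
  proof (rule ccontr)
    assume "\<not> (\<forall>\<^sub>F t in at_top. dist (?D t) 0 < \<epsilon>)"
    then have leaves: "\<exists>t\<ge>T. ?D t \<ge> \<epsilon>" for T
      by (auto simp: eventually_at_top_linorder not_less infdist_nonneg)
    have "\<exists>\<sigma> \<tau>. real k \<le> \<sigma> \<and> \<sigma> \<le> \<tau> \<and> ?D \<sigma> \<le> \<delta> \<and> ?D \<tau> \<ge> \<epsilon> \<and> (\<forall>t\<in>{\<sigma><..\<tau>}. ?D t > \<delta>)" for k :: nat
    proof -
      obtain p where p: "p \<ge> real k" "?D p < \<delta>" using enters[OF \<delta>(1)] by blast
      obtain q where q: "q \<ge> p" "?D q \<ge> \<epsilon>" using leaves by blast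
      let ?A = "{t\<in>{p..q}. ?D t \<le> \<delta>}"
      have "closed ?A"
        using continuous_closed_preimage[OF D_cont[of "{p..q}"] closed_atLeastAtMost closed_atMost[of \<delta>]]
        by (simp add: vimage_def Int_def)
      moreover have "bounded ?A" by (rule bounded_subset[of "{p..q}"]) auto
      ultimately have "compact ?A" by (simp add: compact_eq_bounded_closed)
      moreover have "p \<in> ?A" using p q by simp
      ultimately obtain \<sigma> where \<sigma>: "\<sigma> \<in> ?A" "\<And>t. t \<in> ?A \<Longrightarrow> t \<le> \<sigma>"
        using compact_attains_sup[of ?A] by blast
      have "?D t > \<delta>" if "t \<in> {\<sigma><..q}" for t
        using \<sigma>(2)[of t] \<sigma>(1) that by force
      then show ?thesis using \<sigma>(1) p q by (intro exI[of _ \<sigma>] exI[of _ q]) auto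
    qed
    then obtain \<sigma> \<tau> where \<sigma>\<tau>: "\<And>k::nat. real k \<le> \<sigma> k" "\<And>k. \<sigma> k \<le> \<tau> k" "\<And>k. ?D (\<sigma> k) \<le> \<delta>" "\<And>k. ?D (\<tau> k) \<ge> \<epsilon>"
      "\<And>k t. t \<in> {\<sigma> k<..\<tau> k} \<Longrightarrow> ?D t > \<delta>" by metis
    have "filterlim \<sigma> at_top sequentially"
      using \<sigma>\<tau>(1) by (intro filterlim_at_top_mono[OF filterlim_real_sequentially]) auto
    then obtain r Y where r: "strict_mono (r :: nat \<Rightarrow> nat)" "filterlim (\<lambda>k. \<sigma> (r k)) at_top sequentially"
      "\<And>c d. uniform_limit {c..d} (\<lambda>k t. w (\<sigma> (r k) + t)) Y sequentially" "shift_limit w Y"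
      by (rule shift_limit_exists) (rule that)
    have lim: "(\<lambda>k. ?D (\<sigma> (r k) + t)) \<longlonglongrightarrow> infdist (Y t) \<Lambda>" for t
      using tendsto_uniform_limitI[OF r(3)[of t t], of t] by (intro tendsto_infdist) simp
    have "infdist (Y 0) \<Lambda> \<le> \<delta>" by (rule LIMSEQ_le_const2[OF lim[of 0]]) (use \<sigma>\<tau>(3) in auto)
    then have Y0: "infdist (Y 0) \<Lambda> < \<delta>0" "infdist (Y 0) \<Lambda> < \<delta>1" using \<delta> by auto
    obtain U where U: "U > 0" "infdist (Y U) \<Lambda> < \<delta>" using small[OF \<delta>0(2)[OF halfline[OF r(4)] Y0(1)] \<delta>(1)] by blast
    \<comment> \<open>The excursion is over before time \<open>U\<close>, because the limit is back inside the inner neighbourhood by then.\<close>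
    have "\<forall>\<^sub>F k in sequentially. ?D (\<sigma> (r k) + U) < \<delta>" using order_tendstoD(2)[OF lim U(2)] .
    moreover have "\<forall>\<^sub>F k in sequentially. \<forall>u\<in>{0..U}. dist (w (\<sigma> (r k) + u)) (Y u) < \<epsilon> / 2"
      by (rule uniform_limitD[OF r(3) \<open>\<epsilon> / 2 > 0\<close>])
    ultimately have "\<forall>\<^sub>F k in sequentially. ?D (\<sigma> (r k) + U) < \<delta> \<and> (\<forall>u\<in>{0..U}. dist (w (\<sigma> (r k) + u)) (Y u) < \<epsilon> / 2)"
      by (rule eventually_conj)
    then obtain k where k: "?D (\<sigma> (r k) + U) < \<delta>" "\<And>u. u \<in> {0..U} \<Longrightarrow> dist (w (\<sigma> (r k) + u)) (Y u) < \<epsilon> / 2"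
      using eventually_happens'[OF sequentially_bot] by blast
    define d where "d = \<tau> (r k) - \<sigma> (r k)"
    have "d \<ge> 0" using \<sigma>\<tau>(2) by (simp add: d_def)
    have "d \<le> U"
    proof (rule ccontr)
      assume "\<not> d \<le> U"
      then show False
        using \<sigma>\<tau>(5)[of "\<sigma> (r k) + U" "r k"] k(1) U(1)
        by (auto simp: d_def)
    qed
    then have d: "d \<in> {0..U}" using \<open>d \<ge> 0\<close> by simp
    have "\<epsilon> \<le> infdist (w (\<sigma> (r k) + d)) \<Lambda>" using \<sigma>\<tau>(4)[of "r k"] by (simp add: d_def)
    also have "\<dots> \<le> infdist (Y d) \<Lambda> + dist (w (\<sigma> (r k) + d)) (Y d)" by (rule infdist_triangle)
    also have "\<dots> < \<epsilon> / 2 + \<epsilon> / 2"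
      using k(2)[OF d] \<delta>1(2)[OF halfline[OF r(4)] Y0(2) \<open>d \<ge> 0\<close>] by (intro add_strict_mono)
    finally show False by simp
  qed
qed

end

section \<open>Convergence of the algorithm\<close>

context step_sizes
begin

lemma trajectory_asymptotic:
  fixes x :: "nat \<Rightarrow> 'v::euclidean_space"
  assumes follows: "follows F x" and F: "\<And>p. compact (F p)" and x: "bounded (range x)"
  shows "asymptotic_trajectory F (trajectory x)"
proof -
  obtain C T where C: "C \<ge> 0" and T: "T > 0" and lip: "asymptotically_lipschitz C T (trajectory x)"
    and fol: "asymptotically_follows F (trajectory x)"
    using trajectory_asymptotics[OF follows compact_imp_bounded[OF F] x] by blast
  show ?thesis
    by (unfold_locales)
       (use bounded_trajectory[OF x] uniformly_continuous_trajectory[OF C T lip]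
          shift_limit_solution[OF T lip fol compact_imp_closed[OF F]] in blast)+
qed

lemma bounded_shifted_interpolations:
  fixes x :: "nat \<Rightarrow> 'v::euclidean_space"
  assumes "bounded (range (trajectory x))"
  shows "bounded (\<Union>n. range (shifted_interpolation a x n))"
  by (rule bounded_subset[OF assms]) (auto simp: shifted_interpolation_eq_trajectory)

lemma equicontinuous_shifted_interpolations:
  fixes x :: "nat \<Rightarrow> 'v::euclidean_space"
  assumes unif: "uniformly_continuous_on UNIV (trajectory x)"
  shows "equicontinuous_on_bounded_intervals (shifted_interpolation a x)"
  unfolding equicontinuous_on_bounded_intervals_def
proof (intro allI impI)
  fix \<epsilon> :: real assume "\<epsilon> > 0"
  then obtain d where d: "d > 0" "\<And>u v. dist u v < d \<Longrightarrow> dist (trajectory x u) (trajectory x v) < \<epsilon>"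
    using unif unfolding uniformly_continuous_on_def by (metis UNIV_I dist_commute)
  have "dist (shifted_interpolation a x n s) (shifted_interpolation a x n t) < \<epsilon>" if "\<bar>s - t\<bar> < d" for n s t
    using d(2)[of "s + time n" "t + time n"] that by (simp add: shifted_interpolation_eq_trajectory dist_real_def)
  then show "\<exists>\<delta>>0. \<forall>n. \<forall>s\<in>{c..d}. \<forall>t\<in>{c..d}. \<bar>s - t\<bar> < \<delta> \<longrightarrow>
      dist (shifted_interpolation a x n s) (shifted_interpolation a x n t) < \<epsilon>" for c d
    using d(1) by blast
qed

lemma time_subseq_at_top: "strict_mono r \<Longrightarrow> filterlim (\<lambda>k. time (r k)) at_top sequentially"
  using filterlim_compose[OF time_at_top filterlim_subseq] .

lemma limit_of_subsequence_shift_limit: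
  fixes x :: "nat \<Rightarrow> 'v::euclidean_space"
  assumes "limit_of_subsequence (shifted_interpolation a x) Y"
  shows "shift_limit (trajectory x) Y"
proof -
  obtain r where r: "strict_mono (r :: nat \<Rightarrow> nat)"
    "\<forall>c d. uniform_limit {c..d} (\<lambda>k. shifted_interpolation a x (r k)) Y sequentially"
    using assms unfolding limit_of_subsequence_def by blast
  have "shifted_interpolation a x (r k) = (\<lambda>t. trajectory x (time (r k) + t))" for k
    by (simp add: fun_eq_iff shifted_interpolation_eq_trajectory add.commute)
  then show ?thesis
    unfolding shift_limit_def using r(2) time_subseq_at_top[OF r(1)] by (intro exI[of _ "\<lambda>k. time (r k)"]) simp
qed

lemma limit_points_in_limit_set:
  fixes x :: "nat \<Rightarrow> 'v::euclidean_space"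
  shows "limit_points x \<subseteq> limit_set (trajectory x)"
proof
  fix \<theta> assume "\<theta> \<in> limit_points x"
  then obtain r where r: "strict_mono (r :: nat \<Rightarrow> nat)" "(x \<circ> r) \<longlonglongrightarrow> \<theta>" by (auto simp: limit_points_def)
  show "\<theta> \<in> limit_set (trajectory x)"
    by (rule limit_in_limit_set[OF time_subseq_at_top[OF r(1)]]) (use r(2) in \<open>simp add: o_def\<close>)
qed

lemma converges_to_stable_set:
  fixes x :: "nat \<Rightarrow> 'v::euclidean_space"
  assumes traj: "asymptotic_trajectory F (trajectory x)"
    and \<Lambda>: "locally_asymptotically_stable F \<Lambda>" and K: "closed K" "K \<subseteq> domain_of_attraction F \<Lambda>"
    and visits: "\<exists>\<^sub>\<infinity>n. x n \<in> K"
  shows "(\<lambda>n. infdist (x n) \<Lambda>) \<longlonglongrightarrow> 0"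
proof -
  have "infinite {n. x n \<in> K}" using visits by (simp add: frequently_cofinite)
  then obtain r where r: "strict_mono (r :: nat \<Rightarrow> nat)" "\<forall>k. r k \<in> {n. x n \<in> K}"
    using infinite_enumerate by blast
  have "((\<lambda>t. infdist (trajectory x t) \<Lambda>) \<longlongrightarrow> 0) at_top"
    by (rule asymptotic_trajectory.attracted_to_stable_set[OF traj \<Lambda> K time_subseq_at_top[OF r(1)]])
       (use r(2) in simp)
  from filterlim_compose[OF this time_at_top] show ?thesis by simp
qed

end



theorem theorem2p2:
  fixes M :: "'a measure"
    and S :: "'s measure" and Z :: "'z measure" and W :: "'w measure"
    and a :: "nat \<Rightarrow> real"
    and X \<beta> :: "nat \<Rightarrow> 'a \<Rightarrow> 'v::euclidean_space"
    and \<xi> :: "nat \<Rightarrow> 'a \<Rightarrow> 's" and \<zeta> :: "nat \<Rightarrow> 'a \<Rightarrow> 'z" and \<zeta>' :: "nat \<Rightarrow> 'a \<Rightarrow> 'w"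
    and b :: "nat \<Rightarrow> 'v \<Rightarrow> 's \<Rightarrow> 'v" and h :: "'v \<Rightarrow> 'z \<Rightarrow> 'v" and h0 :: "'w \<Rightarrow> 'v"
    and hbar :: "'v \<Rightarrow> 'v" and G :: "'v \<Rightarrow> 'v set"
  assumes prob: "prob_space M" and complete: "complete_measure M"
    and steps: "\<And>n. a n > 0" "a \<longlonglongrightarrow> 0" "\<not> summable a"
    and noise: "\<And>n. \<xi> n \<in> measurable M S" "\<And>n. \<zeta> n \<in> measurable M Z" "\<And>n. \<zeta>' n \<in> measurable M W"
    and state: "\<And>n. X n \<in> borel_measurable M"
    and h_meas: "case_prod h \<in> borel_measurable (borel \<Otimes>\<^sub>M Z)"
    and algorithm: "\<And>n \<omega>. \<omega> \<in> space M \<Longrightarrow>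
      X (Suc n) \<omega> = X n \<omega> + a n *\<^sub>R b n (X n \<omega>) (\<xi> n \<omega>) + a n *\<^sub>R h (X n \<omega>) (\<zeta> n \<omega>)
        + a n *\<^sub>R h0 (\<zeta>' n \<omega>) + a n *\<^sub>R \<beta> n \<omega>"
    and X_bounded: "AE \<omega> in M. bounded (range (\<lambda>n. X n \<omega>))"
    and A_i: "\<And>B \<epsilon>. bounded B \<Longrightarrow> \<epsilon> > 0 \<Longrightarrow>
      \<exists>\<delta>>0. \<forall>x\<in>B. \<forall>y\<in>B. dist x y < \<delta> \<longrightarrow> (\<forall>z\<in>space Z. dist (h x z) (h y z) < \<epsilon>)"
    and A_ii: "(\<exists>C. \<forall>x. \<forall>z\<in>space Z. norm (h x z) \<le> C) \<or>
      (\<exists>(g1::'v \<Rightarrow> real) (g2::'z \<Rightarrow> real) (g3::'z \<Rightarrow> real).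
         g1 \<in> borel_measurable borel \<and> g2 \<in> borel_measurable Z \<and> g3 \<in> borel_measurable Z \<and>
         (\<forall>x. g1 x \<ge> 0) \<and> (\<forall>z\<in>space Z. g2 z \<ge> 0 \<and> g3 z \<ge> 0) \<and>
         (\<forall>B. bounded B \<longrightarrow> bounded (g1 ` B)) \<and>
         (\<forall>x. \<forall>z\<in>space Z. norm (h x z) \<le> g1 x * g2 z + g3 z) \<and>
         asymptotically_small_increments M a (\<lambda>i \<omega>. g2 (\<zeta> i \<omega>) + g3 (\<zeta> i \<omega>)))"
    and A_iii: "continuous_on UNIV hbar"
      "\<exists>T>0. \<forall>x. averages_out M a T (\<lambda>i \<omega>. h x (\<zeta> i \<omega>) - hbar x)"
    and A_iv_indep: "prob_space.indep_sets M
      (\<lambda>k. [sets (noise_sigma M S \<xi> UNIV), sets (noise_sigma M Z \<zeta> UNIV),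
            sets (noise_sigma M W \<zeta>' UNIV)] ! k) {0, 1, 2}"
    and A_iv_exogenous: "exogenous M S \<xi> X" "exogenous M Z \<zeta> X" "exogenous M W \<zeta>' X"
    and A_iv_h0: "h0 \<in> borel_measurable W"
      "\<exists>T>0. averages_out M a T (\<lambda>i \<omega>. h0 (\<zeta>' i \<omega>))"
    and A_v: "\<And>n. \<beta> n \<in> borel_measurable M" "\<And>n. \<exists>C. AE \<omega> in M. norm (\<beta> n \<omega>) \<le> C"
      "AE \<omega> in M. (\<lambda>n. norm (\<beta> n \<omega>)) \<longlonglongrightarrow> 0"
    and G: "set_valued_bound M a S \<xi> b G"
  defines "F \<equiv> \<lambda>x. {hbar x + y | y. y \<in> G x}"
    and "Xs \<equiv> \<lambda>\<omega>. shifted_interpolation a (\<lambda>n. X n \<omega>)"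
  shows "(\<exists>N\<in>null_sets M. \<forall>\<omega>\<in>space M - N.
           (bounded (\<Union>n. range (Xs \<omega> n)) \<and> equicontinuous_on_bounded_intervals (Xs \<omega>)) \<and>
           (\<forall>Y. limit_of_subsequence (Xs \<omega>) Y \<longrightarrow>
              di_solution F UNIV Y \<and> internally_chain_transitive F (limit_set Y)) \<and>
           limit_points (\<lambda>n. X n \<omega>) \<subseteq> chain_recurrent_points F) \<and>
         (\<forall>\<Lambda> K. locally_asymptotically_stable F \<Lambda> \<longrightarrow> compact K \<longrightarrow> K \<subseteq> domain_of_attraction F \<Lambda> \<longrightarrow>
           ((AE \<omega> in M. \<exists>\<^sub>\<infinity>n. X n \<omega> \<in> K) \<longrightarrow> (AE \<omega> in M. (\<lambda>n. infdist (X n \<omega>) \<Lambda>) \<longlonglongrightarrow> 0)) \<and>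
           (\<forall>\<rho>. measure M {\<omega>\<in>space M. \<exists>\<^sub>\<infinity>n. X n \<omega> \<in> K} \<ge> \<rho> \<longrightarrow>
                measure M {\<omega>\<in>space M. (\<lambda>n. infdist (X n \<omega>) \<Lambda>) \<longlonglongrightarrow> 0} \<ge> \<rho>))"
proof -
  interpret prob_space M by fact
  interpret step_sizes a by unfold_locales (use steps in auto)

  obtain R where G_vals: "\<And>x. G x \<noteq> {}" "\<And>x. compact (G x)" "\<And>x. convex (G x)"
    and G_ball: "\<And>x. G x \<subseteq> cball 0 R" and G_graph: "closed {(x, y). y \<in> G x}"
    using G unfolding set_valued_bound_def by meson
  obtain m :: "nat \<Rightarrow> 'v \<Rightarrow> 's \<Rightarrow> real" and Tm
    where m_meas: "\<forall>n x. m n x \<in> borel_measurable S"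
    and m_pos: "\<forall>n x. \<forall>s\<in>space S. m n x s > 0"
    and m_cont: "\<forall>x. \<forall>\<epsilon>>0. \<exists>\<delta>>0. \<forall>y. dist y x < \<delta> \<longrightarrow> (\<forall>n. \<forall>s\<in>space S. \<bar>m n y s - m n x s\<bar> < \<epsilon>)"
    and b: "\<forall>n x. \<forall>s\<in>space S. b n x s \<in> {y + m n x s *\<^sub>R u | y u. y \<in> G x \<and> u \<in> cball 0 1}"
    and Tm_pos: "Tm > 0" and m_avg: "\<forall>x. averages_out M a Tm (\<lambda>i \<omega>. m i x (\<xi> i \<omega>))"
    using G[unfolded set_valued_bound_def] by (elim conjE exE) (rule that; assumption)
  have \<xi>_space: "\<xi> i \<omega> \<in> space S" and \<zeta>_space: "\<zeta> i \<omega> \<in> space Z" if "\<omega> \<in> space M" for i \<omega>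
    using noise(1,2) that by (auto dest: measurable_space)
  have F_compact: "compact (F x)" for x
  proof -
    have "F x = (+) (hbar x) ` G x" by (auto simp: F_def)
    then show ?thesis using G_vals(2) compact_translation by metis
  qed

  have AE_m: "AE \<omega> in M. \<forall>x. averages_to_zero Tm (\<lambda>i. m i x (\<xi> i \<omega>))"
  proof (rule AE_averages_to_zero_all[OF prob _ Tm_pos m_avg[rule_format]])
    show "(\<lambda>\<omega>. m i x (\<xi> i \<omega>)) \<in> borel_measurable M" for x i
      by (rule measurable_compose[OF noise(1) m_meas[rule_format]])
    fix x and \<epsilon> :: real assume "\<epsilon> > 0"
    then obtain \<delta> where \<delta>: "\<delta> > 0" "\<And>y n s. dist y x < \<delta> \<Longrightarrow> s \<in> space S \<Longrightarrow> \<bar>m n y s - m n x s\<bar> < \<epsilon>"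
      using m_cont by blast
    have "norm (m i y (\<xi> i \<omega>) - m i x (\<xi> i \<omega>)) \<le> \<epsilon>" if "dist y x < \<delta>" "\<omega> \<in> space M" for y i \<omega>
      using \<delta>(2)[OF that(1) \<xi>_space[OF that(2)], of i i] by simp
    then show "\<exists>\<delta>>0. \<forall>y. dist y x < \<delta> \<longrightarrow> (\<forall>i. \<forall>\<omega>\<in>space M. norm (m i y (\<xi> i \<omega>) - m i x (\<xi> i \<omega>)) \<le> \<epsilon>)"
      using \<delta>(1) by blast
  qed

  have h_cont: "\<exists>\<delta>>0. \<forall>y. dist y x < \<delta> \<longrightarrow> (\<forall>z\<in>space Z. dist (h y z) (h x z) < \<epsilon>)" if "\<epsilon> > 0" for x \<epsilon>
  proof -
    obtain \<delta> where \<delta>: "\<delta> > 0" "\<forall>u\<in>cball x 1. \<forall>y\<in>cball x 1. dist u y < \<delta> \<longrightarrow> (\<forall>z\<in>space Z. dist (h u z) (h y z) < \<epsilon>)"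
      using A_i[OF bounded_cball \<open>\<epsilon> > 0\<close>, of x 1] by blast
    have "dist (h y z) (h x z) < \<epsilon>" if "dist y x < min \<delta> 1" "z \<in> space Z" for y z
      using \<delta>(2)[rule_format, of y x z] that by (simp add: dist_commute)
    then show ?thesis using \<delta>(1) by (intro exI[of _ "min \<delta> 1"]) auto
  qed
  obtain Th where Th: "Th > 0" "\<And>x. averages_out M a Th (\<lambda>i \<omega>. h x (\<zeta> i \<omega>) - hbar x)" using A_iii(2) by blast
  have AE_h: "AE \<omega> in M. \<forall>x. averages_to_zero Th (\<lambda>i. h x (\<zeta> i \<omega>) - hbar x)"
  proof (rule AE_averages_to_zero_all[OF prob _ Th])
    show "(\<lambda>\<omega>. h x (\<zeta> i \<omega>) - hbar x) \<in> borel_measurable M" for x i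
    proof -
      have "(\<lambda>\<omega>. (x, \<zeta> i \<omega>)) \<in> measurable M (borel \<Otimes>\<^sub>M Z)" using noise(2) by measurable
      from measurable_compose[OF this h_meas] show ?thesis by simp
    qed
    fix x and \<epsilon> :: real assume "\<epsilon> > 0"
    then have \<epsilon>2: "\<epsilon> / 2 > 0" by simp
    obtain \<delta> where \<delta>: "\<delta> > 0" "\<And>y z. dist y x < \<delta> \<Longrightarrow> z \<in> space Z \<Longrightarrow> dist (h y z) (h x z) < \<epsilon> / 2"
      using h_cont[OF \<epsilon>2, of x] by blast
    obtain \<delta>' where \<delta>': "\<delta>' > 0" "\<And>y. dist y x < \<delta>' \<Longrightarrow> dist (hbar y) (hbar x) < \<epsilon> / 2"
      using A_iii(1) \<epsilon>2 unfolding continuous_on_iff by (metis UNIV_I)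
    have "norm ((h y (\<zeta> i \<omega>) - hbar y) - (h x (\<zeta> i \<omega>) - hbar x)) \<le> \<epsilon>"
      if "dist y x < min \<delta> \<delta>'" "\<omega> \<in> space M" for y i \<omega>
    proof -
      have "norm ((h y (\<zeta> i \<omega>) - hbar y) - (h x (\<zeta> i \<omega>) - hbar x))
          = norm ((h y (\<zeta> i \<omega>) - h x (\<zeta> i \<omega>)) - (hbar y - hbar x))" by (simp add: algebra_simps)
      also have "\<dots> \<le> dist (h y (\<zeta> i \<omega>)) (h x (\<zeta> i \<omega>)) + dist (hbar y) (hbar x)"
        unfolding dist_norm by (rule norm_triangle_ineq4)
      also have "\<dots> \<le> \<epsilon> / 2 + \<epsilon> / 2"
        using \<delta>(2)[of y "\<zeta> i \<omega>"] \<delta>'(2)[of y] \<zeta>_space[OF that(2), of i] that(1)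
        by (intro add_mono) (auto intro: less_imp_le)
      finally show ?thesis by simp
    qed
    then show "\<exists>\<delta>>0. \<forall>y. dist y x < \<delta> \<longrightarrow>
        (\<forall>i. \<forall>\<omega>\<in>space M. norm ((h y (\<zeta> i \<omega>) - hbar y) - (h x (\<zeta> i \<omega>) - hbar x)) \<le> \<epsilon>)"
      using \<delta>(1) \<delta>'(1) by (intro exI[of _ "min \<delta> \<delta>'"]) auto
  qed

  obtain T0 where T0: "T0 > 0" "averages_out M a T0 (\<lambda>i \<omega>. h0 (\<zeta>' i \<omega>))" using A_iv_h0(2) by blast
  have AE_h0: "AE \<omega> in M. averages_to_zero T0 (\<lambda>i. h0 (\<zeta>' i \<omega>))"
    by (rule AE_averages_to_zero[OF prob measurable_compose[OF noise(3) A_iv_h0(1)] T0])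

  have good: "AE \<omega> in M. asymptotic_trajectory F (trajectory (\<lambda>n. X n \<omega>))"
    using AE_space AE_m AE_h AE_h0 A_v(3) X_bounded
  proof eventually_elim
    case (elim \<omega>)
    \<comment> \<open>The three noise conditions come with window lengths of their own.\<close>
    define T where "T = min Tm (min Th T0)"
    have T: "T > 0" "T \<le> Tm" "T \<le> Th" "T \<le> T0" using Tm_pos Th(1) T0(1) by (auto simp: T_def)
    have "(\<lambda>n. \<beta> n \<omega>) \<longlonglongrightarrow> 0" using elim(5) by (rule tendsto_norm_zero_cancel)
    then have e: "averages_to_zero T (\<lambda>i. h0 (\<zeta>' i \<omega>) + \<beta> i \<omega>)"
      by (intro averages_to_zero_add averages_to_zero_vanishing averages_to_zero_mono[OF elim(4)] T)
    have "follows F (\<lambda>n. X n \<omega>)"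
      unfolding F_def
    proof (rule follows_if_noise_averages[where B = "\<lambda>i y. b i y (\<xi> i \<omega>)" and H = "\<lambda>i y. h y (\<zeta> i \<omega>)"
          and m = "\<lambda>i y. m i y (\<xi> i \<omega>)", OF G_vals(1,3) G_ball G_graph _ _ _ _ _ T(1) _ _ e])
      show "X (Suc i) \<omega> = X i \<omega> + a i *\<^sub>R (b i (X i \<omega>) (\<xi> i \<omega>) + h (X i \<omega>) (\<zeta> i \<omega>) + (h0 (\<zeta>' i \<omega>) + \<beta> i \<omega>))" for i
        using algorithm[OF elim(1), of i] by (simp add: scaleR_add_right)
      show "b i y (\<xi> i \<omega>) \<in> {g + m i y (\<xi> i \<omega>) *\<^sub>R u | g u. g \<in> G y \<and> u \<in> cball 0 1}" for i y
        by (rule b[rule_format, OF \<xi>_space[OF elim(1)]])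
      show "m i y (\<xi> i \<omega>) > 0" for i y by (rule m_pos[rule_format, OF \<xi>_space[OF elim(1)]])
      show "averages_to_zero T (\<lambda>i. m i p (\<xi> i \<omega>))" for p
        using averages_to_zero_mono[OF _ T(2)] elim(2) by blast
      show "averages_to_zero T (\<lambda>i. h p (\<zeta> i \<omega>) - hbar p)" for p
        using averages_to_zero_mono[OF _ T(3)] elim(3) by blast
      fix p and \<eta> :: real assume \<eta>: "\<eta> > 0"
      show "\<exists>\<delta>>0. \<forall>y. dist y p < \<delta> \<longrightarrow> (\<forall>i. \<bar>m i y (\<xi> i \<omega>) - m i p (\<xi> i \<omega>)\<bar> < \<eta>)"
        using m_cont[rule_format, OF \<eta>, of p] \<xi>_space[OF elim(1)] by blast
      show "\<exists>\<delta>>0. \<forall>y. dist y p < \<delta> \<longrightarrow> (\<forall>i. dist (h y (\<zeta> i \<omega>)) (h p (\<zeta> i \<omega>)) < \<eta>)"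
        using h_cont[OF \<eta>, of p] \<zeta>_space[OF elim(1)] by blast
    qed
    then show ?case by (rule trajectory_asymptotic[OF _ F_compact elim(6)])
  qed

  have pathwise: "(bounded (\<Union>n. range (Xs \<omega> n)) \<and> equicontinuous_on_bounded_intervals (Xs \<omega>)) \<and>
           (\<forall>Y. limit_of_subsequence (Xs \<omega>) Y \<longrightarrow>
              di_solution F UNIV Y \<and> internally_chain_transitive F (limit_set Y)) \<and>
           limit_points (\<lambda>n. X n \<omega>) \<subseteq> chain_recurrent_points F"
    if traj: "asymptotic_trajectory F (trajectory (\<lambda>n. X n \<omega>))" for \<omega>
  proof (intro conjI allI impI)
    interpret asymptotic_trajectory F "trajectory (\<lambda>n. X n \<omega>)" by (rule traj)
    show "bounded (\<Union>n. range (Xs \<omega> n))"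
      unfolding Xs_def by (rule bounded_shifted_interpolations[OF bounded])
    show "equicontinuous_on_bounded_intervals (Xs \<omega>)"
      unfolding Xs_def by (rule equicontinuous_shifted_interpolations[OF unif])
    show "limit_points (\<lambda>n. X n \<omega>) \<subseteq> chain_recurrent_points F"
      using limit_points_in_limit_set limit_set_chain_recurrent by (rule order_trans)
    fix Y assume "limit_of_subsequence (Xs \<omega>) Y"
    then have Y: "shift_limit (trajectory (\<lambda>n. X n \<omega>)) Y"
      unfolding Xs_def by (rule limit_of_subsequence_shift_limit)
    show "di_solution F UNIV Y" by (rule solution[OF Y])
    show "internally_chain_transitive F (limit_set Y)"
      by (rule asymptotic_trajectory.limit_set_internally_chain_transitive[OF shift_limit_asymptotic_trajectory[OF Y]])
  qed

  obtain N where N: "{\<omega>\<in>space M. \<not> asymptotic_trajectory F (trajectory (\<lambda>n. X n \<omega>))} \<subseteq> N" "N \<in> null_sets M"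
    using good unfolding eventually_ae_filter by blast

  have attracted: "AE \<omega> in M. (\<exists>\<^sub>\<infinity>n. X n \<omega> \<in> K) \<longrightarrow> (\<lambda>n. infdist (X n \<omega>) \<Lambda>) \<longlonglongrightarrow> 0"
    if "locally_asymptotically_stable F \<Lambda>" "compact K" "K \<subseteq> domain_of_attraction F \<Lambda>" for \<Lambda> K
    using good
  proof eventually_elim
    case (elim \<omega>)
    then show ?case using converges_to_stable_set[OF elim that(1) compact_imp_closed[OF that(2)] that(3)] by blast
  qed

  have conv_sets: "{\<omega>\<in>space M. (\<lambda>n. infdist (X n \<omega>) \<Lambda>) \<longlonglongrightarrow> 0} \<in> sets M" for \<Lambda>
  proof -
    have [measurable]: "(\<lambda>\<omega>. infdist (X n \<omega>) \<Lambda>) \<in> borel_measurable M" for n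
    proof (rule measurable_compose[OF state])
      show "(\<lambda>x. infdist x \<Lambda>) \<in> borel_measurable borel"
        by (intro borel_measurable_continuous_onI continuous_intros)
    qed
    have "(\<lambda>n. infdist (X n \<omega>) \<Lambda>) \<longlonglongrightarrow> 0 \<longleftrightarrow> (\<forall>k. \<exists>N. \<forall>n. n \<ge> N \<longrightarrow> infdist (X n \<omega>) \<Lambda> < 1 / real (Suc k))" for \<omega>
    proof
      assume conv: "(\<lambda>n. infdist (X n \<omega>) \<Lambda>) \<longlonglongrightarrow> 0"
      have "1 / real (Suc k) > 0" for k by simp
      then show "\<forall>k. \<exists>N. \<forall>n. n \<ge> N \<longrightarrow> infdist (X n \<omega>) \<Lambda> < 1 / real (Suc k)"
        using order_tendstoD(2)[OF conv] unfolding eventually_sequentially by blast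
    next
      assume *: "\<forall>k. \<exists>N. \<forall>n. n \<ge> N \<longrightarrow> infdist (X n \<omega>) \<Lambda> < 1 / real (Suc k)"
      show "(\<lambda>n. infdist (X n \<omega>) \<Lambda>) \<longlonglongrightarrow> 0"
      proof (rule metric_LIMSEQ_I)
        fix e :: real assume "e > 0"
        then obtain k where k: "1 / real (Suc k) < e" using nat_approx_posE by blast
        obtain N where "\<And>n. n \<ge> N \<Longrightarrow> infdist (X n \<omega>) \<Lambda> < 1 / real (Suc k)" using * by blast
        then have "dist (infdist (X n \<omega>) \<Lambda>) 0 < e" if "n \<ge> N" for n
          using k less_trans that by (fastforce simp: infdist_nonneg)
        then show "\<exists>N. \<forall>n\<ge>N. dist (infdist (X n \<omega>) \<Lambda>) 0 < e" by blast
      qed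
    qed
    then show ?thesis by (simp only:) measurable
  qed

  show ?thesis
  proof (intro conjI allI impI)
    show "\<exists>N\<in>null_sets M. \<forall>\<omega>\<in>space M - N.
           (bounded (\<Union>n. range (Xs \<omega> n)) \<and> equicontinuous_on_bounded_intervals (Xs \<omega>)) \<and>
           (\<forall>Y. limit_of_subsequence (Xs \<omega>) Y \<longrightarrow>
              di_solution F UNIV Y \<and> internally_chain_transitive F (limit_set Y)) \<and>
           limit_points (\<lambda>n. X n \<omega>) \<subseteq> chain_recurrent_points F"
      by (rule bexI[OF _ N(2)], rule ballI, rule pathwise) (use N(1) in blast)
    fix \<Lambda> K assume K: "locally_asymptotically_stable F \<Lambda>" "compact K" "K \<subseteq> domain_of_attraction F \<Lambda>"
    show "AE \<omega> in M. (\<lambda>n. infdist (X n \<omega>) \<Lambda>) \<longlonglongrightarrow> 0" if "AE \<omega> in M. \<exists>\<^sub>\<infinity>n. X n \<omega> \<in> K"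
      using that attracted[OF K] by eventually_elim simp
    fix \<rho> assume \<rho>: "\<rho> \<le> prob {\<omega>\<in>space M. \<exists>\<^sub>\<infinity>n. X n \<omega> \<in> K}"
    have "prob {\<omega>\<in>space M. \<exists>\<^sub>\<infinity>n. X n \<omega> \<in> K} \<le> prob {\<omega>\<in>space M. (\<lambda>n. infdist (X n \<omega>) \<Lambda>) \<longlonglongrightarrow> 0}"
      by (rule finite_measure_mono_AE[OF _ conv_sets]) (use attracted[OF K] in eventually_elim, simp)
    then show "\<rho> \<le> prob {\<omega>\<in>space M. (\<lambda>n. infdist (X n \<omega>) \<Lambda>) \<longlonglongrightarrow> 0}" using \<rho> by simp
  qed
qed

end
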